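(* Let $k\ge 1$. In the dynamic streaming model there is an algorithm for the parameterized (unweighted) $k$-matching problem such that, on input $(\mathcal{S},k)$, where $\mathcal{S}$ is a dynamic stream of an unweighted graph $G$, the algorithm outputs a matching $M'$ satisfying: (1) if $G$ contains a $k$-matching then, with probability at least $1-\frac{11}{20k^3\ln(2k)}$, $M'$ is a $k$-matching of $G$; and (2) if $G$ does not contain a $k$-matching then $M'=\emptyset$. Moreover, the algorithm runs in $\tilde{O}(k^2)$ space and has $\tilde{O}(1)$ update time.
   Context: All graphs are undirected and simple. A matching is a set of edges no two of which share an endpoint; a $k$-matching is a matching with exactly $k$ edges. Dynamic graph streaming model: the vertex set is $V=\{0,\dots,n-1\}$; the graph is given as a stream (of length polynomial in $n$) of edge insertions and edge deletions, and $G$ consists of the edges inserted and not subsequently deleted. The update time is the time to process one stream element; the space includes the space to maintain the sketch and to answer the query. $\tilde{O}(\cdot)$ hides factors polylogarithmic in the input size. *)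

theory Defs
  imports "HOL-Probability.Probability" "HOL-Library.Log_Nat"
begin

text \<open>
  A simple graph on the vertices \<open>0, \<dots>, n - 1\<close> is given by its set of edges, each edge being
  a two-element set of vertices.
\<close>

definition is_matching :: "nat set set \<Rightarrow> nat set set \<Rightarrow> bool" where
  "is_matching E M \<longleftrightarrow> M \<subseteq> E \<and> pairwise disjnt M"

definition is_k_matching :: "nat set set \<Rightarrow> nat \<Rightarrow> nat set set \<Rightarrow> bool" where
  "is_k_matching E k M \<longleftrightarrow> is_matching E M \<and> finite M \<and> card M = k"

datatype edge_update = Ins nat nat | Del nat nat

fun apply_update :: "nat set set \<Rightarrow> edge_update \<Rightarrow> nat set set" where
  "apply_update E (Ins u v) = insert {u, v} E"
| "apply_update E (Del u v) = E - {{u, v}}"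

definition stream_graph :: "edge_update list \<Rightarrow> nat set set" where
  "stream_graph \<sigma> = foldl apply_update {} \<sigma>"

text \<open>
  The graph stays simple throughout: only absent edges are inserted, only present edges are
  deleted. The two endpoints of an edge may be presented in either order.
\<close>

fun legal_update :: "nat \<Rightarrow> nat set set \<Rightarrow> edge_update \<Rightarrow> bool" where
  "legal_update n E (Ins u v) \<longleftrightarrow> u < n \<and> v < n \<and> u \<noteq> v \<and> {u, v} \<notin> E"
| "legal_update n E (Del u v) \<longleftrightarrow> {u, v} \<in> E"

fun legal_updates :: "nat \<Rightarrow> nat set set \<Rightarrow> edge_update list \<Rightarrow> bool" where
  "legal_updates n E [] \<longleftrightarrow> True"
| "legal_updates n E (x # \<sigma>) \<longleftrightarrow> legal_update n E x \<and> legal_updates n (apply_update E x) \<sigma>"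

definition dynamic_stream :: "nat \<Rightarrow> edge_update list \<Rightarrow> bool" where
  "dynamic_stream n \<sigma> \<longleftrightarrow> legal_updates n {} \<sigma>"

text \<open>
  The machine model is the logarithmic-cost RAM of Aho, Hopcroft and Ullman, with structured
  control flow and an instruction that tosses a fair coin. The coins are read once, in order,
  from an infinite tape; the tape is not memory, so a program that needs an earlier coin again
  has to store it.
\<close>

type_synonym mem = "nat \<Rightarrow> nat"
type_synonym config = "mem \<times> bool stream"

datatype loc = Dir nat | Ind nat
datatype operand = Const nat | Cell loc
datatype binop = Add | Sub | Mul | Div | Mod | Less

datatype com =
    Skip
  | Set loc binop operand operand
  | Flip loc
  | Seq com com
  | If operand com com
  | While operand com

fun addr :: "loc \<Rightarrow> mem \<Rightarrow> nat" where
  "addr (Dir a) s = a"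
| "addr (Ind a) s = s a"

fun val :: "operand \<Rightarrow> mem \<Rightarrow> nat" where
  "val (Const c) s = c"
| "val (Cell l) s = s (addr l s)"

text \<open>Subtraction is truncated, and \<open>x div 0 = 0\<close>, \<open>x mod 0 = x\<close>, as in HOL.\<close>

fun bop :: "binop \<Rightarrow> nat \<Rightarrow> nat \<Rightarrow> nat" where
  "bop Add x y = x + y"
| "bop Sub x y = x - y"
| "bop Mul x y = x * y"
| "bop Div x y = x div y"
| "bop Mod x y = x mod y"
| "bop Less x y = (if x < y then 1 else 0)"

definition bits :: "nat \<Rightarrow> nat" where
  "bits x = max 1 (floorlog 2 x)"

fun loc_cost :: "loc \<Rightarrow> mem \<Rightarrow> nat" where
  "loc_cost (Dir a) s = bits a"
| "loc_cost (Ind a) s = bits a + bits (s a)"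

fun operand_cost :: "operand \<Rightarrow> mem \<Rightarrow> nat" where
  "operand_cost (Const c) s = bits c"
| "operand_cost (Cell l) s = loc_cost l s + bits (s (addr l s))"

text \<open>
  The number of bits of a memory image: every nonzero cell is written down together with its
  address. Only finitely many cells are nonzero in a configuration reachable from an initial one.
\<close>

definition mem_bits :: "mem \<Rightarrow> nat" where
  "mem_bits s = (\<Sum>a | s a \<noteq> 0. bits a + bits (s a))"

text \<open>
  \<open>exec c cf t m cf'\<close>: program \<open>c\<close> started in configuration \<open>cf\<close> terminates in \<open>cf'\<close>, taking time
  \<open>t\<close>, and \<open>m\<close> is the maximum of \<open>mem_bits\<close> over all configurations passed on the way.
\<close>

inductive exec :: "com \<Rightarrow> config \<Rightarrow> nat \<Rightarrow> nat \<Rightarrow> config \<Rightarrow> bool" where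
  Skip: "exec Skip (s, \<omega>) 1 (mem_bits s) (s, \<omega>)"
| Set: "z = bop f (val x s) (val y s) \<Longrightarrow> s' = s(addr d s := z) \<Longrightarrow>
    exec (Set d f x y) (s, \<omega>)
      (1 + operand_cost x s + operand_cost y s + loc_cost d s + bits z)
      (max (mem_bits s) (mem_bits s')) (s', \<omega>)"
| Flip: "s' = s(addr d s := of_bool b) \<Longrightarrow>
    exec (Flip d) (s, b ## \<omega>) (1 + loc_cost d s) (max (mem_bits s) (mem_bits s')) (s', \<omega>)"
| Seq: "exec c1 cf t1 m1 cf' \<Longrightarrow> exec c2 cf' t2 m2 cf'' \<Longrightarrow>
    exec (Seq c1 c2) cf (t1 + t2) (max m1 m2) cf''"
| IfTrue: "val x s \<noteq> 0 \<Longrightarrow> exec c1 (s, \<omega>) t m cf' \<Longrightarrow>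
    exec (If x c1 c2) (s, \<omega>) (1 + operand_cost x s + t) m cf'"
| IfFalse: "val x s = 0 \<Longrightarrow> exec c2 (s, \<omega>) t m cf' \<Longrightarrow>
    exec (If x c1 c2) (s, \<omega>) (1 + operand_cost x s + t) m cf'"
| WhileFalse: "val x s = 0 \<Longrightarrow>
    exec (While x c) (s, \<omega>) (1 + operand_cost x s) (mem_bits s) (s, \<omega>)"
| WhileTrue: "val x s \<noteq> 0 \<Longrightarrow> exec c (s, \<omega>) t1 m1 cf' \<Longrightarrow> exec (While x c) cf' t2 m2 cf'' \<Longrightarrow>
    exec (While x c) (s, \<omega>) (1 + operand_cost x s + t1 + t2) (max m1 m2) cf''"

text \<open>
  One fixed triple of programs serves all inputs. The numbers \<open>n\<close> and \<open>k\<close> are supplied in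
  cells 0 and 1 before initialization; each stream element is placed in cells 2 (operation),
  3 and 4 (endpoints) before the update program runs. After the query program has run, cell 2
  holds the number of output edges and cell 3 the address of the array of their endpoints.
\<close>

record stream_alg =
  init_prog :: com
  update_prog :: com
  query_prog :: com

definition initial_mem :: "nat \<Rightarrow> nat \<Rightarrow> mem" where
  "initial_mem n k = (\<lambda>_. 0)(0 := n, 1 := k)"

fun feed :: "edge_update \<Rightarrow> config \<Rightarrow> config" where
  "feed (Ins u v) (s, \<omega>) = (s(2 := 1, 3 := u, 4 := v), \<omega>)"
| "feed (Del u v) (s, \<omega>) = (s(2 := 0, 3 := u, 4 := v), \<omega>)"

definition output_edges :: "mem \<Rightarrow> nat set set" where
  "output_edges s = {{s (s 3 + 2 * i), s (s 3 + 2 * i + 1)} | i. i < s 2}"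

text \<open>Here the time is the maximum, not the sum, over the stream elements.\<close>

inductive process :: "com \<Rightarrow> edge_update list \<Rightarrow> config \<Rightarrow> nat \<Rightarrow> nat \<Rightarrow> config \<Rightarrow> bool" where
  Nil: "process U [] cf 0 0 cf"
| Cons: "exec U (feed x cf) t m cf' \<Longrightarrow> process U \<sigma> cf' t' m' cf'' \<Longrightarrow>
    process U (x # \<sigma>) cf (max t t') (max m m') cf''"

text \<open>
  \<open>run A n k \<sigma> \<omega> M T S\<close>: on the stream \<open>\<sigma>\<close> and the coin tape \<open>\<omega>\<close>, the algorithm \<open>A\<close> terminates
  with output \<open>M\<close>; \<open>T\<close> is its update time and \<open>S\<close> its space in bits, taken over
  initialization, all updates and the query.
\<close>

inductive run :: "stream_alg \<Rightarrow> nat \<Rightarrow> nat \<Rightarrow> edge_update list \<Rightarrow> bool stream \<Rightarrow>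
    nat set set \<Rightarrow> nat \<Rightarrow> nat \<Rightarrow> bool" where
  "exec (init_prog A) (initial_mem n k, \<omega>) t0 m0 cf0 \<Longrightarrow>
   process (update_prog A) \<sigma> cf0 T m1 cf1 \<Longrightarrow>
   exec (query_prog A) cf1 t2 m2 (s, \<omega>') \<Longrightarrow>
   run A n k \<sigma> \<omega> (output_edges s) T (max m0 (max m1 m2))"

definition coin_tape :: "bool stream measure" where
  "coin_tape = stream_space (measure_pmf (bernoulli_pmf (1/2)))"

inductive_cases SkipE: "exec Skip cf t m cf'"
inductive_cases SetE: "exec (Set d f x y) cf t m cf'"
inductive_cases FlipE: "exec (Flip d) cf t m cf'"
inductive_cases SeqE: "exec (Seq c1 c2) cf t m cf'"
inductive_cases IfE: "exec (If x c1 c2) cf t m cf'"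
inductive_cases WhileE: "exec (While x c) cf t m cf'"

lemma exec_deterministic:
  "exec c cf t m cf' \<Longrightarrow> exec c cf t2 m2 cf2 \<Longrightarrow> t2 = t \<and> m2 = m \<and> cf2 = cf'"
proof (induction arbitrary: t2 m2 cf2 rule: exec.induct)
  case (Skip s \<omega>)
  then show ?case by (auto elim: SkipE)
next
  case (Set z f x s y s' d \<omega>)
  from Set.prems show ?case by (elim SetE) (simp add: Set.hyps)
next
  case (Flip s' s d b \<omega>)
  from Flip.prems show ?case by (elim FlipE) (simp add: Flip.hyps)
next
  case (Seq c1 cf ta ma cfa c2 tb mb cfb)
  from Seq.prems obtain ta' ma' cfa' tb' mb' where
    *: "exec c1 cf ta' ma' cfa'" "exec c2 cfa' tb' mb' cf2" "t2 = ta' + tb'" "m2 = max ma' mb'"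
    by (elim SeqE)
  from Seq.IH(1)[OF *(1)] have a: "ta' = ta \<and> ma' = ma \<and> cfa' = cfa" .
  from a *(2) have "exec c2 cfa tb' mb' cf2" by simp
  from Seq.IH(2)[OF this] a *(3,4) show ?case by simp
next
  case (IfTrue x s c1 \<omega> t m cf' c2)
  from IfTrue.prems IfTrue.hyps(1) obtain t' where
    *: "exec c1 (s, \<omega>) t' m2 cf2" "t2 = 1 + operand_cost x s + t'"
    by (elim IfE) auto
  from IfTrue.IH[OF *(1)] *(2) show ?case by simp
next
  case (IfFalse x s c2 \<omega> t m cf' c1)
  from IfFalse.prems IfFalse.hyps(1) obtain t' where
    *: "exec c2 (s, \<omega>) t' m2 cf2" "t2 = 1 + operand_cost x s + t'"
    by (elim IfE) auto
  from IfFalse.IH[OF *(1)] *(2) show ?case by simp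
next
  case (WhileFalse x s c \<omega>)
  from WhileFalse.prems show ?case by (rule WhileE) (use WhileFalse.hyps in auto)
next
  case (WhileTrue x s c \<omega> ta ma cfa tb mb cfb)
  from WhileTrue.prems obtain ta' ma' cfa' tb' mb' where
    *: "exec c (s, \<omega>) ta' ma' cfa'" "exec (While x c) cfa' tb' mb' cf2"
      "t2 = 1 + operand_cost x s + ta' + tb'" "m2 = max ma' mb'"
    by (rule WhileE) (use WhileTrue.hyps(1) in auto)
  from WhileTrue.IH(1)[OF *(1)] have a: "ta' = ta \<and> ma' = ma \<and> cfa' = cfa" .
  from a *(2) have "exec (While x c) cfa tb' mb' cf2" by simp
  from WhileTrue.IH(2)[OF this] a *(3,4) show ?case by simp
qed

inductive_cases process_NilE: "process U [] cf t m cf'"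
inductive_cases process_ConsE: "process U (x # \<sigma>) cf t m cf'"

lemma process_deterministic:
  "process U \<sigma> cf t m cf' \<Longrightarrow> process U \<sigma> cf t2 m2 cf2 \<Longrightarrow> t2 = t \<and> m2 = m \<and> cf2 = cf'"
proof (induction arbitrary: t2 m2 cf2 rule: process.induct)
  case (Nil U cf)
  then show ?case by (auto elim: process_NilE)
next
  case (Cons U x cf t m cf' \<sigma> t' m' cf'')
  from Cons.prems obtain ta ma cfa tb mb where
    *: "exec U (feed x cf) ta ma cfa" "process U \<sigma> cfa tb mb cf2"
      "t2 = max ta tb" "m2 = max ma mb"
    by (elim process_ConsE)
  from exec_deterministic[OF Cons.hyps(1) *(1)] have a: "ta = t \<and> ma = m \<and> cfa = cf'" .
  from a *(2) have "process U \<sigma> cf' tb mb cf2" by simp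
  from Cons.IH[OF this] a *(3,4) show ?case by simp
qed

lemma run_deterministic:
  assumes "run A n k \<sigma> \<omega> M T S" and "run A n k \<sigma> \<omega> M' T' S'"
  shows "M' = M \<and> T' = T \<and> S' = S"
  using assms(1)
proof cases
  case 1: (1 t0 m0 cf0 m1 cf1 t2 m2 s \<omega>1)
  from assms(2) show ?thesis
  proof cases
    case 2: (1 t0' m0' cf0' m1' cf1' t2' m2' s' \<omega>1')
    have a: "m0' = m0 \<and> cf0' = cf0"
      using exec_deterministic[OF 1(3) 2(3)] by simp
    have b: "T' = T \<and> m1' = m1 \<and> cf1' = cf1"
      using process_deterministic[OF 1(4) 2(4)[unfolded a[THEN conjunct2]]] by simp
    have c: "m2' = m2 \<and> s' = s"
      using exec_deterministic[OF 1(5) 2(5)[unfolded b[THEN conjunct2, THEN conjunct2]]] by simp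
    show ?thesis using a b c 1 2 by simp
  qed
qed

end

theory Submission
  imports Defs "HOL-Number_Theory.Cong"
begin

text \<open>
  A hash function into \<open>O(k\<^sup>2)\<close> values separates the \<open>2 k\<close> vertices of a fixed \<open>k\<close>-matching, so a
  random table indexed by hash values spreads them independently over \<open>8 k\<close> groups, none of which
  receives more than logarithmically many. In each group one of logarithmically many further tables
  with polylogarithmic range separates the vertices. Group and table value give every vertex of the
  matching its own label. For each pair of labels, and each pair of table indices, the sketch keeps
  the sum of the edges between the labels, subsampled at all rates \<open>1 / 2 ^ j\<close>; since multiplicities are 0
  or 1, it is decidable without error whether a sum consists of one edge only. With good probability
  every pair of labels joined by a matching edge has a sum with a single edge, and such edges form a
  \<open>k\<close>-matching because their labels are distinct. Independent repetitions reduce the failure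
  probability; the query searches all sequences of \<open>k\<close> recovered edges for a matching.

  If \<open>2 k > n\<close>, there is no \<open>k\<close>-matching, and the programs do nothing.
\<close>

section \<open>Expressions and loops on the RAM\<close>

text \<open>Space dictates the shape. Buckets are indexed by pairs of labels, so only about
  \<open>k\<close> labels are affordable, whereas one hash function needs about \<open>k ^ 2\<close>
  values to separate \<open>2 * k\<close> vertices; hence labels in two levels. A random table
  indexed by vertices would take \<open>n\<close> cells, so vertices are hashed to
  \<open>256 * k ^ 2\<close> values first. Which table separates a group depends on the unknown
  matching, so this choice exists only in the analysis, and the sketch serves every pair of table
  indices. The machine has random bits but no primes at hand, so hashing works modulo a power of
  two. One number \<open>q = 32 * (l + 5)\<close>, with \<open>l\<close> the binary logarithm of
  \<open>n\<close> rounded up, is the word length and the number of tables, of sampling seeds, of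
  rates and of repetitions; an update visits one bucket in each of \<open>q ^ 5\<close> families.
  The search of the query takes exponential time, but it is charged for space only, and its counter
  needs just about \<open>q * k\<close> bits. The requirement for graphs without a
  \<open>k\<close>-matching holds for all coins; bad luck can only lose a matching.\<close>

lemma bits_ge1: "bits x \<ge> 1" by (simp add: bits_def)

lemma bits_le_iff: "v \<ge> 1 \<Longrightarrow> bits x \<le> v \<longleftrightarrow> x < 2 ^ v"
  by (auto simp: bits_def floorlog_le_iff)

lemma less_two_power_bits: "x < 2 ^ bits x"
  using bits_le_iff[OF bits_ge1, of x x] by simp

lemma bits_leI: "x < 2 ^ v \<Longrightarrow> v \<ge> 1 \<Longrightarrow> bits x \<le> v"
  by (simp add: bits_le_iff)

lemma bits_mono: "x \<le> y \<Longrightarrow> bits x \<le> bits y"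
  using less_two_power_bits[of y] bits_le_iff[OF bits_ge1, of x y] by simp

text \<open>Multiplication is the worst case: a product adds the lengths, and every other operation
  stays within the same bound. This is what \<open>sz\<close> accumulates along an
  expression.\<close>

lemma bits_bop: "bits (bop f x y) \<le> bits x + bits y"
proof -
  have x: "x < 2 ^ bits x" and y: "y < 2 ^ bits y" by (rule less_two_power_bits)+
  have p: "(2::nat) ^ (bits x + bits y) = 2 ^ bits x * 2 ^ bits y" by (simp add: power_add)
  have "bits x + bits y \<ge> 1" using bits_ge1[of x] by simp
  moreover have "bop f x y < 2 ^ (bits x + bits y)"
  proof (cases f)
    case Add
    have "(2::nat) \<le> 2 ^ bits x" "(2::nat) \<le> 2 ^ bits y"
      using power_increasing[OF bits_ge1, of "2::nat"] by simp_all
    moreover have "u + v < a * b" if "u < a" "v < b" "2 \<le> a" "2 \<le> b" for u v a b :: nat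
    proof -
      have "u + v \<le> (a - 1) + (b - 1)" using that by simp
      also have "\<dots> < a * b"
      proof -
        obtain a' b' where "a = 2 + a'" "b = 2 + b'"
          using \<open>2 \<le> a\<close> \<open>2 \<le> b\<close> le_Suc_ex by blast
        then show ?thesis by simp
      qed
      finally show ?thesis .
    qed
    ultimately show ?thesis using Add x y p by simp
  next
    case Mul
    then show ?thesis using mult_strict_mono[OF x y] by (simp add: p)
  next
    case Less
    have "(2::nat) ^ 1 \<le> 2 ^ (bits x + bits y)"
      using bits_ge1[of x] by (intro power_increasing) auto
    then show ?thesis using Less by simp
  next
    case Sub
    have "x - y < 2 ^ bits x" using x by simp
    then show ?thesis using Sub p by (simp add: less_le_trans)
  next
    case Div
    have "x div y < 2 ^ bits x" using x by (meson div_le_dividend le_less_trans)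
    then show ?thesis using Div p by (simp add: less_le_trans)
  next
    case Mod
    have "x mod y < 2 ^ bits x" using x by (meson mod_less_eq_dividend le_less_trans)
    then show ?thesis using Mod p by (simp add: less_le_trans)
  qed
  ultimately show ?thesis by (simp add: bits_le_iff)
qed

lemma mem_bits_upd: "mem_bits (s(a := z)) \<le> mem_bits s + bits a + bits z"
proof (cases "finite {b. s b \<noteq> 0}")
  case True
  let ?g = "\<lambda>b. bits b + bits ((s(a := z)) b)"
  have "mem_bits (s(a := z)) \<le> (\<Sum>b\<in>insert a ({b. s b \<noteq> 0} - {a}). ?g b)"
    unfolding mem_bits_def using True by (intro sum_mono2) auto
  also have "\<dots> = ?g a + (\<Sum>b\<in>{b. s b \<noteq> 0} - {a}. bits b + bits (s b))"
    using True by (subst sum.insert) (auto intro!: sum.cong)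
  also have "(\<Sum>b\<in>{b. s b \<noteq> 0} - {a}. bits b + bits (s b)) \<le> mem_bits s"
    unfolding mem_bits_def using True by (intro sum_mono2) auto
  finally show ?thesis by simp
next
  \<comment> \<open>An infinite sum is 0 by convention, and infinitely many nonzero cells remain
    after changing one.\<close>
  case False
  have "{b. s b \<noteq> 0} \<subseteq> insert a {b. (s(a := z)) b \<noteq> 0}" by auto
  then have "infinite {b. (s(a := z)) b \<noteq> 0}" using False finite_subset by blast
  then have "mem_bits (s(a := z)) = 0" unfolding mem_bits_def by (rule sum.infinite)
  then show ?thesis by simp
qed

lemma bits_addr: "bits (addr d s) \<le> loc_cost d s"
  by (cases d) auto

text \<open>Every bit of memory that a program claims has to be written, so time dominates space growth.\<close>

lemma exec_mem:
  "exec c cf t m cf' \<Longrightarrow> m \<le> mem_bits (fst cf) + t \<and> mem_bits (fst cf') \<le> mem_bits (fst cf) + t"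
proof (induction rule: exec.induct)
  case (Set z f x s y s' d \<omega>)
  then show ?case using mem_bits_upd[of s "addr d s" z] bits_addr[of d s] by (simp del: fun_upd_apply)
next
  case (Flip s' s d b \<omega>)
  have "bits (of_bool b) = 1" by (cases b) (simp_all add: bits_def floorlog_def)
  then show ?case using Flip mem_bits_upd[of s "addr d s" "of_bool b"] bits_addr[of d s] by (simp del: fun_upd_apply of_bool_eq)
qed auto

section \<open>Compiling nested expressions and loops\<close>

text \<open>The machine combines two operands per instruction. Correctness and cost of nested
  expressions are proved once, so that the programs below can be written and bounded at this
  level.\<close>

datatype ex = Nm nat | Rg nat | Ld ex | Op binop ex ex

fun valex :: "mem \<Rightarrow> ex \<Rightarrow> nat" where
  "valex s (Nm c) = c"
| "valex s (Rg r) = s r"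
| "valex s (Ld e) = s (valex s e)"
| "valex s (Op f a b) = bop f (valex s a) (valex s b)"

text \<open>Keeps the evaluation stack out of the cells that an expression reads; then the
  intermediate results of an evaluation do not disturb its value (\<open>ev_upd\<close>).\<close>

fun readable :: "mem \<Rightarrow> ex \<Rightarrow> bool" where
  "readable s (Nm c) = True"
| "readable s (Rg r) = (r \<notin> {20..<100})"
| "readable s (Ld e) = (readable s e \<and> valex s e \<notin> {20..<100})"
| "readable s (Op f a b) = (readable s a \<and> readable s b)"

text \<open>Number of stack cells used above the first: the right operand is evaluated one cell
  higher, while the left value waits below.\<close>

fun depth :: "ex \<Rightarrow> nat" where
  "depth (Nm c) = 0"
| "depth (Rg r) = 0"
| "depth (Ld e) = depth e"
| "depth (Op f a b) = max (depth a) (Suc (depth b))"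

definition zero :: "nat \<Rightarrow> com" where
  "zero r = Set (Dir r) Add (Const 0) (Const 0)"

text \<open>Cells 20 to 99 serve as an evaluation stack, which is empty (all zero) between statements.\<close>

fun cmp :: "nat \<Rightarrow> ex \<Rightarrow> com" where
  "cmp d (Nm c) = Set (Dir d) Add (Const c) (Const 0)"
| "cmp d (Rg r) = Set (Dir d) Add (Cell (Dir r)) (Const 0)"
| "cmp d (Ld e) = Seq (cmp d e) (Set (Dir d) Add (Cell (Ind d)) (Const 0))"
| "cmp d (Op f a b) = Seq (cmp d a) (Seq (cmp (Suc d) b)
     (Seq (Set (Dir d) f (Cell (Dir d)) (Cell (Dir (Suc d)))) (zero (Suc d))))"

text \<open>Bit length of the value in units of a bound \<open>V\<close> on the length of every
  cell; by \<open>bits_bop\<close> the lengths of operands add (\<open>bits_ev\<close>).\<close>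

fun sz :: "ex \<Rightarrow> nat" where
  "sz (Nm c) = bits c"
| "sz (Rg r) = 1"
| "sz (Ld e) = 1"
| "sz (Op f a b) = sz a + sz b"

text \<open>Running time of \<open>cmp\<close> in the same units; the additive constants absorb the
  stack addresses.\<close>

fun ecost :: "ex \<Rightarrow> nat" where
  "ecost (Nm c) = 10 + 2 * bits c"
| "ecost (Rg r) = 10 + bits r"
| "ecost (Ld e) = ecost e + 10 + sz e"
| "ecost (Op f a b) = ecost a + ecost b + 2 * sz a + 2 * sz b + 10"

definition clean :: "nat \<Rightarrow> mem \<Rightarrow> bool" where
  "clean d s \<longleftrightarrow> (\<forall>a\<in>{d..<100}. s a = 0)"

text \<open>\<open>V \<ge> 7\<close> makes every address below 128, hence every register and stack
  address, cost at most \<open>V\<close>.\<close>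

definition vbound :: "nat \<Rightarrow> mem \<Rightarrow> bool" where
  "vbound V s \<longleftrightarrow> V \<ge> 7 \<and> (\<forall>a. s a < 2 ^ V)"

lemma vbound_bits: "vbound V s \<Longrightarrow> bits (s a) \<le> V"
  unfolding vbound_def by (intro bits_leI) auto

lemma bits_small: "d < 128 \<Longrightarrow> bits d \<le> 7"
  by (intro bits_leI) auto

lemma bits_0: "bits 0 = 1" by (simp add: bits_def floorlog_def)

lemma bits_ev: "vbound V s \<Longrightarrow> bits (valex s e) \<le> sz e * V"
proof (induction e)
  case (Nm x)
  then show ?case by (auto simp: vbound_def)
next
  case (Op f a b)
  then show ?case using bits_bop[of f "valex s a" "valex s b"] by (simp add: add_mult_distrib)
qed (auto simp: vbound_bits)

lemma ev_upd: "readable s e \<Longrightarrow> a \<in> {20..<100} \<Longrightarrow> valex (s(a := x)) e = valex s e"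
  by (induction e) auto

lemma readable_upd: "readable s e \<Longrightarrow> a \<in> {20..<100} \<Longrightarrow> readable (s(a := x)) e"
  by (induction e) (auto simp: ev_upd)

lemma clean_upd: "clean d s \<Longrightarrow> clean (Suc d) (s(d := x))"
  by (auto simp: clean_def)

lemma exec_Set:
  assumes "s' = s(addr d s := bop f (val x s) (val y s))"
    and "1 + operand_cost x s + operand_cost y s + loc_cost d s + bits (bop f (val x s) (val y s)) \<le> t"
  shows "\<exists>t' m. exec (Set d f x y) (s, \<omega>) t' m (s', \<omega>) \<and> t' \<le> t"
  using exec.Set[OF refl assms(1)] assms(2) by blast

lemma exec_Seq:
  assumes "\<exists>t' m. exec c1 cf t' m cf' \<and> t' \<le> t1" "\<exists>t' m. exec c2 cf' t' m cf'' \<and> t' \<le> t2"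
    and "t1 + t2 \<le> t"
  shows "\<exists>t' m. exec (Seq c1 c2) cf t' m cf'' \<and> t' \<le> t"
  using assms exec.Seq by (meson add_mono order_trans)

lemma exec_zero:
  assumes "a < 100" "s' = s(a := 0)"
  shows "\<exists>t' m. exec (zero a) (s, \<omega>) t' m (s', \<omega>) \<and> t' \<le> 11"
  unfolding zero_def using bits_small[of a] assms by (intro exec_Set) (auto simp: bits_0)

text \<open>The bound \<open>V\<close> is assumed outside the stack only: the stack cells below
  \<open>d\<close> hold intermediate values, which may be longer than \<open>V\<close> bits.\<close>

lemma cmp_correct:
  assumes "clean d s" "readable s e" "20 \<le> d" "d + depth e < 100"
    and "V \<ge> 7" "\<And>a. a \<notin> {20..<100} \<Longrightarrow> s a < 2 ^ V"
  shows "\<exists>t m. exec (cmp d e) (s, \<omega>) t m (s(d := valex s e), \<omega>) \<and> t \<le> ecost e * V"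
  using assms
proof (induction e arbitrary: d s)
  case (Nm c)
  have "1 \<le> V" "bits d \<le> 7" using Nm by (auto intro: bits_small)
  moreover obtain b where "bits c \<le> b" and b: "ecost (Nm c) * V = 10 * V + 2 * b"
    using Nm by (intro that[of "bits c * V"]) (simp_all add: algebra_simps)
  ultimately show ?case using Nm(5)
    unfolding cmp.simps b by (intro exec_Set) (auto simp: bits_0)
next
  case (Rg r)
  have "1 \<le> V" "bits d \<le> 7" using Rg by (auto intro: bits_small)
  moreover obtain b where "bits r \<le> b" and b: "ecost (Rg r) * V = 10 * V + b"
    using Rg by (intro that[of "bits r * V"]) (simp_all add: algebra_simps)
  moreover have "bits (s r) \<le> V" using Rg(2,5,6) by (intro bits_leI) auto
  ultimately show ?case using Rg(5)
    unfolding cmp.simps b by (intro exec_Set) (auto simp: bits_0)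
next
  case (Ld e)
  \<comment> \<open>With the stack erased, \<open>vbound\<close> holds and readable expressions keep
    their values, so \<open>bits_ev\<close> applies.\<close>
  define s0 where "s0 = (\<lambda>a. if a \<in> {20..<100} then 0 else s a)"
  have vb: "vbound V s0" using Ld.prems(5,6) by (auto simp: vbound_def s0_def)
  have ev0: "valex s0 e' = valex s e'" if "readable s e'" for e'
    using that by (induction e') (auto simp: s0_def)
  have b1: "bits (valex s e) \<le> sz e * V" using bits_ev[OF vb, of e] ev0[of e] Ld.prems(2) by simp
  have b2: "bits (s (valex s e)) \<le> V" using Ld.prems(2,5,6) by (intro bits_leI) auto
  have b3: "bits d \<le> 7" using Ld.prems by (intro bits_small) auto
  let ?s = "s(d := valex s e)"
  have "valex s e \<noteq> d" using Ld.prems by auto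
  then have 2: "\<exists>t m. exec (Set (Dir d) Add (Cell (Ind d)) (Const 0)) (?s, \<omega>) t m (s(d := valex s (Ld e)), \<omega>)
      \<and> t \<le> (10 + sz e) * V"
    using b1 b2 b3 Ld.prems(5) by (intro exec_Set) (auto simp: bits_0 algebra_simps)
  have 1: "\<exists>t m. exec (cmp d e) (s, \<omega>) t m (?s, \<omega>) \<and> t \<le> ecost e * V"
    using Ld.prems by (intro Ld.IH) auto
  show ?case
    unfolding cmp.simps by (rule exec_Seq[OF 1 2]) (simp add: algebra_simps)
next
  case (Op f a b)
  define s0 where "s0 = (\<lambda>a. if a \<in> {20..<100} then 0 else s a)"
  have vb: "vbound V s0" using Op.prems(5,6) by (auto simp: vbound_def s0_def)
  have ev0: "valex s0 e' = valex s e'" if "readable s e'" for e'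
    using that by (induction e') (auto simp: s0_def)
  have b1: "bits (valex s a) \<le> sz a * V" using bits_ev[OF vb, of a] ev0[of a] Op.prems(2) by simp
  have b2: "bits (valex s b) \<le> sz b * V" using bits_ev[OF vb, of b] ev0[of b] Op.prems(2) by simp
  have b3: "bits d \<le> 7" "bits (Suc d) \<le> 7" using Op.prems by (auto intro: bits_small)
  let ?s1 = "s(d := valex s a)"
  let ?s2 = "?s1(Suc d := valex s b)"
  let ?s3 = "?s2(d := valex s (Op f a b))"
  have d: "Suc d < 100" "d \<in> {20..<100}" using Op.prems by auto
  have 1: "\<exists>t m. exec (cmp d a) (s, \<omega>) t m (?s1, \<omega>) \<and> t \<le> ecost a * V"
    using Op.prems by (intro Op.IH(1)) auto
  have evb: "valex ?s1 b = valex s b" using Op.prems d by (intro ev_upd) auto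
  have 2: "\<exists>t m. exec (cmp (Suc d) b) (?s1, \<omega>) t m (?s2, \<omega>) \<and> t \<le> ecost b * V"
  proof -
    have "clean (Suc d) ?s1" "readable ?s1 b" using Op.prems d by (auto intro: clean_upd readable_upd)
    moreover have "?s1 x < 2 ^ V" if "x \<notin> {20..<100}" for x using Op.prems(6)[OF that] that d by auto
    ultimately have "\<exists>t m. exec (cmp (Suc d) b) (?s1, \<omega>) t m (?s1(Suc d := valex ?s1 b), \<omega>) \<and> t \<le> ecost b * V"
      using Op.prems by (intro Op.IH(2)) (auto simp del: fun_upd_apply)
    then show ?thesis unfolding evb .
  qed
  have 3: "\<exists>t m. exec (Set (Dir d) f (Cell (Dir d)) (Cell (Dir (Suc d)))) (?s2, \<omega>) t m (?s3, \<omega>)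
      \<and> t \<le> (2 * sz a + 2 * sz b + 4) * V"
    using b1 b2 b3 Op.prems(5) bits_bop[of f "valex s a" "valex s b"]
    by (intro exec_Set) (auto simp: bits_0 algebra_simps)
  have "s (Suc d) = 0" using Op.prems(1) d by (auto simp: clean_def)
  then have 4: "\<exists>t m. exec (zero (Suc d)) (?s3, \<omega>) t m (s(d := valex s (Op f a b)), \<omega>) \<and> t \<le> 11"
    using d by (intro exec_zero) auto
  show ?case
    unfolding cmp.simps
    by (rule exec_Seq[OF 1 exec_Seq[OF 2 exec_Seq[OF 3 4 order_refl] order_refl]])
      (use Op.prems(5) in \<open>auto simp: algebra_simps\<close>)
qed

definition Store :: "ex \<Rightarrow> ex \<Rightarrow> com" where
  "Store a e = Seq (cmp 20 a) (Seq (cmp 21 e)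
     (Seq (Set (Ind 20) Add (Cell (Dir 21)) (Const 0)) (Seq (zero 21) (zero 20))))"

text \<open>The condition is evaluated into cell 20 before the loop and after each round. Each round
  first clears that cell, and at the exit it holds 0, so the stack is empty wherever an invariant
  has to hold.\<close>

definition WhileE :: "ex \<Rightarrow> com \<Rightarrow> com" where
  "WhileE e c = Seq (cmp 20 e) (While (Cell (Dir 20)) (Seq (zero 20) (Seq c (cmp 20 e))))"

definition scost :: "ex \<Rightarrow> ex \<Rightarrow> nat" where
  "scost a e = ecost a + ecost e + sz a + 2 * sz e + 10"

lemma Store_correct:
  assumes "clean 20 s" "vbound V s" "readable s a" "readable s e" "depth a < 79" "depth e < 79"
    and "valex s a \<notin> {20..<100}" "s' = s(valex s a := valex s e)"
  shows "\<exists>t m. exec (Store a e) (s, \<omega>) t m (s', \<omega>) \<and> t \<le> scost a e * V"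
proof -
  have V: "V \<ge> 7" using assms(2) by (simp add: vbound_def)
  let ?s1 = "s(20 := valex s a)"
  let ?s2 = "?s1(21 := valex s e)"
  have 1: "\<exists>t m. exec (cmp 20 a) (s, \<omega>) t m (?s1, \<omega>) \<and> t \<le> ecost a * V"
    using assms by (intro cmp_correct) (auto simp: vbound_def)
  have eve: "valex ?s1 e = valex s e" using assms by (intro ev_upd) auto
  have "clean 21 ?s1" using clean_upd[OF assms(1)] by simp
  moreover have "readable ?s1 e" using assms by (intro readable_upd) auto
  ultimately have 2: "\<exists>t m. exec (cmp 21 e) (?s1, \<omega>) t m (?s2, \<omega>) \<and> t \<le> ecost e * V"
    using assms cmp_correct[of 21 ?s1 e V \<omega>] unfolding eve by (force simp: vbound_def)
  let ?s3 = "?s2(valex s a := valex s e)"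
  have 3: "\<exists>t m. exec (Set (Ind 20) Add (Cell (Dir 21)) (Const 0)) (?s2, \<omega>) t m (?s3, \<omega>)
      \<and> t \<le> (sz a + 2 * sz e + 5) * V"
    using bits_ev[OF assms(2), of a] bits_ev[OF assms(2), of e] bits_small[of 20] bits_small[of 21] V
    by (intro exec_Set) (auto simp: bits_0 algebra_simps)
  let ?s4 = "?s3(21 := 0)"
  have 4: "\<exists>t m. exec (zero 21) (?s3, \<omega>) t m (?s4, \<omega>) \<and> t \<le> 11"
    by (intro exec_zero) auto
  have "s 20 = 0" "s 21 = 0" using assms(1) by (auto simp: clean_def)
  then have 5: "\<exists>t m. exec (zero 20) (?s4, \<omega>) t m (s', \<omega>) \<and> t \<le> 11"
    using assms by (intro exec_zero) auto
  show ?thesis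
    unfolding Store_def scost_def
    by (rule exec_Seq[OF 1 exec_Seq[OF 2 exec_Seq[OF 3 exec_Seq[OF 4 5 order_refl] order_refl] order_refl]])
      (use V in \<open>auto simp: algebra_simps\<close>)
qed

text \<open>The invariant carries the round number, so a loop is handled by naming its number
  \<open>M\<close> of rounds. The extra round in the bound pays for the first evaluation of the
  condition and the failing test.\<close>

lemma WhileE_time:
  assumes inv: "\<And>i s \<omega>. I i s \<omega> \<Longrightarrow> i \<le> M \<Longrightarrow>
      clean 20 s \<and> vbound V s \<and> readable s e \<and> (valex s e \<noteq> 0 \<longleftrightarrow> i < M)"
    and body: "\<And>i s \<omega>. I i s \<omega> \<Longrightarrow> i < M \<Longrightarrow>
      \<exists>s' \<omega>' t m. exec c (s, \<omega>) t m (s', \<omega>') \<and> I (Suc i) s' \<omega>' \<and> t \<le> tb"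
    and e: "depth e < 79"
    and "I 0 s \<omega>"
  shows "\<exists>s' \<omega>' t m. exec (WhileE e c) (s, \<omega>) t m (s', \<omega>') \<and> I M s' \<omega>'
      \<and> t \<le> (M + 1) * (tb + (ecost e + sz e + 4) * V)"
proof -
  let ?w = "While (Cell (Dir 20)) (Seq (zero 20) (Seq c (cmp 20 e)))"
  have cmp: "\<exists>t m. exec (cmp 20 e) (s, \<omega>) t m (s(20 := valex s e), \<omega>) \<and> t \<le> ecost e * V"
    if "I i s \<omega>" "i \<le> M" for i s \<omega>
    using inv[OF that] e by (intro cmp_correct) (auto simp: vbound_def)
  have loop: "\<exists>s' \<omega>' t m. exec ?w (s(20 := valex s e), \<omega>) t m (s', \<omega>') \<and> I M s' \<omega>'
      \<and> t \<le> j * (tb + (ecost e + sz e + 4) * V) + 9 + sz e * V"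
    if "I i s \<omega>" "i + j = M" for i j s \<omega>
    using that
  proof (induction j arbitrary: i s \<omega>)
    case 0
    have ii: "valex s e = 0" "clean 20 s" using inv[OF 0(1)] 0(2) by auto
    have se: "s(20 := valex s e) = s" using ii by (auto simp: clean_def)
    have "exec ?w (s, \<omega>) (1 + operand_cost (Cell (Dir 20)) s) (mem_bits s) (s, \<omega>)"
      by (rule exec.WhileFalse) (use ii in \<open>auto simp: clean_def\<close>)
    moreover have "1 + operand_cost (Cell (Dir 20)) s \<le> 9"
      using ii bits_small[of 20] by (auto simp: clean_def bits_0)
    ultimately show ?case using 0 se by (intro exI[of _ s] exI[of _ \<omega>] exI conjI) auto
  next
    case (Suc j)
    have ii: "valex s e \<noteq> 0" "clean 20 s" "vbound V s" using inv[OF Suc.prems(1)] Suc.prems(2) by auto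
    have V: "V \<ge> 7" using ii by (simp add: vbound_def)
    let ?s = "s(20 := valex s e)"
    obtain s1 w1 t1 m1 where b: "exec c (s, \<omega>) t1 m1 (s1, w1)" "I (Suc i) s1 w1" "t1 \<le> tb"
      using body[OF Suc.prems(1)] Suc.prems(2) by fastforce
    obtain t2 m2 where c: "exec (cmp 20 e) (s1, w1) t2 m2 (s1(20 := valex s1 e), w1)" "t2 \<le> ecost e * V"
      using cmp[OF b(2)] Suc.prems(2) by auto
    obtain s3 w3 t3 m3 where d: "exec ?w (s1(20 := valex s1 e), w1) t3 m3 (s3, w3)" "I M s3 w3"
      "t3 \<le> j * (tb + (ecost e + sz e + 4) * V) + 9 + sz e * V"
      using Suc.IH[OF b(2)] Suc.prems(2) by (auto simp del: fun_upd_apply)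
    have "s 20 = 0" using ii by (auto simp: clean_def)
    then have s: "s = ?s(20 := 0)" by auto
    have "(20 :: nat) < 100" by simp
    from exec_zero[OF this s] obtain t0 m0 where z: "exec (zero 20) (?s, \<omega>) t0 m0 (s, \<omega>)" "t0 \<le> 11"
      by blast
    have "exec ?w (?s, \<omega>) (1 + operand_cost (Cell (Dir 20)) ?s + (t0 + (t1 + t2)) + t3)
        (max (max m0 (max m1 m2)) m3) (s3, w3)"
      by (rule exec.WhileTrue[OF _ exec.Seq[OF z(1) exec.Seq[OF b(1) c(1)]] d(1)]) (use ii in auto)
    moreover have "operand_cost (Cell (Dir 20)) ?s \<le> 7 + sz e * V"
      using bits_small[of 20] bits_ev[OF ii(3), of e] by simp
    then have "1 + operand_cost (Cell (Dir 20)) ?s + (t0 + (t1 + t2)) + t3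
        \<le> Suc j * (tb + (ecost e + sz e + 4) * V) + 9 + sz e * V"
      using z(2) b(3) c(2) d(3) V by (simp add: algebra_simps)
    ultimately show ?case using d(2) by blast
  qed
  obtain t1 m1 where a: "exec (cmp 20 e) (s, \<omega>) t1 m1 (s(20 := valex s e), \<omega>)" "t1 \<le> ecost e * V"
    using cmp[OF assms(4)] by auto
  obtain s2 w2 t2 m2 where b: "exec ?w (s(20 := valex s e), \<omega>) t2 m2 (s2, w2)" "I M s2 w2"
      "t2 \<le> M * (tb + (ecost e + sz e + 4) * V) + 9 + sz e * V"
    using loop[OF assms(4), of M] by auto
  have V: "V \<ge> 7" using inv[OF assms(4)] by (simp add: vbound_def)
  show ?thesis
    unfolding WhileE_def
    using exec.Seq[OF a(1) b(1)] a(2) b(2,3) V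
    by (intro exI[of _ s2] exI[of _ w2] exI conjI) (auto simp: algebra_simps)
qed

section \<open>Executions with a space bound only\<close>

text \<open>Initialization and query are charged for space only. Unlike time, this bound does not
  grow under sequencing, which matters for the exponentially long search.\<close>

definition runm :: "nat \<Rightarrow> com \<Rightarrow> config \<Rightarrow> config \<Rightarrow> bool" where
  "runm M c cf cf' \<longleftrightarrow> (\<exists>t m. exec c cf t m cf' \<and> m \<le> M)"

lemma runm_Seq: "runm M a cf cf' \<Longrightarrow> runm M b cf' cf'' \<Longrightarrow> runm M (Seq a b) cf cf''"
  unfolding runm_def using exec.Seq by (metis max.bounded_iff)

text \<open>\<open>exec_mem\<close> turns the short time of a single statement into its extra space,
  so only the memory between statements has to be bounded.\<close>

lemma runm_Store:
  assumes "clean 20 s" "vbound V s" "readable s a" "readable s e" "depth a < 79" "depth e < 79"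
    and "valex s a \<notin> {20..<100}" "s' = s(valex s a := valex s e)"
    and "mem_bits s + scost a e * V \<le> M"
  shows "runm M (Store a e) (s, \<omega>) (s', \<omega>)"
proof -
  obtain t m where "exec (Store a e) (s, \<omega>) t m (s', \<omega>)" "t \<le> scost a e * V"
    using Store_correct[OF assms(1-8)] by blast
  then show ?thesis using exec_mem[of "Store a e" "(s, \<omega>)" t m "(s', \<omega>)"] assms(9)
    by (auto simp: runm_def intro!: exI)
qed

lemma runm_Flip:
  assumes "s' = s(r := of_bool (shd \<omega>))" "mem_bits s \<le> M" "mem_bits s' \<le> M"
  shows "runm M (Flip (Dir r)) (s, \<omega>) (s', stl \<omega>)"
  using exec.Flip[of s' s "Dir r" "shd \<omega>" "stl \<omega>"] assms by (auto simp: runm_def intro!: exI)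

lemma runm_WhileE:
  assumes inv: "\<And>i s \<omega>. I i s \<omega> \<Longrightarrow> i \<le> M \<Longrightarrow>
      clean 20 s \<and> vbound V s \<and> readable s e \<and> (valex s e \<noteq> 0 \<longleftrightarrow> i < M)
      \<and> mem_bits s + (ecost e + sz e + 4) * V \<le> B"
    and body: "\<And>i s \<omega>. I i s \<omega> \<Longrightarrow> i < M \<Longrightarrow> \<exists>s' \<omega>'. runm B c (s, \<omega>) (s', \<omega>') \<and> I (Suc i) s' \<omega>'"
    and e: "depth e < 79"
    and "I 0 s \<omega>"
  shows "\<exists>s' \<omega>'. runm B (WhileE e c) (s, \<omega>) (s', \<omega>') \<and> I M s' \<omega>'"
proof -
  let ?w = "While (Cell (Dir 20)) (Seq (zero 20) (Seq c (cmp 20 e)))"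
  have cmp: "runm B (cmp 20 e) (s, \<omega>) (s(20 := valex s e), \<omega>)"
    if "I i s \<omega>" "i \<le> M" for i s \<omega>
  proof -
    have "\<exists>t m. exec (cmp 20 e) (s, \<omega>) t m (s(20 := valex s e), \<omega>) \<and> t \<le> ecost e * V"
      using inv[OF that] e by (intro cmp_correct) (auto simp: vbound_def)
    then obtain t m where t: "exec (cmp 20 e) (s, \<omega>) t m (s(20 := valex s e), \<omega>)" "t \<le> ecost e * V"
      by blast
    then show ?thesis using exec_mem[OF t(1)] inv[OF \<open>I i s \<omega>\<close> \<open>i \<le> M\<close>]
      by (auto simp: runm_def algebra_simps intro!: exI)
  qed
  have loop: "\<exists>s' \<omega>'. runm B ?w (s(20 := valex s e), \<omega>) (s', \<omega>') \<and> I M s' \<omega>'"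
    if "I i s \<omega>" "i + j = M" for i j s \<omega>
    using that
  proof (induction j arbitrary: i s \<omega>)
    case 0
    have ii: "valex s e = 0" "clean 20 s" "mem_bits s \<le> B" using inv[OF 0(1)] 0(2) by auto
    have se: "s(20 := valex s e) = s" using ii by (auto simp: clean_def)
    have "exec ?w (s, \<omega>) (1 + operand_cost (Cell (Dir 20)) s) (mem_bits s) (s, \<omega>)"
      by (rule exec.WhileFalse) (use ii in \<open>auto simp: clean_def\<close>)
    then show ?case using 0 se ii by (auto simp: runm_def intro!: exI)
  next
    case (Suc j)
    have ii: "valex s e \<noteq> 0" "clean 20 s" "vbound V s" "mem_bits s + (ecost e + sz e + 4) * V \<le> B"
      using inv[OF Suc.prems(1)] Suc.prems(2) by auto
    have V: "V \<ge> 7" using ii by (simp add: vbound_def)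
    let ?s = "s(20 := valex s e)"
    obtain s1 w1 where b: "runm B c (s, \<omega>) (s1, w1)" "I (Suc i) s1 w1"
      using body[OF Suc.prems(1)] Suc.prems(2) by fastforce
    have c: "runm B (cmp 20 e) (s1, w1) (s1(20 := valex s1 e), w1)"
      using cmp[OF b(2)] Suc.prems(2) by auto
    obtain s3 w3 where d: "runm B ?w (s1(20 := valex s1 e), w1) (s3, w3)" "I M s3 w3"
      using Suc.IH[OF b(2)] Suc.prems(2) by (auto simp del: fun_upd_apply)
    have "s 20 = 0" using ii by (auto simp: clean_def)
    then have s: "s = ?s(20 := 0)" by auto
    have "(20 :: nat) < 100" by simp
    from exec_zero[OF this s] obtain t0 m0 where z: "exec (zero 20) (?s, \<omega>) t0 m0 (s, \<omega>)" "t0 \<le> 11"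
      by blast
    have "mem_bits ?s \<le> mem_bits s + 7 + sz e * V"
      using mem_bits_upd[of s 20 "valex s e"] bits_small[of 20] bits_ev[OF ii(3), of e] by simp
    then have "m0 \<le> B" using exec_mem[OF z(1)] z(2) ii(4) V by (simp add: algebra_simps)
    then have "runm B (Seq (zero 20) (Seq c (cmp 20 e))) (?s, \<omega>) (s1(20 := valex s1 e), w1)"
      using z by (intro runm_Seq[OF _ runm_Seq[OF b(1) c]]) (auto simp: runm_def)
    then have "runm B ?w (?s, \<omega>) (s3, w3)"
    proof -
      assume "runm B (Seq (zero 20) (Seq c (cmp 20 e))) (?s, \<omega>) (s1(20 := valex s1 e), w1)"
      then obtain t m t' m' where
        "exec (Seq (zero 20) (Seq c (cmp 20 e))) (?s, \<omega>) t m (s1(20 := valex s1 e), w1)" "m \<le> B"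
        "exec ?w (s1(20 := valex s1 e), w1) t' m' (s3, w3)" "m' \<le> B"
        using d(1) unfolding runm_def by blast
      moreover have "val (Cell (Dir 20)) ?s \<noteq> 0" using ii(1) by simp
      ultimately show ?thesis unfolding runm_def using exec.WhileTrue by (metis max.bounded_iff)
    qed
    then show ?case using d(2) by blast
  qed
  show ?thesis
    unfolding WhileE_def using runm_Seq[OF cmp[OF assms(4)]] loop[OF assms(4), of M] by force
qed

section \<open>Counting and hashing\<close>

text \<open>Probability at most \<open>p\<close> under the uniform distribution on a finite product,
  phrased by counting; \<open>measure_coin_tape_prefix\<close> later connects it to the
  tape.\<close>

definition rare :: "real \<Rightarrow> 'i set \<Rightarrow> ('i \<Rightarrow> 'a set) \<Rightarrow> (('i \<Rightarrow> 'a) \<Rightarrow> bool) \<Rightarrow> bool" where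
  "rare p I A Q \<longleftrightarrow> real (card {Y \<in> PiE I A. Q Y}) \<le> p * real (card (PiE I A))"

lemma rare_mono:
  assumes "rare p I A Q" "p \<le> p'" "finite I" "\<And>i. i \<in> I \<Longrightarrow> finite (A i)"
    and "\<And>Y. Y \<in> PiE I A \<Longrightarrow> Q' Y \<Longrightarrow> Q Y"
  shows "rare p' I A Q'"
proof -
  have "finite (PiE I A)" using assms by (intro finite_PiE) auto
  then have "card {Y \<in> PiE I A. Q' Y} \<le> card {Y \<in> PiE I A. Q Y}"
    using assms by (intro card_mono) auto
  then have "real (card {Y \<in> PiE I A. Q' Y}) \<le> real (card {Y \<in> PiE I A. Q Y})" by simp
  also have "\<dots> \<le> p * real (card (PiE I A))" using assms by (simp add: rare_def)
  also have "\<dots> \<le> p' * real (card (PiE I A))" using assms by (intro mult_right_mono) auto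
  finally show ?thesis by (simp add: rare_def)
qed

lemma rare_Bex:
  assumes "finite X" "\<And>x. x \<in> X \<Longrightarrow> rare p I A (Q x)" "finite I" "\<And>i. i \<in> I \<Longrightarrow> finite (A i)"
  shows "rare (real (card X) * p) I A (\<lambda>Y. \<exists>x\<in>X. Q x Y)"
proof -
  have "card {Y \<in> PiE I A. \<exists>x\<in>X. Q x Y} = card (\<Union>x\<in>X. {Y \<in> PiE I A. Q x Y})"
    by (intro arg_cong[of _ _ card]) auto
  also have "\<dots> \<le> (\<Sum>x\<in>X. card {Y \<in> PiE I A. Q x Y})"
    using assms by (intro card_UN_le) auto
  finally have "real (card {Y \<in> PiE I A. \<exists>x\<in>X. Q x Y}) \<le> (\<Sum>x\<in>X. real (card {Y \<in> PiE I A. Q x Y}))"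
    by (simp flip: of_nat_sum)
  also have "\<dots> \<le> (\<Sum>x\<in>X. p * real (card (PiE I A)))"
    using assms(2) by (intro sum_mono) (simp add: rare_def)
  finally show ?thesis by (simp add: rare_def mult.assoc)
qed

lemma rare_disj:
  assumes "rare p I A Q" "rare p' I A Q'" "finite I" "\<And>i. i \<in> I \<Longrightarrow> finite (A i)"
  shows "rare (p + p') I A (\<lambda>Y. Q Y \<or> Q' Y)"
proof -
  have "card {Y \<in> PiE I A. Q Y \<or> Q' Y} = card ({Y \<in> PiE I A. Q Y} \<union> {Y \<in> PiE I A. Q' Y})"
    by (intro arg_cong[of _ _ card]) auto
  also have "\<dots> \<le> card {Y \<in> PiE I A. Q Y} + card {Y \<in> PiE I A. Q' Y}" by (rule card_Un_le)
  finally show ?thesis using assms by (simp add: rare_def algebra_simps)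
qed

text \<open>Conditioning on the coordinates in \<open>J\<close>: the product splits into the fibres
  of the restriction to \<open>J\<close>, and a bound valid on each fibre carries over to the
  whole.\<close>

lemma rare_fix:
  assumes "finite I" "\<And>i. i \<in> I \<Longrightarrow> finite (A i)" "J \<subseteq> I"
    and "\<And>Z. Z \<in> PiE J A \<Longrightarrow> rare p I (\<lambda>i. if i \<in> J then {Z i} else A i) Q"
  shows "rare p I A Q"
proof -
  let ?A = "\<lambda>Z i. if i \<in> J then {Z i} else A i"
  have fin: "finite (PiE J A)" "finite (PiE I A)"
    using assms finite_subset by (auto intro!: finite_PiE)
  have eq: "{Y \<in> {Y \<in> PiE I A. P Y}. restrict Y J = Z} = {Y \<in> PiE I (?A Z). P Y}"
    if Z: "Z \<in> PiE J A" for P Z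
  proof (intro set_eqI iffI)
    fix Y assume "Y \<in> {Y \<in> {Y \<in> PiE I A. P Y}. restrict Y J = Z}"
    then show "Y \<in> {Y \<in> PiE I (?A Z). P Y}" by (auto simp: PiE_iff restrict_def)
  next
    fix Y assume Y: "Y \<in> {Y \<in> PiE I (?A Z). P Y}"
    then have "Y i = Z i" if "i \<in> J" for i using that assms(3) by (force simp: PiE_iff)
    moreover have "Z i = undefined" if "i \<notin> J" for i using Z that by (auto simp: PiE_iff extensional_def)
    ultimately have "restrict Y J = Z" by (auto simp: restrict_def)
    moreover have "Y i \<in> A i" if "i \<in> I" for i
      using Y Z that assms(3) by (auto simp: PiE_iff split: if_splits)
    ultimately show "Y \<in> {Y \<in> {Y \<in> PiE I A. P Y}. restrict Y J = Z}" using Y by (auto simp: PiE_iff)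
  qed
  have sum: "card {Y \<in> PiE I A. P Y} = (\<Sum>Z\<in>PiE J A. card {Y \<in> PiE I (?A Z). P Y})" for P
  proof -
    have "card {Y \<in> PiE I A. P Y} = (\<Sum>Y\<in>{Y \<in> PiE I A. P Y}. 1)" by simp
    also have "\<dots> = (\<Sum>Z\<in>PiE J A. \<Sum>Y\<in>{Y \<in> {Y \<in> PiE I A. P Y}. restrict Y J = Z}. 1)"
      using fin assms(3) by (intro sum.group[symmetric]) (auto simp: PiE_iff intro: rev_finite_subset)
    also have "\<dots> = (\<Sum>Z\<in>PiE J A. card {Y \<in> PiE I (?A Z). P Y})"
      by (intro sum.cong refl) (subst eq, auto)
    finally show ?thesis .
  qed
  have "real (card {Y \<in> PiE I A. Q Y}) = (\<Sum>Z\<in>PiE J A. real (card {Y \<in> PiE I (?A Z). Q Y}))"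
    by (simp add: sum)
  also have "\<dots> \<le> (\<Sum>Z\<in>PiE J A. p * real (card (PiE I (?A Z))))"
    using assms(4) by (intro sum_mono) (simp add: rare_def)
  also have "\<dots> = p * real (card (PiE I A))"
    using sum[of "\<lambda>_. True"] by (simp add: sum_distrib_left)
  finally show ?thesis by (simp add: rare_def)
qed

text \<open>Once the coordinates outside \<open>D\<close> are fixed, the bad event forces each
  coordinate in \<open>D\<close> into a small set of its own. These sets may depend on the fixed
  coordinates but not on the others in \<open>D\<close>, so their proportions multiply.\<close>

lemma rare_indep:
  assumes "finite I" "\<And>i. i \<in> I \<Longrightarrow> finite (A i)" "D \<subseteq> I"
    and "\<And>Z. Z \<in> PiE (I - D) A \<Longrightarrow> \<exists>F. \<forall>i\<in>D. F i \<subseteq> A i \<and> real (card (F i)) \<le> p * real (card (A i))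
        \<and> (\<forall>Y\<in>PiE I A. (\<forall>j. j \<notin> D \<longrightarrow> Y j = Z j) \<and> Q Y \<longrightarrow> Y i \<in> F i)"
  shows "rare (p ^ card D) I A Q"
proof (rule rare_fix[where J = "I - D"])
  fix Z assume Z: "Z \<in> PiE (I - D) A"
  let ?A = "\<lambda>i. if i \<in> I - D then {Z i} else A i"
  obtain F where F: "\<And>i. i \<in> D \<Longrightarrow> F i \<subseteq> A i" "\<And>i. i \<in> D \<Longrightarrow> real (card (F i)) \<le> p * real (card (A i))"
    "\<And>i Y. i \<in> D \<Longrightarrow> Y \<in> PiE I A \<Longrightarrow> (\<And>j. j \<notin> D \<Longrightarrow> Y j = Z j) \<Longrightarrow> Q Y \<Longrightarrow> Y i \<in> F i"
    using assms(4)[OF Z] by metis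
  have finD: "finite D" using assms(1,3) finite_subset by blast
  have sub: "{Y \<in> PiE I ?A. Q Y} \<subseteq> PiE I (\<lambda>i. if i \<in> D then F i else {Z i})"
  proof
    fix Y assume Y: "Y \<in> {Y \<in> PiE I ?A. Q Y}"
    have eq: "Y j = Z j" if "j \<notin> D" for j
    proof (cases "j \<in> I")
      case True
      then show ?thesis using Y that by (force simp: PiE_iff)
    next
      case False
      then show ?thesis using Y Z by (auto simp: PiE_iff extensional_def)
    qed
    have "Y i \<in> A i" if "i \<in> I" for i
    proof (cases "i \<in> D")
      case True
      then show ?thesis using Y that by (force simp: PiE_iff)
    next
      case False
      then show ?thesis using eq[OF False] Z that by (auto simp: PiE_iff)
    qed
    then have "Y \<in> PiE I A" using Y by (auto simp: PiE_iff)
    then have "Y i \<in> F i" if "i \<in> D" for i using F(3) that eq Y by blast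
    then show "Y \<in> PiE I (\<lambda>i. if i \<in> D then F i else {Z i})"
      using eq Y by (auto simp: PiE_iff)
  qed
  have "finite (F i)" if "i \<in> D" for i using F(1)[OF that] assms(2,3) that finite_subset by blast
  then have "finite (PiE I (\<lambda>i. if i \<in> D then F i else {Z i}))"
    using assms(1) by (intro finite_PiE) auto
  then have "real (card {Y \<in> PiE I ?A. Q Y}) \<le> real (card (PiE I (\<lambda>i. if i \<in> D then F i else {Z i})))"
    using sub by (simp add: card_mono)
  also have "\<dots> = (\<Prod>i\<in>I. if i \<in> D then real (card (F i)) else 1)"
    using assms(1) by (simp add: card_PiE of_nat_prod if_distrib cong: if_cong)
  also have "\<dots> = (\<Prod>i\<in>D. real (card (F i)))"
    using assms(1,3) by (simp add: prod.If_cases Int_absorb1)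
  also have "\<dots> \<le> (\<Prod>i\<in>D. p * real (card (A i)))"
    using F(2) by (intro prod_mono) auto
  also have "\<dots> = p ^ card D * (\<Prod>i\<in>D. real (card (A i)))"
    by (simp add: prod.distrib)
  also have "(\<Prod>i\<in>D. real (card (A i))) = (\<Prod>i\<in>I. if i \<in> D then real (card (A i)) else 1)"
    using assms(1,3) by (simp add: prod.If_cases Int_absorb1)
  also have "\<dots> = (\<Prod>i\<in>I. real (card (?A i)))"
    by (intro prod.cong) auto
  also have "\<dots> = real (card (PiE I ?A))" using assms(1) by (simp only: card_PiE of_nat_prod)
  finally show "rare (p ^ card D) I ?A Q" by (simp add: rare_def)
qed (use assms in auto)

text \<open>Reducing a uniform number below \<open>N\<close> modulo \<open>G\<close> is biased by
  rounding; since \<open>G \<le> N\<close>, the factor 2 covers it.\<close>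

lemma card_mod_eq_le: "G > 0 \<Longrightarrow> G \<le> N \<Longrightarrow> real (card {x \<in> {..<N}. x mod G = r}) \<le> 2 / real G * real N"
proof -
  assume G: "G > 0" "G \<le> N"
  have "card {x \<in> {..<N}. x mod G = r} \<le> card {..N div G}"
    by (rule card_inj_on_le[where f = "\<lambda>x. x div G"])
      (auto simp: inj_on_def div_le_mono, metis mod_div_decomp)
  then have "real (card {x \<in> {..<N}. x mod G = r}) \<le> real (N div G) + 1" by simp
  also have "\<dots> \<le> real N / real G + 1" proof -
    have "real (N div G * G) \<le> real N" by (simp only: of_nat_le_iff div_times_less_eq_dividend)
    then show ?thesis using G by (simp add: field_simps)
  qed
  also have "\<dots> \<le> 2 / real G * real N" using G by (simp add: field_simps)
  finally show ?thesis .
qed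

text \<open>
  The number \<open>z < U * U\<close> encodes the two coefficients of an affine map modulo \<open>U\<close>. The modulus
  need not be prime; pairwise independence then still holds on intervals, up to a constant factor.
\<close>

definition hash :: "nat \<Rightarrow> nat \<Rightarrow> nat \<Rightarrow> nat" where
  "hash U z x = ((z div U) * x + z mod U) mod U"

lemma hash_less: "U > 0 \<Longrightarrow> hash U z x < U" by (simp add: hash_def)

text \<open>With \<open>g\<close> the gcd of \<open>\<delta>\<close> and \<open>U\<close>, the
  values stay in one residue class modulo \<open>g\<close> and repeat with period
  \<open>w = U div g\<close>. So \<open>a\<close> is determined by its period number, one of
  \<open>g\<close>, and by the quotient of its value by \<open>g\<close>, one of at most
  \<open>Len div g + 2\<close>. As \<open>g \<le> \<bar>\<delta>\<bar> \<le> Len\<close>, the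
  product is at most \<open>Len + 2 * g \<le> 3 * Len\<close>.\<close>

lemma card_affine_interval_le:
  fixes c \<delta> lo Len :: int
  assumes "U > 0" "\<delta> \<noteq> 0" "\<bar>\<delta>\<bar> \<le> Len"
  shows "int (card {a :: nat. a < U \<and> (c + int a * \<delta>) mod int U \<in> {lo..<lo + Len}}) \<le> 3 * Len"
proof -
  define g where "g = gcd \<delta> (int U)"
  have g: "g > 0" "g dvd \<delta>" "g dvd int U" using assms by (auto simp: g_def)
  have gL: "g \<le> Len" using zdvd_imp_le[of g "\<bar>\<delta>\<bar>"] g assms by auto
  let ?r = "\<lambda>a :: nat. (c + int a * \<delta>) mod int U"
  define w where "w = int U div g"
  have w: "w > 0" "int U = w * g" using g assms by (auto simp: w_def pos_imp_zdiv_pos_iff zdvd_imp_le)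
  let ?S = "{a :: nat. a < U \<and> ?r a \<in> {lo..<lo + Len}}"
  let ?T = "{0..<g} \<times> {lo div g..(lo + Len - 1) div g}"
  have "card ?S \<le> card ?T"
  proof (rule card_inj_on_le[where f = "\<lambda>a. (int a div w, ?r a div g)"])
    show "inj_on (\<lambda>a. (int a div w, ?r a div g)) ?S"
    proof (rule inj_onI)
      fix a b assume ab: "a \<in> ?S" "b \<in> ?S" "(int a div w, ?r a div g) = (int b div w, ?r b div g)"
      have rc: "?r x mod g = c mod g" for x
        using g by (metis dvd_mult mod_add_right_eq mod_mod_cancel mod_0_imp_dvd add.right_neutral dvd_imp_mod_0)
      have "?r a = ?r b" using ab(3) rc[of a] rc[of b]
        by (metis Pair_inject mod_div_decomp)
      then have "int U dvd (c + int a * \<delta>) - (c + int b * \<delta>)" by (simp add: mod_eq_dvd_iff)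
      then have "int U dvd (int a - int b) * \<delta>" by (simp add: algebra_simps)
      moreover obtain \<delta>' where d: "\<delta> = g * \<delta>'" using g by blast
      ultimately have "w * g dvd ((int a - int b) * \<delta>') * g" using w by (simp add: mult_ac)
      then have "w dvd (int a - int b) * \<delta>'" using g(1) by (subst (asm) dvd_mult_cancel_right) auto
      moreover have "coprime w \<delta>'"
      proof -
        have "gcd (g * \<delta>') (g * w) = g" using d w(2) by (metis g_def mult.commute)
        then have "g * gcd \<delta>' w = g" using g(1) by (simp add: gcd_mult_distrib_int[symmetric] abs_of_pos)
        then show ?thesis using g(1) by (simp add: coprime_iff_gcd_eq_1 gcd.commute)
      qed
      ultimately have "w dvd int a - int b" by (simp add: coprime_dvd_mult_left_iff)
      then have "int a mod w = int b mod w" by (simp add: mod_eq_dvd_iff)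
      then show "a = b" using ab(3) by (metis Pair_inject mod_div_decomp of_nat_eq_iff)
    qed
    show "(\<lambda>a. (int a div w, ?r a div g)) ` ?S \<subseteq> ?T"
    proof
      fix p assume "p \<in> (\<lambda>a. (int a div w, ?r a div g)) ` ?S"
      then obtain a where a: "a < U" "lo \<le> ?r a" "?r a \<le> lo + Len - 1" "p = (int a div w, ?r a div g)" by auto
      have "int a div w * w \<le> int a"
        using pos_mod_sign[OF w(1), of "int a"] div_mult_mod_eq[of "int a" w] by linarith
      also have "\<dots> < g * w" using a(1) w by (simp add: mult.commute)
      finally have "int a div w < g" using w(1) by simp
      moreover have "0 \<le> int a div w" using w(1) by (simp add: pos_imp_zdiv_nonneg_iff)
      ultimately show "p \<in> ?T" using a g(1) by (auto intro: zdiv_mono1)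
    qed
  qed auto
  then have "int (card ?S) \<le> int (card ?T)" by (simp only: of_nat_le_iff)
  also have "\<dots> = g * int (nat ((lo + Len - 1) div g + 1 - lo div g))" using g(1) by simp
  also have "\<dots> \<le> g * (Len div g + 2)"
  proof -
    have "(lo + Len - 1) div g \<le> (lo + Len) div g" using g(1) by (intro zdiv_mono1) auto
    also have "\<dots> < lo div g + Len div g + 2"
    proof -
      have "(lo + Len) div g * g \<le> lo + Len"
        using pos_mod_sign[OF g(1), of "lo + Len"] div_mult_mod_eq[of "lo + Len" g] by linarith
      also have "\<dots> < (lo div g + Len div g + 2) * g"
        using pos_mod_bound[OF g(1), of lo] pos_mod_bound[OF g(1), of Len]
          div_mult_mod_eq[of lo g] div_mult_mod_eq[of Len g] unfolding distrib_right by linarith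
      finally show ?thesis using g(1) by simp
    qed
    finally show ?thesis using g(1) gL by (intro mult_left_mono) (auto simp: pos_imp_zdiv_nonneg_iff)
  qed
  also have "\<dots> \<le> Len + 2 * g"
    using pos_mod_sign[OF g(1), of Len] mult_div_mod_eq[of g Len] unfolding distrib_left by linarith
  finally show ?thesis using gL by simp
qed

text \<open>Given the value \<open>c\<close> of the hash at \<open>x\<close>, the value at
  \<open>y\<close> is \<open>c\<close> plus the multiplier \<open>z div U\<close> times
  \<open>y - x\<close>, so \<open>card_affine_interval_le\<close> counts the multipliers for each
  \<open>c\<close>. The interval for \<open>y\<close> may move with the value at \<open>x\<close>,
  because a collision means landing in the same block.\<close>

lemma card_hash_pair_le:
  fixes x y :: nat
  assumes U: "U > 0" and xy: "x \<noteq> y" "x \<le> Len" "y \<le> Len" and I: "I \<subseteq> {..<U}"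
  shows "card {z \<in> {..<U * U}. hash U z x \<in> I \<and> hash U z y \<in> {lo (hash U z x)..<lo (hash U z x) + Len}}
    \<le> card I * (3 * Len)" (is "card ?S \<le> _")
proof -
  let ?d = "int y - int x"
  let ?a = "\<lambda>c. {a :: nat. a < U \<and> (int c + int a * ?d) mod int U \<in> {int (lo c)..<int (lo c) + int Len}}"
  have finI: "finite I" using I finite_subset by blast
  have "card ?S \<le> card (SIGMA c:I. ?a c)"
  proof (rule card_inj_on_le[where f = "\<lambda>z. (hash U z x, z div U)"])
    show "finite (SIGMA c:I. ?a c)" using finI by (auto intro: finite_subset[of _ "{..<U}"])
    show "inj_on (\<lambda>z. (hash U z x, z div U)) ?S"
    proof (rule inj_onI)
      fix z z' assume zz: "z \<in> ?S" "z' \<in> ?S" "(hash U z x, z div U) = (hash U z' x, z' div U)"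
      then have "(z div U * x + z mod U) mod U = (z div U * x + z' mod U) mod U"
        by (auto simp: hash_def)
      then have "(z mod U) mod U = (z' mod U) mod U"
        by (metis cong_add_lcancel_nat cong_def)
      then show "z = z'" using zz(3) by (metis Pair_inject mod_mod_trivial div_mult_mod_eq)
    qed
    show "(\<lambda>z. (hash U z x, z div U)) ` ?S \<subseteq> (SIGMA c:I. ?a c)"
    proof
      fix p assume "p \<in> (\<lambda>z. (hash U z x, z div U)) ` ?S"
      then obtain z where z: "z < U * U" "hash U z x \<in> I" "p = (hash U z x, z div U)"
        "lo (hash U z x) \<le> hash U z y" "hash U z y < lo (hash U z x) + Len" by auto
      have "int (hash U z y) = (int (z div U) * int y + int (z mod U)) mod int U"
        by (simp add: hash_def zmod_int)
      also have "\<dots> = ((int (z div U) * int x + int (z mod U)) + int (z div U) * ?d) mod int U"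
        by (simp add: algebra_simps)
      also have "\<dots> = (int (hash U z x) + int (z div U) * ?d) mod int U"
        by (simp add: hash_def zmod_int mod_add_left_eq)
      finally have "(int (hash U z x) + int (z div U) * ?d) mod int U = int (hash U z y)" by simp
      moreover have "z div U < U" using z(1) by (simp add: less_mult_imp_div_less)
      ultimately show "p \<in> (SIGMA c:I. ?a c)" using z by auto
    qed
  qed
  also have "\<dots> = (\<Sum>c\<in>I. card (?a c))" using finI by (intro card_SigmaI) auto
  also have "\<dots> \<le> (\<Sum>c\<in>I. 3 * Len)"
  proof (rule sum_mono)
    fix c assume "c \<in> I"
    have "int (card (?a c)) \<le> 3 * int Len"
      using U xy by (intro card_affine_interval_le) auto
    then show "card (?a c) \<le> 3 * Len" by linarith
  qed
  finally show ?thesis by simp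
qed

text \<open>For every multiplier and every target in \<open>I\<close> there is an offset that works,
  namely the target minus the multiple of \<open>x\<close>, modulo \<open>U\<close>;
  \<open>?f\<close> is the resulting seed.\<close>

lemma card_hash_ge:
  assumes U: "U > 0" and I: "I \<subseteq> {..<U}"
  shows "U * card I \<le> card {z \<in> {..<U * U}. hash U z x \<in> I}"
proof -
  let ?f = "\<lambda>(a, c). a * U + (c + (U - (a * x) mod U)) mod U"
  have h: "hash U (?f (a, c)) x = c" "?f (a, c) div U = a" "?f (a, c) < U * U" if "a < U" "c < U" for a c
  proof -
    let ?b = "(c + (U - (a * x) mod U)) mod U"
    have b: "?b < U" using U by simp
    show d: "?f (a, c) div U = a" using b by simp
    have "?f (a, c) mod U = ?b" by simp
    then have "hash U (?f (a, c)) x = (a * x + ?b) mod U" using d by (simp only: hash_def)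
    also have "\<dots> = ((a * x) mod U + (c + (U - (a * x) mod U))) mod U" by (simp add: mod_add_eq mod_add_right_eq mod_add_left_eq)
    also have "(a * x) mod U + (c + (U - (a * x) mod U)) = c + U"
      using mod_less_divisor[OF U, of "a * x"] by linarith
    finally show "hash U (?f (a, c)) x = c" using that by simp
    have "a * U + ?b < (a + 1) * U" using b by simp
    also have "\<dots> \<le> U * U" using that by (intro mult_right_mono) auto
    finally show "?f (a, c) < U * U" by simp
  qed
  have "card ({..<U} \<times> I) \<le> card {z \<in> {..<U * U}. hash U z x \<in> I}"
  proof (rule card_inj_on_le[where f = ?f])
    show "inj_on ?f ({..<U} \<times> I)"
      by (rule inj_on_inverseI[where g = "\<lambda>z. (z div U, hash U z x)"]) (use h I in force)
    show "?f ` ({..<U} \<times> I) \<subseteq> {z \<in> {..<U * U}. hash U z x \<in> I}"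
    proof
      fix z assume "z \<in> ?f ` ({..<U} \<times> I)"
      then obtain a c where "a < U" "c \<in> I" "z = ?f (a, c)" by auto
      then show "z \<in> {z \<in> {..<U * U}. hash U z x \<in> I}" using h[of a c] I by auto
    qed
  qed auto
  then show ?thesis by (simp add: card_cartesian_product)
qed

text \<open>
  Bonferroni: a set of size \<open>m\<close> subsampled at rate \<open>p\<close> is hit exactly once with probability at least
  \<open>m p - 3 (m p)\<^sup>2\<close>, where the factor 3 instead of 1 pays for the bias of the hash function.
\<close>

lemma card_isolating_ge:
  assumes U: "U > 0" "U = T * 2 ^ e" and C: "finite C" "\<And>x. x \<in> C \<Longrightarrow> x \<le> T"
    and e: "8 * card C \<le> 2 ^ e" "2 ^ e < 16 * card C"
  shows "real (U * U) / 32 \<le> real (card {z \<in> {..<U * U}. \<exists>!x. x \<in> C \<and> hash U z x < T})"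
proof -
  let ?m = "card C"
  let ?A = "\<lambda>x. {z \<in> {..<U * U}. hash U z x \<in> {..<T}}"
  let ?P = "\<lambda>x y. {z \<in> {..<U * U}. hash U z x \<in> {..<T} \<and> hash U z y \<in> {0..<0 + T}}"
  have T: "T \<le> U" using U by simp
  have A: "U * T \<le> card (?A x)" for x
    using card_hash_ge[OF U(1), of "{..<T}" x] T by simp
  have P: "card (?P x y) \<le> T * (3 * T)" if "x \<in> C" "y \<in> C" "x \<noteq> y" for x y
    using card_hash_pair_le[OF U(1), of x y T "{..<T}" "\<lambda>_. 0"] C(2) that T by simp
  \<comment> \<open>Seeds that sample \<open>x\<close> and no other element of \<open>C\<close>.
    They are disjoint for different \<open>x\<close>, so their numbers add up to a lower
    bound.\<close>
  let ?D = "\<lambda>x. ?A x - (\<Union>y\<in>C - {x}. ?P x y)"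
  have D: "real (U * T) - real ?m * real (T * (3 * T)) \<le> real (card (?D x))" if "x \<in> C" for x
  proof -
    have "card (\<Union>y\<in>C - {x}. ?P x y) \<le> (\<Sum>y\<in>C - {x}. card (?P x y))"
      using C by (intro card_UN_le) auto
    also have "\<dots> \<le> (\<Sum>y\<in>C - {x}. T * (3 * T))" using P[OF that] by (intro sum_mono) auto
    also have "\<dots> \<le> ?m * (T * (3 * T))" using C by (simp add: card_Diff_subset_Int mult_le_mono1)
    finally have 1: "card (\<Union>y\<in>C - {x}. ?P x y) \<le> ?m * (T * (3 * T))" .
    have "card (?A x) - card (\<Union>y\<in>C - {x}. ?P x y) \<le> card (?D x)"
      by (rule diff_card_le_card_Diff) (use C in auto)
    then have "U * T \<le> card (?D x) + ?m * (T * (3 * T))" using 1 A[of x] by linarith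
    then have "real (U * T) \<le> real (card (?D x) + ?m * (T * (3 * T)))" by (simp only: of_nat_le_iff)
    then show ?thesis by simp
  qed
  have "real ?m * (real (U * T) - real ?m * real (T * (3 * T))) = (\<Sum>x\<in>C. real (U * T) - real ?m * real (T * (3 * T)))"
    by simp
  also have "\<dots> \<le> (\<Sum>x\<in>C. real (card (?D x)))" using D by (intro sum_mono) auto
  also have "\<dots> = real (\<Sum>x\<in>C. card (?D x))" by simp
  also have "(\<Sum>x\<in>C. card (?D x)) = card (\<Union>x\<in>C. ?D x)"
    using C by (intro card_UN_disjoint[symmetric]) auto
  also have "real (card (\<Union>x\<in>C. ?D x)) \<le> real (card {z \<in> {..<U * U}. \<exists>!x. x \<in> C \<and> hash U z x < T})"
    by (intro of_nat_mono card_mono) auto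
  finally have *: "real ?m * (real (U * T) - real ?m * real (T * (3 * T)))
      \<le> real (card {z \<in> {..<U * U}. \<exists>!x. x \<in> C \<and> hash U z x < T})" .
  define E where "E = (2 :: real) ^ e"
  define m where "m = real ?m"
  have rU: "real U = real T * E" using U by (simp add: E_def)
  have mE: "8 * m \<le> E" "E < 16 * m" using e unfolding E_def m_def
    by (metis of_nat_le_iff of_nat_mult of_nat_numeral of_nat_power)
       (metis e(2) of_nat_less_iff of_nat_mult of_nat_numeral of_nat_power)
  have E0: "E > 0" by (simp add: E_def)
  \<comment> \<open>From \<open>8 * m \<le> E\<close> and \<open>E < 16 * m\<close>: the first
    factor is at least \<open>E / 16\<close>, the second at least \<open>E / 2\<close>.\<close>
  have "E * E / 32 \<le> m * (E - 3 * m)"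
  proof -
    have "E / 16 * (E / 2) \<le> m * (E - 3 * m)" using mE E0 by (intro mult_mono) auto
    then show ?thesis by simp
  qed
  then have "real T * real T * (E * E / 32) \<le> real T * real T * (m * (E - 3 * m))"
    by (intro mult_left_mono) auto
  also have "\<dots> = m * (real (U * T) - m * real (T * (3 * T)))" using rU by (simp add: algebra_simps)
  finally show ?thesis using * rU by (simp add: m_def algebra_simps)
qed

section \<open>Sampling a matching\<close>

lemma card_filter_not: "finite X \<Longrightarrow> card {x \<in> X. \<not> P x} + card {x \<in> X. P x} = card X"
  by (subst card_Un_disjoint[symmetric]) (auto intro: arg_cong[of _ _ card])

locale sampling =
  fixes n k l :: nat and Ed M :: "(nat \<times> nat) set"
  assumes k: "k \<ge> 1" and kn: "2 * k \<le> n" and nl: "n \<le> 2 ^ l"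
    and Ed: "Ed \<subseteq> {..<n} \<times> {..<n}"
    and M: "M \<subseteq> Ed" "card M \<le> k"
begin

text \<open>The constants are tuned to make each kind of failure have probability at most
  \<open>1 / 8\<close>. The factor 32 in \<open>q\<close> comes from
  \<open>(31 / 32) ^ 32 \<le> 1 / 2\<close>, and \<open>U * U = 2 ^ q\<close> gives seeds of
  \<open>q\<close> bits. \<open>RR\<close> beats at most \<open>4 * k ^ 2\<close> pairs of vertices
  times \<open>6 / RR\<close>; \<open>D\<close> is the length of the blocks of hash values that
  share an index below \<open>RR\<close>; \<open>B\<close> makes \<open>2 * k * (2 / B)\<close> and
  \<open>G\<close> makes \<open>q ^ 2 * (2 / G)\<close> equal to \<open>1 / 2\<close>.\<close>

definition q where "q = 32 * (l + 5)"
definition U where "U = (2 :: nat) ^ (16 * (l + 5))"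
definition RR where "RR = 256 * k ^ 2"
definition D where "D = U div RR + 1"
definition B where "B = 8 * k"
definition G where "G = 4 * q ^ 2"
definition I where "I = {..q} \<times> {..RR}"
definition A where "A = (\<lambda>_ :: nat \<times> nat. {..<U * U})"
definition S where "S = fst ` M \<union> snd ` M"

text \<open>
  \<open>Y (t, c)\<close> is the \<open>c\<close>-th random number of row \<open>t\<close>. Column 0 holds hash function seeds, the
  other columns random tables indexed by \<open>hv\<close>: row 0 assigns a vertex to a group, row \<open>j + 1\<close> is the
  \<open>j\<close>-th attempt to tell the vertices of one group apart.
\<close>

definition hv :: "(nat \<times> nat \<Rightarrow> nat) \<Rightarrow> nat \<Rightarrow> nat" where
  "hv Y v = hash U (Y (0, 0)) v div D"
definition fv where "fv Y v = Y (0, Suc (hv Y v)) mod B"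
definition gv where "gv Y j v = Y (Suc j, Suc (hv Y v)) mod G"
text \<open>The edges that share a bucket with \<open>(u, v)\<close>, before subsampling, when table
  \<open>j\<close> serves first and table \<open>j'\<close> second endpoints.\<close>

definition cls where
  "cls Y j u j' v = {e \<in> Ed. fv Y (fst e) = fv Y u \<and> gv Y j (fst e) = gv Y j u
      \<and> fv Y (snd e) = fv Y v \<and> gv Y j' (snd e) = gv Y j' v}"
definition isolates where
  "isolates Y t j C \<longleftrightarrow> (\<exists>!e. e \<in> C \<and> hash U (Y (Suc t, 0)) (fst e * n + snd e) < 2 ^ j)"
text \<open>\<open>ls\<close> selects a separating table for each group. The programs never compute
  it; they keep buckets for all pairs of tables.\<close>

definition good where
  "good Y \<longleftrightarrow> (\<exists>ls. (\<forall>i. ls i < q) \<and> inj_on (\<lambda>v. (fv Y v, gv Y (ls (fv Y v)) v)) S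
     \<and> (\<forall>(u, v)\<in>M. \<exists>t<q. \<exists>j<q. isolates Y t j (cls Y (ls (fv Y u)) u (ls (fv Y v)) v)))"

lemma finM: "finite M" "finite Ed"
proof -
  show "finite Ed" using finite_subset[OF Ed] by simp
  then show "finite M" using finite_subset[OF M(1)] by simp
qed
lemma finS: "finite S" using finM by (simp add: S_def)
lemma cardS: "card S \<le> 2 * k"
proof -
  have "card S \<le> card (fst ` M) + card (snd ` M)" unfolding S_def by (rule card_Un_le)
  also have "\<dots> \<le> card M + card M" using finM by (intro add_mono card_image_le)
  finally show ?thesis using M by simp
qed
lemma S_less: "v \<in> S \<Longrightarrow> v < n" using M Ed by (auto simp: S_def)

lemma U0: "U > 0" by (simp add: U_def)
lemma UU: "U * U = 2 ^ q" by (simp add: U_def q_def flip: power_add)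
lemma finI: "finite I" and finA: "finite (A i)" by (auto simp: I_def A_def)
lemma cardA: "card (A i) = U * U" by (simp add: A_def)
lemma k_le: "2 * k \<le> 2 ^ l" using kn nl by simp
lemma B0: "B > 0" using k by (simp add: B_def)
lemma G0: "G > 0" by (simp add: G_def q_def)
lemma R0: "RR > 0" using k by (simp add: RR_def)

lemma B_le: "B \<le> U * U"
proof -
  have "B \<le> 4 * 2 ^ l" using k_le by (simp add: B_def)
  also have "\<dots> = 2 ^ (l + 2)" by (simp add: power_add)
  also have "\<dots> \<le> 2 ^ q" by (intro power_increasing) (auto simp: q_def)
  finally show ?thesis by (simp add: UU)
qed

lemma G_le: "G \<le> U * U"
proof -
  have "l + 5 < 2 ^ (l + 5)" by (rule less_exp)
  then have "q \<le> 2 ^ (l + 10)" unfolding q_def by (simp add: power_add)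
  then have "q ^ 2 \<le> (2 ^ (l + 10)) ^ 2" by (rule power_mono) simp
  then have "G \<le> 2 ^ 2 * (2 ^ (l + 10)) ^ 2" by (simp add: G_def)
  also have "\<dots> = 2 ^ (2 + (l + 10) * 2)" by (simp only: power_add power_mult)
  also have "\<dots> \<le> 2 ^ q" by (intro power_increasing) (auto simp: q_def)
  finally show ?thesis by (simp add: UU)
qed

lemma R_le: "RR * 2 ^ l \<le> U"
proof -
  have "(2 * k) ^ 2 \<le> (2 ^ l) ^ 2" using k_le by (rule power_mono) simp
  then have "RR \<le> 2 ^ 6 * (2 ^ l) ^ 2" by (simp add: RR_def power_mult_distrib)
  then have "RR * 2 ^ l \<le> 2 ^ 6 * (2 ^ l) ^ 2 * 2 ^ l" by simp
  also have "\<dots> = 2 ^ (6 + l * 2 + l)" by (simp only: power_add power_mult)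
  also have "\<dots> \<le> U" unfolding U_def by (intro power_increasing) auto
  finally show ?thesis .
qed

text \<open>\<open>card_hash_pair_le\<close> with blocks of length \<open>D\<close> requires
  vertices to be at most \<open>D\<close>; hence the generous size of \<open>U\<close>.\<close>

lemma n_le_D: "n \<le> D"
proof -
  have "2 ^ l \<le> U div RR" using R_le R0 by (simp add: less_eq_div_iff_mult_less_eq mult.commute)
  then show ?thesis using nl by (simp add: D_def)
qed

lemma D_le: "real D \<le> 2 * real U / real RR"
proof -
  have "(1::nat) \<le> 2 ^ l" by simp
  then have "RR * 1 \<le> RR * 2 ^ l" by (intro mult_le_mono2)
  then have "RR * 1 \<le> U" using R_le by (rule order_trans)
  then have "RR \<le> U" by simp
  then have "1 \<le> real U / real RR" using R0 by simp
  moreover have "real (U div RR) \<le> real U / real RR"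
  proof -
    have "real (U div RR * RR) \<le> real U" by (simp only: of_nat_le_iff div_times_less_eq_dividend)
    then show ?thesis using R0 by (simp add: field_simps)
  qed
  ultimately show ?thesis by (simp add: D_def)
qed

lemma hv_less: "hv Y v < RR"
proof -
  have "U < RR * D"
  proof -
    have "U = U div RR * RR + U mod RR" by simp
    also have "\<dots> < U div RR * RR + RR" using R0 by (intro add_strict_left_mono mod_less_divisor)
    finally show ?thesis by (simp add: D_def algebra_simps)
  qed
  then have "hash U (Y (0, 0)) v < RR * D" using hash_less[OF U0, of "Y (0, 0)" v] by simp
  then show ?thesis by (simp add: hv_def less_mult_imp_div_less)
qed

lemma two_k_le_q: "64 * real k \<le> 2 ^ q"
proof -
  have "64 * k \<le> 2 ^ 5 * 2 ^ l" using k_le by simp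
  also have "\<dots> \<le> 2 ^ q" unfolding power_add[symmetric] by (intro power_increasing) (auto simp: q_def)
  finally have "real (64 * k) \<le> real (2 ^ q)" by (simp only: of_nat_le_iff)
  then show ?thesis by simp
qed

section \<open>The four ways to fail\<close>

text \<open>Two vertices collide if the hash of the second falls into the block of length
  \<open>D\<close> around that of the first, which by \<open>card_hash_pair_le\<close> has
  probability at most \<open>3 * D / U \<le> 6 / RR\<close>. The union over at most
  \<open>4 * k ^ 2\<close> pairs gives \<open>24 / 256\<close>.\<close>

lemma rare_collision: "rare (1/8) I A (\<lambda>Y. \<not> inj_on (hv Y) S)"
proof -
  let ?X = "{(u, v) \<in> S \<times> S. u \<noteq> v}"
  have *: "rare ((6 / real RR) ^ 1) I A (\<lambda>Y. hv Y (fst p) = hv Y (snd p))" if "p \<in> ?X" for p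
  proof -
    obtain u v where p: "p = (u, v)" "u \<in> S" "v \<in> S" "u \<noteq> v" using \<open>p \<in> ?X\<close> by auto
    let ?D0 = "{(0, 0)} :: (nat \<times> nat) set"
    let ?F = "{z \<in> {..<U * U}. hash U z u \<in> {..<U}
        \<and> hash U z v \<in> {hash U z u div D * D..<hash U z u div D * D + D}}"
    have D0: "D > 0" by (simp add: D_def)
    have "card ?F \<le> card {..<U} * (3 * D)"
      using card_hash_pair_le[of U u v D "{..<U}" "\<lambda>c. c div D * D"] U0 p S_less n_le_D by fastforce
    then have "real (card ?F) \<le> real (U * (3 * D))" by (simp only: of_nat_le_iff card_lessThan)
    also have "\<dots> = real U * (3 * real D)" by simp
    also have "\<dots> \<le> real U * (3 * (2 * real U / real RR))" using D_le by (intro mult_left_mono) auto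
    finally have F: "real (card ?F) \<le> 6 / real RR * real (card (A i))" for i by (simp add: cardA field_simps)
    have mem: "x div D * D \<le> y \<and> y < x div D * D + D" if "x div D = y div D" for x y
      using that D0 by (metis dividend_less_div_times div_times_less_eq_dividend add.commute)
    have "rare ((6 / real RR) ^ card ?D0) I A (\<lambda>Y. hv Y (fst p) = hv Y (snd p))"
    proof (rule rare_indep)
      show "?D0 \<subseteq> I" by (simp add: I_def)
      fix Z assume "Z \<in> PiE (I - ?D0) A"
      show "\<exists>F. \<forall>i\<in>?D0. F i \<subseteq> A i \<and> real (card (F i)) \<le> 6 / real RR * real (card (A i)) \<and>
          (\<forall>Y\<in>PiE I A. (\<forall>j. j \<notin> ?D0 \<longrightarrow> Y j = Z j) \<and> hv Y (fst p) = hv Y (snd p) \<longrightarrow> Y i \<in> F i)"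
      proof (intro exI[of _ "\<lambda>_. ?F"] ballI conjI impI)
        fix i Y assume i: "i \<in> ?D0" and Y: "Y \<in> PiE I A"
          and h: "(\<forall>j. j \<notin> ?D0 \<longrightarrow> Y j = Z j) \<and> hv Y (fst p) = hv Y (snd p)"
        have "Y (0, 0) < U * U" using Y by (auto simp: I_def A_def PiE_iff)
        moreover have "hash U (Y (0, 0)) u div D = hash U (Y (0, 0)) v div D" using h p by (simp add: hv_def)
        ultimately show "Y i \<in> ?F" using i mem hash_less[OF U0] by simp
      qed (use F in \<open>auto simp: A_def\<close>)
    qed (use finI finA in auto)
    then show ?thesis by simp
  qed
  have fX: "finite ?X" using finS by (auto intro: rev_finite_subset[of "S \<times> S"])
  have "card ?X \<le> card (S \<times> S)" using finS by (intro card_mono) auto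
  also have "\<dots> \<le> (2 * k) * (2 * k)" unfolding card_cartesian_product using cardS by (intro mult_le_mono)
  finally have "real (card ?X) \<le> real ((2 * k) * (2 * k))" by (simp only: of_nat_le_iff)
  then have "real (card ?X) * (6 / real RR) \<le> real ((2 * k) * (2 * k)) * (6 / real RR)"
    by (intro mult_right_mono) auto
  also have "\<dots> \<le> 1 / 8" using k by (simp add: RR_def field_simps power2_eq_square)
  finally have le: "real (card ?X) * (6 / real RR) ^ 1 \<le> 1 / 8" by simp
  show ?thesis
    by (rule rare_mono[OF rare_Bex[OF fX *] le]) (use finI finA in \<open>force simp: inj_on_def\<close>)+
qed

text \<open>An overloaded group contains a set \<open>T\<close> of \<open>q\<close> vertices. With
  the hash seed fixed and injective on \<open>S\<close>, these read different table entries, so all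
  of them land in group \<open>i\<close> with probability at most \<open>(2 / B) ^ q\<close>; there
  are at most \<open>(2 * k) ^ q * B\<close> choices of \<open>T\<close> and
  \<open>i\<close>.\<close>

lemma rare_overload:
  "rare (1/8) I A (\<lambda>Y. inj_on (hv Y) S \<and> (\<exists>i. q \<le> card {v \<in> S. fv Y v = i}))"
proof -
  let ?X = "{T. T \<subseteq> S \<and> card T = q} \<times> {..<B}"
  have *: "rare ((2 / real B) ^ q) I A (\<lambda>Y. inj_on (hv Y) S \<and> (\<forall>v\<in>fst p. fv Y v = snd p))" if "p \<in> ?X" for p
  proof -
    obtain T i where p: "p = (T, i)" "T \<subseteq> S" "card T = q" using \<open>p \<in> ?X\<close> by auto
    show ?thesis
    proof (rule rare_fix[where J = "{(0, 0)}"])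
      fix Z assume Z: "Z \<in> PiE {(0, 0)} A"
      let ?A = "\<lambda>i. if i \<in> {(0, 0)} then {Z i} else A i"
      let ?h = "\<lambda>v. hash U (Z (0, 0)) v div D"
      have hv: "hv Y v = ?h v" if "Y \<in> PiE I ?A" for Y v
      proof -
        have "Y (0, 0) = Z (0, 0)" using that by (force simp: PiE_iff I_def)
        then show ?thesis by (simp add: hv_def)
      qed
      show "rare ((2 / real B) ^ q) I ?A (\<lambda>Y. inj_on (hv Y) S \<and> (\<forall>v\<in>fst p. fv Y v = snd p))"
      proof (cases "inj_on ?h S")
        \<comment> \<open>The event includes injectivity, so a seed with collisions contributes
          nothing.\<close>
        case False
        have "\<not> inj_on (hv Y) S" if "Y \<in> PiE I ?A" for Y
          using False hv[OF that] by (simp cong: inj_on_cong)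
        then have e: "{Y \<in> PiE I ?A. inj_on (hv Y) S \<and> (\<forall>v\<in>fst p. fv Y v = snd p)} = {}" by blast
        show ?thesis unfolding rare_def e by simp
      next
        case True
        let ?D0 = "(\<lambda>v. (0 :: nat, Suc (?h v))) ` T"
        have "card ?D0 = q" using True p by (subst card_image) (auto simp: inj_on_def)
        moreover have "rare ((2 / real B) ^ card ?D0) I ?A (\<lambda>Y. inj_on (hv Y) S \<and> (\<forall>v\<in>fst p. fv Y v = snd p))"
        proof (rule rare_indep)
          show "?D0 \<subseteq> I" using hv_less[of Z] by (auto simp: I_def hv_def Suc_le_eq)
          fix Z' assume "Z' \<in> PiE (I - ?D0) ?A"
          let ?F = "{x \<in> {..<U * U}. x mod B = i}"
          show "\<exists>F. \<forall>i\<in>?D0. F i \<subseteq> ?A i \<and> real (card (F i)) \<le> 2 / real B * real (card (?A i)) \<and>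
            (\<forall>Y\<in>PiE I ?A. (\<forall>j. j \<notin> ?D0 \<longrightarrow> Y j = Z' j) \<and> inj_on (hv Y) S \<and> (\<forall>v\<in>fst p. fv Y v = snd p) \<longrightarrow> Y i \<in> F i)"
          proof (intro exI[of _ "\<lambda>_. ?F"] ballI conjI impI)
            fix x assume x: "x \<in> ?D0"
            show "?F \<subseteq> ?A x" using x by (auto simp: A_def)
            show "real (card ?F) \<le> 2 / real B * real (card (?A x))"
              using card_mod_eq_le[OF B0 B_le, of i] x cardA by auto
            fix Y assume Y: "Y \<in> PiE I ?A"
              and h: "(\<forall>j. j \<notin> ?D0 \<longrightarrow> Y j = Z' j) \<and> inj_on (hv Y) S \<and> (\<forall>v\<in>fst p. fv Y v = snd p)"
            obtain v where v: "v \<in> T" "x = (0, Suc (?h v))" using x by blast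
            have "x \<in> I" using hv_less[of Z v] v by (auto simp: I_def hv_def Suc_le_eq)
            then have "Y x \<in> A x" using Y v by (force simp: PiE_iff)
            moreover have "fv Y v = i" using h p v by simp
            ultimately show "Y x \<in> ?F" using v hv[OF Y] by (simp add: fv_def A_def)
          qed
        qed (use finI finA in auto)
        ultimately show ?thesis by simp
      qed
    qed (use finI finA in \<open>auto simp: I_def\<close>)
  qed
  have fX: "finite ?X" using finS by auto
  have "card {T. T \<subseteq> S \<and> card T = q} = card S choose q" by (rule n_subsets[OF finS])
  also have "\<dots> \<le> (2 * k) ^ q"
  proof (cases "q \<le> card S")
    case True
    then have "card S choose q \<le> card S ^ q" by (rule binomial_le_pow)
    also have "\<dots> \<le> (2 * k) ^ q" using cardS by (intro power_mono) auto
    finally show ?thesis .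
  qed (simp add: binomial_eq_0)
  finally have "card ?X \<le> (2 * k) ^ q * B" by (simp add: card_cartesian_product)
  then have "real (card ?X) \<le> real ((2 * k) ^ q * B)" by (simp only: of_nat_le_iff)
  then have "real (card ?X) * (2 / real B) ^ q \<le> real ((2 * k) ^ q * B) * (2 / real B) ^ q"
    by (intro mult_right_mono) auto
  also have "\<dots> = real B * ((2 * real k) * (2 / real B)) ^ q"
    by (simp only: of_nat_mult of_nat_power power_mult_distrib of_nat_numeral mult_ac)
  also have "(2 * real k) * (2 / real B) = 1 / 2" using k by (simp add: B_def)
  also have "real B * (1 / 2) ^ q \<le> 1 / 8" using two_k_le_q by (simp add: B_def power_divide field_simps)
  finally have le: "real (card ?X) * (2 / real B) ^ q \<le> 1 / 8" .
  show ?thesis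
  proof (rule rare_mono[OF rare_Bex[OF fX *] le])
    fix Y assume "Y \<in> PiE I A" and "inj_on (hv Y) S \<and> (\<exists>i. q \<le> card {v \<in> S. fv Y v = i})"
    then obtain i where i: "inj_on (hv Y) S" "q \<le> card {v \<in> S. fv Y v = i}" by blast
    then obtain T where T: "T \<subseteq> {v \<in> S. fv Y v = i}" "card T = q" by (meson obtain_subset_with_card_n)
    \<comment> \<open>A nonempty \<open>T\<close> shows that the overloaded \<open>i\<close> is one
      of the \<open>B\<close> groups.\<close>
    have "q > 0" by (simp add: q_def)
    then obtain v where "v \<in> T" using T by fastforce
    then have "i < B" using T B0 by (auto simp: fv_def)
    then show "\<exists>p\<in>?X. inj_on (hv Y) S \<and> (\<forall>v\<in>fst p. fv Y v = snd p)"
      using T i by (intro bexI[of _ "(T, i)"]) auto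
  qed (use finI finA in auto)
qed

text \<open>Row 0, hence the grouping, is fixed first. If all \<open>q\<close> tables fail on a
  group, a function \<open>\<pi>\<close> picks a colliding pair for every table. Fewer than
  \<open>q\<close> vertices form at most \<open>q ^ 2\<close> pairs, so there are at most
  \<open>(q ^ 2) ^ q\<close> such functions, each realized with probability at most
  \<open>(2 / G) ^ q\<close>.\<close>

lemma rare_no_injective:
  "rare (1/8) I A (\<lambda>Y. inj_on (hv Y) S \<and> (\<forall>i. card {v \<in> S. fv Y v = i} < q)
      \<and> (\<exists>s\<in>S. \<forall>j<q. \<not> inj_on (gv Y j) {v \<in> S. fv Y v = fv Y s}))"
proof -
  let ?Q = "\<lambda>s Y. inj_on (hv Y) S \<and> (\<forall>i. card {v \<in> S. fv Y v = i} < q)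
      \<and> (\<forall>j<q. \<not> inj_on (gv Y j) {v \<in> S. fv Y v = fv Y s})"
  have *: "rare ((1 / 2) ^ q) I A (?Q s)" for s
  proof (rule rare_fix[where J = "{0} \<times> {..RR}"])
    fix Z assume Z: "Z \<in> PiE ({0} \<times> {..RR}) A"
    let ?A = "\<lambda>i. if i \<in> {0} \<times> {..RR} then {Z i} else A i"
    have finA': "finite (?A i)" for i using finA by auto
    have Y0: "Y (0, c) = Z (0, c)" if "Y \<in> PiE I ?A" "c \<le> RR" for Y c
      using that by (force simp: PiE_iff I_def)
    have hv: "hv Y v = hv Z v" if "Y \<in> PiE I ?A" for Y v
      using Y0[OF that, of 0] by (simp add: hv_def)
    have fv: "fv Y v = fv Z v" if "Y \<in> PiE I ?A" for Y v
      using Y0[OF that, of "Suc (hv Z v)"] hv[OF that] hv_less[of Z v] by (simp add: fv_def)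
    let ?T = "{v \<in> S. fv Z v = fv Z s}"
    have finT: "finite ?T" using finS by simp
    show "rare ((1 / 2) ^ q) I ?A (?Q s)"
    proof (cases "inj_on (hv Z) S \<and> card ?T < q")
      case False
      have "\<not> ?Q s Y" if "Y \<in> PiE I ?A" for Y
        using False hv[OF that] fv[OF that] by (auto simp: inj_on_def)
      then have e: "{Y \<in> PiE I ?A. ?Q s Y} = {}" by blast
      show ?thesis unfolding rare_def e by simp
    next
      case True
      let ?P = "{(u, v) \<in> ?T \<times> ?T. u \<noteq> v}"
      let ?X = "PiE {..<q} (\<lambda>_. ?P)"
      have finP: "finite ?P" using finT by (auto intro: rev_finite_subset[of "?T \<times> ?T"])
      have fX: "finite ?X" using finP by (intro finite_PiE) auto
      have **: "rare ((2 / real G) ^ q) I ?A (\<lambda>Y. \<forall>j<q. gv Y j (fst (\<pi> j)) = gv Y j (snd (\<pi> j)))"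
        if pi: "\<pi> \<in> ?X" for \<pi>
      proof -
        \<comment> \<open>Only the entry of the second vertex of each pair is left random. The entry
          of the first is another coordinate, as the hash is injective, and it prescribes the
          residue.\<close>
        let ?D0 = "(\<lambda>j. (Suc j, Suc (hv Z (snd (\<pi> j))))) ` {..<q}"
        have "card ?D0 = q" by (subst card_image) (auto simp: inj_on_def)
        moreover have "rare ((2 / real G) ^ card ?D0) I ?A (\<lambda>Y. \<forall>j<q. gv Y j (fst (\<pi> j)) = gv Y j (snd (\<pi> j)))"
        proof (rule rare_indep)
          show "?D0 \<subseteq> I" using hv_less[of Z] by (auto simp: I_def Suc_le_eq)
          fix Z' assume "Z' \<in> PiE (I - ?D0) ?A"
          \<comment> \<open>Table \<open>j\<close> is row \<open>Suc j\<close>, so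
            \<open>fst x - 1\<close> recovers the table from the coordinate.\<close>
          let ?F = "\<lambda>x. {y \<in> {..<U * U}. y mod G = Z' (fst x, Suc (hv Z (fst (\<pi> (fst x - 1))))) mod G}"
          show "\<exists>F. \<forall>i\<in>?D0. F i \<subseteq> ?A i \<and> real (card (F i)) \<le> 2 / real G * real (card (?A i)) \<and>
            (\<forall>Y\<in>PiE I ?A. (\<forall>j. j \<notin> ?D0 \<longrightarrow> Y j = Z' j) \<and> (\<forall>j<q. gv Y j (fst (\<pi> j)) = gv Y j (snd (\<pi> j))) \<longrightarrow> Y i \<in> F i)"
          proof (intro exI[of _ ?F] ballI conjI impI)
            fix x assume x: "x \<in> ?D0"
            show "?F x \<subseteq> ?A x" using x by (auto simp: A_def)
            have "?A x = A x" using x by auto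
            then show "real (card (?F x)) \<le> 2 / real G * real (card (?A x))"
              using card_mod_eq_le[OF G0 G_le] cardA by simp
            fix Y assume Y: "Y \<in> PiE I ?A"
              and h: "(\<forall>j. j \<notin> ?D0 \<longrightarrow> Y j = Z' j) \<and> (\<forall>j<q. gv Y j (fst (\<pi> j)) = gv Y j (snd (\<pi> j)))"
            obtain j where j: "j < q" "x = (Suc j, Suc (hv Z (snd (\<pi> j))))" using x by blast
            have "\<pi> j \<in> ?P" using pi j by (auto simp: PiE_iff)
            then have uv: "fst (\<pi> j) \<in> S" "snd (\<pi> j) \<in> S" "fst (\<pi> j) \<noteq> snd (\<pi> j)" by auto
            then have ne: "hv Z (fst (\<pi> j)) \<noteq> hv Z (snd (\<pi> j))" using True by (auto simp: inj_on_def)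
            have "x \<in> I" using hv_less[of Z] j by (auto simp: I_def Suc_le_eq)
            then have "Y x \<in> A x" using Y j by (force simp: PiE_iff)
            moreover have "(Suc j, Suc (hv Z (fst (\<pi> j)))) \<notin> ?D0" using ne by auto
            then have "Y (Suc j, Suc (hv Z (fst (\<pi> j)))) = Z' (Suc j, Suc (hv Z (fst (\<pi> j))))" using h by blast
            moreover have "gv Y j (fst (\<pi> j)) = gv Y j (snd (\<pi> j))" using h j by blast
            ultimately show "Y x \<in> ?F x" using j hv[OF Y] by (simp add: gv_def A_def)
          qed
        qed (use finI finA' in auto)
        ultimately show ?thesis by simp
      qed
      have "card ?P \<le> card (?T \<times> ?T)" using finT by (intro card_mono) auto
      also have "\<dots> \<le> q * q" using True unfolding card_cartesian_product by (intro mult_le_mono) auto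
      finally have "card ?X \<le> (q * q) ^ q" by (simp add: card_PiE power_mono)
      then have "real (card ?X) \<le> real ((q * q) ^ q)" by (simp only: of_nat_le_iff)
      then have "real (card ?X) * (2 / real G) ^ q \<le> real ((q * q) ^ q) * (2 / real G) ^ q"
        by (intro mult_right_mono) auto
      also have "\<dots> = (real q * real q * (2 / real G)) ^ q"
        by (simp only: of_nat_power of_nat_mult power_mult_distrib)
      also have "real q * real q * (2 / real G) = 1 / 2" by (simp add: G_def q_def power2_eq_square)
      finally have le: "real (card ?X) * (2 / real G) ^ q \<le> (1 / 2) ^ q" .
      show ?thesis
      proof (rule rare_mono[OF rare_Bex[OF fX **] le])
        fix Y assume Y: "Y \<in> PiE I ?A" and Q: "?Q s Y"
        have "\<forall>j\<in>{..<q}. \<exists>p. p \<in> ?P \<and> gv Y j (fst p) = gv Y j (snd p)"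
        proof
          fix j assume "j \<in> {..<q}"
          then have "\<not> inj_on (gv Y j) ?T" using Q fv[OF Y] by simp
          then show "\<exists>p. p \<in> ?P \<and> gv Y j (fst p) = gv Y j (snd p)" by (auto simp: inj_on_def)
        qed
        from bchoice[OF this] obtain \<pi>
          where "\<forall>j\<in>{..<q}. \<pi> j \<in> ?P \<and> gv Y j (fst (\<pi> j)) = gv Y j (snd (\<pi> j))" by blast
        then show "\<exists>\<pi>\<in>?X. \<forall>j<q. gv Y j (fst (\<pi> j)) = gv Y j (snd (\<pi> j))"
          by (intro bexI[of _ "restrict \<pi> {..<q}"]) (auto simp: PiE_iff)
      qed (use finI finA' in auto)
    qed
  qed (use finI finA in \<open>auto simp: I_def\<close>)
  have "real (card S) * (1 / 2) ^ q \<le> real (2 * k) * (1 / 2) ^ q"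
    using cardS by (intro mult_right_mono) (simp_all only: of_nat_le_iff zero_le_power zero_le_divide_1_iff zero_le_numeral)
  also have "\<dots> \<le> 1 / 8" using two_k_le_q by (simp add: power_divide field_simps)
  finally have le: "real (card S) * (1 / 2) ^ q \<le> 1 / 8" .
  show ?thesis
    by (rule rare_mono[OF rare_Bex[OF finS *] le]) (use finI finA in auto)
qed

text \<open>Being a function of the labels alone, this choice stays fixed while the sampling seeds
  vary in \<open>rare_not_isolated\<close>. The default 0 keeps it below \<open>q\<close> for groups
  without an injective table.\<close>

definition lsel where
  "lsel Y i = (if \<exists>j<q. inj_on (gv Y j) {v \<in> S. fv Y v = i}
     then SOME j. j < q \<and> inj_on (gv Y j) {v \<in> S. fv Y v = i} else 0)"

lemma lsel_less: "lsel Y i < q"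
proof (cases "\<exists>j<q. inj_on (gv Y j) {v \<in> S. fv Y v = i}")
  case True
  then show ?thesis using someI_ex[OF True] by (simp add: lsel_def)
next
  case False
  then have "lsel Y i = 0" unfolding lsel_def by (rule if_not_P)
  then show ?thesis by (simp add: q_def)
qed

lemma lsel_inj: "\<exists>j<q. inj_on (gv Y j) {v \<in> S. fv Y v = i} \<Longrightarrow> inj_on (gv Y (lsel Y i)) {v \<in> S. fv Y v = i}"
  using someI_ex[of "\<lambda>j. j < q \<and> inj_on (gv Y j) {v \<in> S. fv Y v = i}"] by (simp add: lsel_def)

text \<open>With everything but the \<open>q\<close> sampling seeds fixed, the class
  \<open>C\<close> of an edge is fixed, and one of the rates suits its size. By
  \<open>card_isolating_ge\<close> each seed fails at that rate with probability at most
  \<open>31 / 32\<close>, and the seeds are independent.\<close>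

lemma rare_not_isolated:
  "rare (1/8) I A (\<lambda>Y. \<exists>e\<in>M. \<forall>t<q. \<forall>j<q.
      \<not> isolates Y t j (cls Y (lsel Y (fv Y (fst e))) (fst e) (lsel Y (fv Y (snd e))) (snd e)))"
proof -
  let ?C = "\<lambda>Y e. cls Y (lsel Y (fv Y (fst e))) (fst e) (lsel Y (fv Y (snd e))) (snd e)"
  have *: "rare ((31 / 32) ^ q) I A (\<lambda>Y. \<forall>t<q. \<forall>j<q. \<not> isolates Y t j (?C Y e))" if e: "e \<in> M" for e
  proof -
    let ?D0 = "(\<lambda>t. (Suc t, 0 :: nat)) ` {..<q}"
    have "card ?D0 = q" by (subst card_image) (auto simp: inj_on_def)
    moreover have "rare ((31 / 32) ^ card ?D0) I A (\<lambda>Y. \<forall>t<q. \<forall>j<q. \<not> isolates Y t j (?C Y e))"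
    proof (rule rare_indep)
      show "?D0 \<subseteq> I" by (auto simp: I_def)
      fix Z assume Z: "Z \<in> PiE (I - ?D0) A"
      define C where "C = ?C Z e"
      let ?id = "\<lambda>e. fst e * n + snd e"
      have C: "?C Y e = C" if "\<forall>j. j \<notin> ?D0 \<longrightarrow> Y j = Z j" for Y
      proof -
        have "(0, c) \<notin> ?D0" "(Suc i, Suc c) \<notin> ?D0" for i c by auto
        then have Y: "Y (0, c) = Z (0, c)" "Y (Suc i, Suc c) = Z (Suc i, Suc c)" for i c
          using that by blast+
        have h: "hv Y = hv Z" by (intro ext) (simp add: hv_def Y)
        have f: "fv Y = fv Z" by (intro ext) (simp add: fv_def h Y)
        have g: "gv Y = gv Z" by (intro ext) (simp add: gv_def h Y)
        have "lsel Y = lsel Z" by (intro ext) (simp only: lsel_def f g)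
        then show ?thesis by (simp add: C_def cls_def f g)
      qed
      have CE: "C \<subseteq> Ed" "e \<in> C" using e M by (auto simp: C_def cls_def)
      have finC: "finite C" using CE finM finite_subset by auto
      have n0: "n > 0" using k kn by simp
      have inj: "inj_on ?id Ed"
      proof (rule inj_onI)
        fix a b assume ab: "a \<in> Ed" "b \<in> Ed" "?id a = ?id b"
        have "(?id a) div n = fst a" "(?id a) mod n = snd a" "(?id b) div n = fst b" "(?id b) mod n = snd b"
          using ab(1,2) Ed by auto
        then show "a = b" using ab(3) by (metis prod_eqI)
      qed
      have id_less: "?id a < n * n" if "a \<in> Ed" for a
      proof -
        have "fst a < n" "snd a < n" using that Ed by auto
        then have "?id a < Suc (fst a) * n" by simp
        also have "\<dots> \<le> n * n" using \<open>fst a < n\<close> by (intro mult_le_mono1) simp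
        finally show ?thesis .
      qed
      let ?C' = "?id ` C"
      have cC: "card ?C' = card C" using CE inj by (intro card_image) (auto intro: inj_on_subset)
      have "?C' \<subseteq> {..<n * n}" using CE id_less by auto
      then have "card ?C' \<le> n * n" using card_mono[of "{..<n * n}"] by simp
      also have nn: "n * n \<le> 2 ^ (2 * l)" using mult_le_mono[OF nl nl] by (simp add: power_add mult_2)
      finally have m_le: "card ?C' \<le> 2 ^ (2 * l)" .
      have m0: "card ?C' > 0" using CE finC by (auto simp: card_gt_0_iff)
      \<comment> \<open>The least exponent satisfying the first bound; minimality yields the
        second.\<close>
      obtain p where p: "8 * card ?C' \<le> 2 ^ p" "2 ^ p < 16 * card ?C'"
      proof -
        define p where "p = (LEAST p. 8 * card ?C' \<le> 2 ^ p)"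
        have "8 * card ?C' \<le> 2 ^ (8 * card ?C')" by (rule less_imp_le[OF less_exp])
        then have 1: "8 * card ?C' \<le> 2 ^ p" unfolding p_def by (rule LeastI)
        have "p \<noteq> 0" using 1 m0 by (cases p) auto
        then obtain p' where p': "p = Suc p'" by (cases p) auto
        then have "\<not> 8 * card ?C' \<le> 2 ^ p'" using not_less_Least[of p' "\<lambda>p. 8 * card ?C' \<le> 2 ^ p"]
          by (simp add: p_def)
        then have "2 ^ p < 16 * card ?C'" unfolding p' by simp
        then show ?thesis using 1 by (intro that)
      qed
      have "(2 :: nat) ^ p < 2 ^ (2 * l + 4)" using p(2) m_le by (simp add: power_add)
      then have pl: "p < 2 * l + 4" by (rule power_less_imp_less_exp[rotated]) simp
      \<comment> \<open>The threshold \<open>2 ^ j\<close> out of \<open>U\<close> samples at rate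
        \<open>1 / 2 ^ p\<close>. As \<open>p < 2 * l + 4\<close>, it is still at least
        \<open>n * n\<close> and so bounds the edge identifiers, as \<open>card_isolating_ge\<close>
        requires.\<close>
      define j where "j = 16 * (l + 5) - p"
      have j: "j < q" "16 * (l + 5) = j + p" "2 * l \<le> j" using pl by (auto simp: j_def q_def)
      have UT: "U = 2 ^ j * 2 ^ p" using j(2) by (simp add: U_def power_add)
      have "n * n \<le> 2 ^ j" using j(3) by (intro order_trans[OF nn] power_increasing) simp_all
      then have ge: "real (U * U) / 32 \<le> real (card {z \<in> {..<U * U}. \<exists>!x. x \<in> ?C' \<and> hash U z x < 2 ^ j})"
        using CE id_less finC by (intro card_isolating_ge[OF U0 UT _ _ p]) (auto intro!: less_imp_le dest: less_le_trans)
      let ?F = "{z \<in> {..<U * U}. \<not> (\<exists>!x. x \<in> ?C' \<and> hash U z x < 2 ^ j)}"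
      have "card ?F + card {z \<in> {..<U * U}. \<exists>!x. x \<in> ?C' \<and> hash U z x < 2 ^ j} = card {..<U * U}"
        by (rule card_filter_not) simp
      then have "real (card ?F) + real (card {z \<in> {..<U * U}. \<exists>!x. x \<in> ?C' \<and> hash U z x < 2 ^ j}) = real (U * U)"
        unfolding of_nat_add[symmetric] by simp
      then have F: "real (card ?F) \<le> 31 / 32 * real (U * U)" using ge by linarith
      show "\<exists>F. \<forall>i\<in>?D0. F i \<subseteq> A i \<and> real (card (F i)) \<le> 31 / 32 * real (card (A i)) \<and>
        (\<forall>Y\<in>PiE I A. (\<forall>j. j \<notin> ?D0 \<longrightarrow> Y j = Z j) \<and> (\<forall>t<q. \<forall>j<q. \<not> isolates Y t j (?C Y e)) \<longrightarrow> Y i \<in> F i)"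
      proof (intro exI[of _ "\<lambda>_. ?F"] ballI conjI impI)
        fix x assume x: "x \<in> ?D0"
        show "?F \<subseteq> A x" by (auto simp: A_def)
        show "real (card ?F) \<le> 31 / 32 * real (card (A x))" using F by (simp add: cardA)
        fix Y assume Y: "Y \<in> PiE I A"
          and h: "(\<forall>j. j \<notin> ?D0 \<longrightarrow> Y j = Z j) \<and> (\<forall>t<q. \<forall>j<q. \<not> isolates Y t j (?C Y e))"
        obtain t where t: "t < q" "x = (Suc t, 0)" using x by blast
        have "Y x \<in> A x" using Y t by (auto simp: PiE_iff I_def)
        moreover have "\<not> (\<exists>!x. x \<in> ?C' \<and> hash U (Y (Suc t, 0)) x < 2 ^ j)"
        proof
          assume "\<exists>!x. x \<in> ?C' \<and> hash U (Y (Suc t, 0)) x < 2 ^ j"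
          then obtain a where a: "a \<in> C" "hash U (Y (Suc t, 0)) (?id a) < 2 ^ j"
            "\<And>b. b \<in> C \<Longrightarrow> hash U (Y (Suc t, 0)) (?id b) < 2 ^ j \<Longrightarrow> ?id b = ?id a" by blast
          have "isolates Y t j C" unfolding isolates_def
          proof (intro ex1I[of _ a])
            fix b assume "b \<in> C \<and> hash U (Y (Suc t, 0)) (?id b) < 2 ^ j"
            then show "b = a" using a(3)[of b] a(1) CE inj by (auto dest: inj_onD)
          qed (use a(1,2) in simp)
          moreover have "?C Y e = C" using h by (intro C) blast
          ultimately show False using h t j(1) by auto
        qed
        ultimately show "Y x \<in> ?F" using t by (simp add: A_def)
      qed
    qed (use finI finA in auto)
    ultimately show ?thesis by simp
  qed
  \<comment> \<open>Each edge fails with probability at most \<open>(1 / 2) ^ (l + 5)\<close>, and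
    there are at most \<open>k \<le> 2 ^ l\<close> edges.\<close>
  have "(31 / 32 :: real) ^ q = ((31 / 32) ^ 32) ^ (l + 5)" by (simp add: q_def flip: power_mult)
  also have "\<dots> \<le> (1 / 2) ^ (l + 5)" by (intro power_mono) (simp_all add: power_divide)
  finally have "real (card M) * (31 / 32) ^ q \<le> real (card M) * (1 / 2) ^ (l + 5)"
    by (intro mult_left_mono) auto
  also have "\<dots> \<le> real (2 ^ l) * (1 / 2) ^ (l + 5)"
    using M(2) k_le by (intro mult_right_mono) (simp_all only: of_nat_le_iff, auto)
  also have "\<dots> \<le> 1 / 8" by (simp add: power_add power_divide)
  finally have le: "real (card M) * (31 / 32) ^ q \<le> 1 / 8" .
  show ?thesis
    by (rule rare_mono[OF rare_Bex[OF finM(1) *] le]) (use finI finA in auto)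
qed

text \<open>The first three failures are chained, each assuming that the previous ones did not
  occur; the bound on the fourth holds for any labels.\<close>

lemma rare_not_good: "rare (1/2) I A (\<lambda>Y. \<not> good Y)"
proof -
  have le: "1/8 + (1/8 + (1/8 + 1/8)) \<le> (1/2 :: real)" by simp
  show ?thesis
  proof (rule rare_mono[OF rare_disj[OF rare_collision rare_disj[OF rare_overload
        rare_disj[OF rare_no_injective rare_not_isolated]]] le])
    fix Y assume ng: "\<not> good Y"
    show "\<not> inj_on (hv Y) S \<or> inj_on (hv Y) S \<and> (\<exists>i. q \<le> card {v \<in> S. fv Y v = i}) \<or>
      inj_on (hv Y) S \<and> (\<forall>i. card {v \<in> S. fv Y v = i} < q)
        \<and> (\<exists>s\<in>S. \<forall>j<q. \<not> inj_on (gv Y j) {v \<in> S. fv Y v = fv Y s}) \<or>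
      (\<exists>e\<in>M. \<forall>t<q. \<forall>j<q. \<not> isolates Y t j
        (cls Y (lsel Y (fv Y (fst e))) (fst e) (lsel Y (fv Y (snd e))) (snd e)))"
    proof (rule ccontr)
      assume *: "\<not> ?thesis"
      have "inj_on (gv Y (lsel Y (fv Y s))) {v \<in> S. fv Y v = fv Y s}" if "s \<in> S" for s
        using * that by (intro lsel_inj) (meson not_le)
      then have "inj_on (\<lambda>v. (fv Y v, gv Y (lsel Y (fv Y v)) v)) S"
        unfolding inj_on_def by (metis (mono_tags, lifting) Pair_inject mem_Collect_eq)
      then have "good Y" unfolding good_def using * lsel_less by (intro exI[of _ "lsel Y"]) fastforce
      then show False using ng by simp
    qed
  qed (use finI finA in auto)
qed

end

section \<open>Coin tosses\<close>

lemma sets_coin_tape: "{\<omega> \<in> space coin_tape. P (stake m \<omega>)} \<in> sets coin_tape"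
proof -
  have 1: "sets coin_tape = sets (stream_space (count_space (UNIV :: bool set)))"
    unfolding coin_tape_def by (intro sets_stream_space_cong) simp
  have "stake m \<in> measurable (stream_space (count_space (UNIV :: bool set))) (count_space UNIV)"
    by (rule measurable_stake)
  then have "stake m \<in> measurable coin_tape (count_space UNIV)"
    using measurable_cong_sets[OF 1 refl] by blast
  then have "stake m -` {bs. P bs} \<inter> space coin_tape \<in> sets coin_tape"
    by (rule measurable_sets) simp
  also have "stake m -` {bs. P bs} \<inter> space coin_tape = {\<omega> \<in> space coin_tape. P (stake m \<omega>)}" by auto
  finally show ?thesis .
qed

lemma space_coin_tape: "space coin_tape = UNIV"
  by (simp add: coin_tape_def space_stream_space)

lemma prob_space_coin_tape: "prob_space coin_tape"
proof -
  show ?thesis unfolding coin_tape_def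
    by (rule prob_space.prob_space_stream_space) (rule measure_pmf.prob_space_axioms)
qed

text \<open>Induction on \<open>m\<close>, splitting off the first coin; the tail of the tape is
  again a coin tape.\<close>

lemma emeasure_coin_tape_prefix:
  "emeasure coin_tape {\<omega> \<in> space coin_tape. stake m \<omega> = bs} = (if length bs = m then ennreal ((1/2) ^ m) else 0)"
proof (induction m arbitrary: bs)
  case 0
  interpret prob_space coin_tape by (rule prob_space_coin_tape)
  show ?case using emeasure_space_1 by (cases bs) auto
next
  case (Suc m)
  have "emeasure coin_tape {\<omega> \<in> space coin_tape. stake (Suc m) \<omega> = bs}
      = (\<integral>\<^sup>+t. emeasure coin_tape {x \<in> space coin_tape. t ## x \<in> {\<omega> \<in> space coin_tape. stake (Suc m) \<omega> = bs}}
          \<partial>measure_pmf (bernoulli_pmf (1/2)))"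
    unfolding coin_tape_def
    by (rule prob_space.emeasure_stream_space[OF measure_pmf.prob_space_axioms]) (rule sets_coin_tape[of "\<lambda>x. x = bs" "Suc m", unfolded coin_tape_def])
  also have "\<dots> = (\<integral>\<^sup>+t. (if bs \<noteq> [] \<and> t = hd bs then (if length (tl bs) = m then ennreal ((1/2) ^ m) else 0) else 0)
          \<partial>measure_pmf (bernoulli_pmf (1/2)))"
  proof (intro nn_integral_cong)
    fix t
    have "{x \<in> space coin_tape. t ## x \<in> {\<omega> \<in> space coin_tape. stake (Suc m) \<omega> = bs}}
      = (if bs \<noteq> [] \<and> t = hd bs then {x \<in> space coin_tape. stake m x = tl bs} else {})"
      by (cases bs) (auto simp: space_coin_tape)
    then show "emeasure coin_tape {x \<in> space coin_tape. t ## x \<in> {\<omega> \<in> space coin_tape. stake (Suc m) \<omega> = bs}}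
      = (if bs \<noteq> [] \<and> t = hd bs then (if length (tl bs) = m then ennreal ((1/2) ^ m) else 0) else 0)"
      by (simp only: Suc.IH emeasure_empty split: if_split) simp
  qed
  also have "\<dots> = (if length bs = Suc m then ennreal ((1/2) ^ Suc m) else 0)"
  proof (cases bs)
    case (Cons b bs')
    have "ennreal ((1 / 2) ^ m / 2) = ennreal (1 / 2 * (1 / 2) ^ m)" by simp
    also have "\<dots> = ennreal (1 / 2) * ennreal ((1 / 2) ^ m)" by (rule ennreal_mult) auto
    also have "ennreal (1 / 2) = inverse 2" by (rule ennreal_half)
    finally have "ennreal ((1 / 2) ^ m / 2) = inverse 2 * ennreal ((1 / 2) ^ m)" .
    then show ?thesis using Cons by (cases b) (auto simp: mult.commute)
  qed simp
  finally show ?case .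
qed

text \<open>The bridge from the tape to counting: all prefixes of length \<open>m\<close> are
  equally likely.\<close>

lemma measure_coin_tape_prefix:
  "measure coin_tape {\<omega> \<in> space coin_tape. P (stake m \<omega>)} = real (card {bs. length bs = m \<and> P bs}) / 2 ^ m"
proof -
  interpret prob_space coin_tape by (rule prob_space_coin_tape)
  let ?L = "{bs :: bool list. length bs = m \<and> P bs}"
  have fin: "finite ?L" using finite_lists_length_eq[of "UNIV :: bool set" m] by (auto intro: rev_finite_subset)
  have eq: "{\<omega> \<in> space coin_tape. P (stake m \<omega>)} = (\<Union>bs\<in>?L. {\<omega> \<in> space coin_tape. stake m \<omega> = bs})" by auto
  have "measure coin_tape {\<omega> \<in> space coin_tape. P (stake m \<omega>)}
      = (\<Sum>bs\<in>?L. measure coin_tape {\<omega> \<in> space coin_tape. stake m \<omega> = bs})"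
    unfolding eq using sets_coin_tape[of "\<lambda>x. x = _"] fin
    by (intro finite_measure_finite_Union) (auto simp: disjoint_family_on_def)
  also have "\<dots> = (\<Sum>bs\<in>?L. (1 / 2) ^ m)"
    by (intro sum.cong refl) (simp add: measure_def emeasure_coin_tape_prefix)
  finally show ?thesis by (simp add: power_divide)
qed

section \<open>Random numbers read off the tape\<close>

definition num :: "bool list \<Rightarrow> nat" where
  "num bs = foldl (\<lambda>x b. 2 * x + of_bool b) 0 bs"

lemma num_snoc: "num (bs @ [b]) = 2 * num bs + of_bool b" by (simp add: num_def)

lemma num_Nil: "num [] = 0" by (simp add: num_def)

lemma num_less: "num bs < 2 ^ length bs"
  by (induction bs rule: rev_induct) (auto simp: num_Nil num_snoc)

lemma num_inj: "length bs = length cs \<Longrightarrow> num bs = num cs \<Longrightarrow> bs = cs"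
proof (induction bs arbitrary: cs rule: rev_induct)
  case (snoc b bs)
  then obtain cs' c where cs: "cs = cs' @ [c]" by (cases cs rule: rev_cases) auto
  have e: "2 * num bs + of_bool b = 2 * num cs' + (of_bool c :: nat)" using snoc.prems(2) cs by (simp add: num_snoc)
  have "num bs = num cs' \<and> b = c" using e by (cases b; cases c; simp; presburger)
  then show ?case using snoc cs by simp
qed simp

text \<open>Number \<open>p\<close> is the binary value of the \<open>p\<close>-th block of
  \<open>w\<close> bits, most significant first. A block not yet reached is empty and gives 0, like
  fresh memory.\<close>

definition numbers :: "nat \<Rightarrow> bool list \<Rightarrow> nat \<Rightarrow> nat" where
  "numbers w bs p = num (take w (drop (p * w) bs))"

lemma numbers_less: "numbers w bs p < 2 ^ w"
proof -
  have "numbers w bs p < 2 ^ length (take w (drop (p * w) bs))" unfolding numbers_def by (rule num_less)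
  also have "\<dots> \<le> 2 ^ w" by (intro power_increasing) auto
  finally show ?thesis .
qed

text \<open>The effect of one coin toss of the initialization program: the number under construction
  is doubled and the bit added.\<close>

lemma numbers_snoc:
  assumes "w > 0"
  shows "numbers w (bs @ [b]) = (numbers w bs)(length bs div w := 2 * numbers w bs (length bs div w) + of_bool b)"
proof
  fix p
  let ?i = "length bs"
  have i: "?i div w * w \<le> ?i" "?i < Suc (?i div w) * w"
    using assms dividend_less_div_times[of w ?i] by (auto simp: div_times_less_eq_dividend)
  consider "p = ?i div w" | "p < ?i div w" | "p > ?i div w" by linarith
  then show "numbers w (bs @ [b]) p = ((numbers w bs)(?i div w := 2 * numbers w bs (?i div w) + of_bool b)) p"
  proof cases
    case 1
    then have "take w (drop (p * w) (bs @ [b])) = take w (drop (p * w) bs) @ [b]" using i by auto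
    then show ?thesis using 1 by (simp only: numbers_def num_snoc fun_upd_same)
  next
    case 2
    then have "Suc p * w \<le> ?i div w * w" by (intro mult_le_mono1) simp
    then have "p * w + w \<le> ?i" using i by (intro order_trans[OF _ i(1)]) simp
    then have "take w (drop (p * w) (bs @ [b])) = take w (drop (p * w) bs)" by simp
    then show ?thesis using 2 by (simp only: numbers_def fun_upd_other less_not_refl3 not_False_eq_True)
  next
    case 3
    then have "Suc (?i div w) * w \<le> p * w" by (intro mult_le_mono1) simp
    then have "?i < p * w" using i by simp
    then show ?thesis using 3 by (simp add: numbers_def)
  qed
qed

text \<open>Serves to inject coin prefixes into tables of random numbers.\<close>

lemma numbers_inj:
  assumes w: "w > 0" and "length bs = m * w" "length cs = m * w" "\<And>p. p < m \<Longrightarrow> numbers w bs p = numbers w cs p"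
  shows "bs = cs"
proof (rule nth_equalityI)
  fix i assume i: "i < length bs"
  let ?p = "i div w"
  have p: "?p < m" using i assms by (simp add: less_mult_imp_div_less)
  have "Suc ?p * w \<le> m * w" using p by (intro mult_le_mono1) simp
  then have l: "length (take w (drop (?p * w) xs)) = w" if "length xs = m * w" for xs :: "bool list" using that by simp
  have "take w (drop (?p * w) bs) = take w (drop (?p * w) cs)"
    using assms(4)[OF p] l[OF assms(2)] l[OF assms(3)] unfolding numbers_def by (intro num_inj) simp_all
  then have "take w (drop (?p * w) bs) ! (i mod w) = take w (drop (?p * w) cs) ! (i mod w)" by simp
  moreover have "take w (drop (?p * w) xs) ! (i mod w) = xs ! i" if "length xs = m * w" for xs :: "bool list"
  proof -
    have "?p * w \<le> length xs" unfolding that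
      by (rule order_trans[OF _ \<open>Suc ?p * w \<le> m * w\<close>]) simp
    then have "drop (?p * w) xs ! (i mod w) = xs ! (?p * w + i mod w)" by (rule nth_drop)
    then show ?thesis using w by (simp only: nth_take mod_less_divisor div_mult_mod_eq)
  qed
  ultimately show "bs ! i = cs ! i" using assms(2,3) by simp
qed (use assms in simp)

context sampling
begin

text \<open>All random numbers form one array: repetition \<open>a\<close>, row \<open>t\<close>,
  column \<open>c\<close>.\<close>

definition ix where "ix a t c = (a * (q + 1) + t) * (RR + 1) + c"
definition NX where "NX = q * (q + 1) * (RR + 1)"
definition repY where "repY X a = (\<lambda>(t, c). X (ix a t c))"

lemma ix_surj: "p < NX \<Longrightarrow> \<exists>a t c. a < q \<and> t \<le> q \<and> c \<le> RR \<and> p = ix a t c"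
proof -
  assume p: "p < NX"
  let ?r = "p div (RR + 1)"
  have "?r < q * (q + 1)" using p unfolding NX_def by (simp add: less_mult_imp_div_less)
  then have "?r div (q + 1) < q" by (simp add: less_mult_imp_div_less)
  moreover have "?r mod (q + 1) \<le> q" using mod_less_divisor[of "q + 1" ?r] by linarith
  moreover have "p mod (RR + 1) \<le> RR" using mod_less_divisor[of "RR + 1" p] by linarith
  moreover have "p = ix (?r div (q + 1)) (?r mod (q + 1)) (p mod (RR + 1))"
    unfolding ix_def by (simp only: div_mult_mod_eq)
  ultimately show ?thesis by blast
qed

text \<open>\<open>good\<close> looks only at indices in \<open>I\<close>, so it does not matter
  that members of \<open>PiE\<close> are undefined elsewhere.\<close>

lemma good_cong:
  assumes eq: "\<And>i. i \<in> I \<Longrightarrow> Y i = Y' i" and "good Y"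
  shows "good Y'"
proof -
  have q0: "q > 0" by (simp add: q_def)
  have h: "hv Y' = hv Y" using eq[of "(0, 0)"] by (auto simp: hv_def I_def)
  have f: "fv Y' = fv Y" using eq hv_less[of Y] by (intro ext) (auto simp: fv_def h I_def Suc_le_eq)
  have g: "gv Y' j = gv Y j" if "j < q" for j
    using eq hv_less[of Y] that by (intro ext) (auto simp: gv_def h I_def Suc_le_eq)
  have i: "isolates Y' t j C = isolates Y t j C" if "t < q" for t j C
    using eq[of "(Suc t, 0)"] that by (auto simp: isolates_def I_def)
  from \<open>good Y\<close> obtain ls where ls: "\<And>i. ls i < q" "inj_on (\<lambda>v. (fv Y v, gv Y (ls (fv Y v)) v)) S"
    "\<forall>(u, v)\<in>M. \<exists>t<q. \<exists>j<q. isolates Y t j (cls Y (ls (fv Y u)) u (ls (fv Y v)) v)"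
    unfolding good_def by blast
  have c: "cls Y' (ls a) u (ls b) v = cls Y (ls a) u (ls b) v" for a b u v
    unfolding cls_def f g[OF ls(1)] ..
  have "\<exists>t<q. \<exists>j<q. isolates Y' t j (cls Y (ls (fv Y u)) u (ls (fv Y v)) v)" if "(u, v) \<in> M" for u v
    using ls(3) that i by blast
  then have "\<forall>(u, v)\<in>M. \<exists>t<q. \<exists>j<q. isolates Y' t j (cls Y' (ls (fv Y u)) u (ls (fv Y v)) v)"
    unfolding c by blast
  then show ?thesis unfolding good_def f using ls(1,2)
    by (intro exI[of _ ls] conjI) (simp_all add: g[OF ls(1)])
qed

text \<open>A prefix for which all \<open>q\<close> repetitions fail is determined by
  \<open>q\<close> bad tables. By \<open>rare_not_good\<close> these are at most a fraction
  \<open>(1 / 2) ^ q\<close> of all \<open>q\<close>-tuples of tables, and there are as many tuples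
  as prefixes.\<close>

lemma prob_some_rep_good:
  "measure coin_tape {\<omega> \<in> space coin_tape. \<exists>a<q. good (repY (numbers q (stake (NX * q) \<omega>)) a)} \<ge> 1 - (1 / 2) ^ q"
proof -
  interpret prob_space coin_tape by (rule prob_space_coin_tape)
  let ?m = "NX * q"
  let ?Bad = "{Y \<in> PiE I A. \<not> good Y}"
  let ?L = "{bs. length bs = ?m \<and> (\<forall>a<q. \<not> good (repY (numbers q bs) a))}"
  have q0: "q > 0" by (simp add: q_def)
  let ?f = "\<lambda>bs. \<lambda>a\<in>{..<q}. \<lambda>i\<in>I. repY (numbers q bs) a i"
  have finBad: "finite ?Bad" using finI finA by (simp add: finite_PiE)
  have "card ?L \<le> card (PiE {..<q} (\<lambda>_. ?Bad))"
  proof (rule card_inj_on_le[where f = ?f])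
    show "inj_on ?f ?L"
    proof (rule inj_onI)
      fix bs cs assume l: "bs \<in> ?L" "cs \<in> ?L" and e: "?f bs = ?f cs"
      show "bs = cs"
      proof (rule numbers_inj[OF q0, of _ NX])
        fix p assume "p < NX"
        then obtain a t c where p: "a < q" "t \<le> q" "c \<le> RR" "p = ix a t c" using ix_surj by blast
        have "?f bs a (t, c) = ?f cs a (t, c)" using e by simp
        then show "numbers q bs p = numbers q cs p" using p by (simp add: repY_def I_def)
      qed (use l in auto)
    qed
    show "?f ` ?L \<subseteq> PiE {..<q} (\<lambda>_. ?Bad)"
    proof
      fix F assume "F \<in> ?f ` ?L"
      then obtain bs where bs: "bs \<in> ?L" "F = ?f bs" by blast
      have "(\<lambda>i\<in>I. repY (numbers q bs) a i) \<in> ?Bad" if "a < q" for a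
      proof -
        have "\<not> good (\<lambda>i\<in>I. repY (numbers q bs) a i)"
          using bs that good_cong[of "\<lambda>i\<in>I. repY (numbers q bs) a i" "repY (numbers q bs) a"] by auto
        moreover have "repY (numbers q bs) a i \<in> A i" for i
          by (cases i) (simp add: repY_def A_def UU numbers_less)
        ultimately show ?thesis by (auto simp: PiE_iff)
      qed
      then show "F \<in> PiE {..<q} (\<lambda>_. ?Bad)" using bs by (auto simp: PiE_iff)
    qed
    show "finite (PiE {..<q} (\<lambda>_. ?Bad))" using finBad by (intro finite_PiE) auto
  qed
  then have "real (card ?L) \<le> real (card ?Bad) ^ q" by (simp add: card_PiE flip: of_nat_power)
  also have "\<dots> \<le> (1 / 2 * real (card (PiE I A))) ^ q"
    using rare_not_good by (intro power_mono) (simp_all add: rare_def)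
  also have "card (PiE I A) = 2 ^ (q * card I)"
    using finI by (simp add: card_PiE cardA UU flip: power_mult)
  also have "(1 / 2 * real (2 ^ (q * card I))) ^ q = (1 / 2) ^ q * real (2 ^ (q * card I)) ^ q"
    by (rule power_mult_distrib)
  also have "real (2 ^ (q * card I)) ^ q = 2 ^ (NX * q)"
    by (simp add: I_def NX_def algebra_simps flip: power_mult)
  finally have L: "real (card ?L) / 2 ^ ?m \<le> (1 / 2) ^ q" by (simp add: divide_le_eq)
  let ?E = "{\<omega> \<in> space coin_tape. \<exists>a<q. good (repY (numbers q (stake ?m \<omega>)) a)}"
  have "1 - measure coin_tape ?E = measure coin_tape (space coin_tape - ?E)"
    using prob_compl[OF sets_coin_tape[of "\<lambda>bs. \<exists>a<q. good (repY (numbers q bs) a)" ?m]] by simp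
  also have "space coin_tape - ?E = {\<omega> \<in> space coin_tape. \<forall>a<q. \<not> good (repY (numbers q (stake ?m \<omega>)) a)}"
    by auto
  also have "measure coin_tape \<dots> = real (card ?L) / 2 ^ ?m"
    by (rule measure_coin_tape_prefix)
  finally show ?thesis using L by linarith
qed

end

section \<open>The sketch\<close>

text \<open>The parameters of \<open>sampling\<close> again, as functions of the numbers
  \<open>k\<close> and \<open>q\<close> that the programs hold in registers. \<open>cS\<close>
  counts labels, \<open>cQ\<close> pairs of labels, \<open>cN\<close> buckets.\<close>

definition cU :: "nat \<Rightarrow> nat" where "cU q = 2 ^ (q div 2)"
definition cR :: "nat \<Rightarrow> nat" where "cR k = 256 * k ^ 2"
definition cD :: "nat \<Rightarrow> nat \<Rightarrow> nat" where "cD k q = cU q div cR k + 1"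
definition cG :: "nat \<Rightarrow> nat" where "cG q = 4 * q ^ 2"
definition cS :: "nat \<Rightarrow> nat \<Rightarrow> nat" where "cS k q = 8 * k * cG q"
definition cQ :: "nat \<Rightarrow> nat \<Rightarrow> nat" where "cQ k q = cS k q * cS k q"
definition cN :: "nat \<Rightarrow> nat \<Rightarrow> nat" where "cN k q = q ^ 5 * cQ k q"

definition xi :: "nat \<Rightarrow> nat \<Rightarrow> nat \<Rightarrow> nat \<Rightarrow> nat \<Rightarrow> nat" where
  "xi k q a t c = (a * (q + 1) + t) * (cR k + 1) + c"
definition hX where "hX k q X a v = hash (cU q) (X (xi k q a 0 0)) v div cD k q"
definition fX where "fX k q X a v = X (xi k q a 0 (Suc (hX k q X a v))) mod (8 * k)"
definition gX where "gX k q X a b v = X (xi k q a (Suc b) (Suc (hX k q X a v))) mod cG q"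
definition labX where "labX k q X a b v = fX k q X a v * cG q + gX k q X a b v"

text \<open>The family index \<open>i < q ^ 5\<close> packs five numbers in base \<open>q\<close>;
  from the lowest digit: the rate, the sampling seed, the table for the smaller endpoint, the table
  for the larger endpoint, the repetition.\<close>

definition pos :: "nat \<Rightarrow> nat \<Rightarrow> (nat \<Rightarrow> nat) \<Rightarrow> nat \<Rightarrow> nat \<Rightarrow> nat \<Rightarrow> nat" where
  "pos k q X i u v = i * cQ k q + (labX k q X (i div q ^ 4) (i div q ^ 2 mod q) u * cS k q
     + labX k q X (i div q ^ 4) (i div q ^ 3 mod q) v)"
definition pass :: "nat \<Rightarrow> nat \<Rightarrow> nat \<Rightarrow> (nat \<Rightarrow> nat) \<Rightarrow> nat \<Rightarrow> nat \<Rightarrow> nat \<Rightarrow> bool" where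
  "pass n k q X i u v \<longleftrightarrow>
     hash (cU q) (X (xi k q (i div q ^ 4) (Suc (i div q mod q)) 0)) (u * n + v) < 2 ^ (i mod q)"
text \<open>The family of a bucket is recovered as \<open>p div cQ k q\<close>; within a family an
  edge can hit one bucket only.\<close>

definition hit :: "nat \<Rightarrow> nat \<Rightarrow> nat \<Rightarrow> (nat \<Rightarrow> nat) \<Rightarrow> nat \<Rightarrow> nat set \<Rightarrow> bool" where
  "hit n k q X p e \<longleftrightarrow> pos k q X (p div cQ k q) (Min e) (Max e) = p
     \<and> pass n k q X (p div cQ k q) (Min e) (Max e)"
text \<open>
  The identifiers of all edges together sum to less than \<open>n ^ 4\<close>, so the quotient of a bucket by
  \<open>n ^ 4\<close> counts the edges in it and the remainder adds up their identifiers.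
\<close>

definition weight :: "nat \<Rightarrow> nat set \<Rightarrow> nat" where
  "weight n e = n ^ 4 + (Min e * n + Max e)"
definition bucket :: "nat \<Rightarrow> nat \<Rightarrow> nat \<Rightarrow> (nat \<Rightarrow> nat) \<Rightarrow> nat set set \<Rightarrow> nat \<Rightarrow> nat" where
  "bucket n k q X E p = (\<Sum>e\<in>E. if hit n k q X p e then weight n e else 0)"

definition graph :: "nat \<Rightarrow> nat set set \<Rightarrow> bool" where
  "graph n E \<longleftrightarrow> (\<forall>e\<in>E. \<exists>u v. u < v \<and> v < n \<and> e = {u, v})"

lemma graph_edge:
  assumes "graph n E" "e \<in> E"
  shows "Min e < Max e" "Max e < n" "e = {Min e, Max e}"
proof -
  obtain u v where uv: "u < v" "v < n" "e = {u, v}" using assms by (auto simp: graph_def)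
  then have "Min e = u" "Max e = v" by auto
  then show "Min e < Max e" "Max e < n" "e = {Min e, Max e}" using uv by auto
qed

lemma edge_id:
  assumes "graph n E" "e \<in> E"
  shows "(Min e * n + Max e) div n = Min e" "(Min e * n + Max e) mod n = Max e" "Min e * n + Max e < n ^ 2"
proof -
  note m = graph_edge[OF assms]
  show "(Min e * n + Max e) div n = Min e" "(Min e * n + Max e) mod n = Max e" using m by auto
  have "Min e * n + Max e < Suc (Min e) * n" using m by simp
  also have "\<dots> \<le> n * n" using m by (intro mult_le_mono1) simp
  finally show "Min e * n + Max e < n ^ 2" by (simp add: power2_eq_square)
qed

lemma graph_finite: "graph n E \<Longrightarrow> finite E" and graph_card: "graph n E \<Longrightarrow> card E \<le> n ^ 2"
proof -
  assume g: "graph n E"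
  have inj: "inj_on (\<lambda>e. Min e * n + Max e) E"
  proof (rule inj_onI)
    fix d e assume *: "d \<in> E" "e \<in> E" "Min d * n + Max d = Min e * n + Max e"
    have "Min d = Min e" "Max d = Max e"
      using edge_id[OF g *(1)] edge_id[OF g *(2)] *(3) by metis+
    then show "d = e" using graph_edge(3)[OF g *(1)] graph_edge(3)[OF g *(2)] by simp
  qed
  have sub: "(\<lambda>e. Min e * n + Max e) ` E \<subseteq> {..<n ^ 2}" using edge_id(3)[OF g] by auto
  show "finite E" by (rule inj_on_finite[OF inj sub]) simp
  show "card E \<le> n ^ 2" using card_inj_on_le[OF inj sub] by simp
qed

lemma mixed_radix:
  fixes a b G :: nat
  assumes "b < G"
  shows "(a * G + b) div G = a" "(a * G + b) mod G = b"
  using assms by auto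

lemma mixed_radix_eq:
  fixes a b c d G :: nat
  assumes "b < G" "d < G"
  shows "a * G + b = c * G + d \<longleftrightarrow> a = c \<and> b = d"
proof
  assume e: "a * G + b = c * G + d"
  have "(a * G + b) div G = a" "(a * G + b) mod G = b" "(c * G + d) div G = c" "(c * G + d) mod G = d"
    using assms by (simp_all add: mixed_radix)
  then show "a = c \<and> b = d" using e by metis
qed simp

lemma sum_hits_eq:
  fixes k q p :: nat and X :: "nat \<Rightarrow> nat"
  assumes "graph n E"
  defines "H \<equiv> {e \<in> E. hit n k q X p e}"
  shows "bucket n k q X E p = card H * n ^ 4 + (\<Sum>e\<in>H. Min e * n + Max e)"
    and "E \<noteq> {} \<Longrightarrow> (\<Sum>e\<in>H. Min e * n + Max e) < n ^ 4"
proof -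
  have fin: "finite E" using graph_finite assms by blast
  have "bucket n k q X E p = (\<Sum>e\<in>H. weight n e)"
    unfolding bucket_def H_def using fin by (simp add: sum.inter_filter)
  then show "bucket n k q X E p = card H * n ^ 4 + (\<Sum>e\<in>H. Min e * n + Max e)"
    by (simp add: weight_def sum.distrib)
  assume "E \<noteq> {}"
  \<comment> \<open>An edge forces \<open>n > 0\<close>; for \<open>n = 0\<close> the strict bound
    would read \<open>0 < 0\<close>.\<close>
  then obtain e where "e \<in> E" by blast
  then have n0: "n > 0" using graph_edge[OF assms(1)] by fastforce
  have "(\<Sum>e\<in>H. Min e * n + Max e) \<le> (\<Sum>e\<in>H. n ^ 2 - 1)"
    using edge_id(3)[OF assms(1)] by (intro sum_mono) (fastforce simp: H_def)
  also have "\<dots> = card H * (n ^ 2 - 1)" by simp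
  also have "\<dots> \<le> n ^ 2 * (n ^ 2 - 1)"
    using card_mono[of E H] graph_card[OF assms(1)] fin by (intro mult_le_mono1) (auto simp: H_def)
  also have "\<dots> < n ^ 2 * n ^ 2" using n0 by (intro mult_strict_left_mono) auto
  also have "\<dots> = n ^ 4" by (simp flip: power_add)
  finally show "(\<Sum>e\<in>H. Min e * n + Max e) < n ^ 4" .
qed

lemma bucket_le: "graph n E \<Longrightarrow> bucket n k q X E p \<le> n ^ 2 * (2 * n ^ 4)"
proof -
  assume g: "graph n E"
  have "bucket n k q X E p \<le> (\<Sum>e\<in>E. 2 * n ^ 4)"
    unfolding bucket_def
  proof (rule sum_mono)
    fix e assume e: "e \<in> E"
    have "n > 0" using graph_edge[OF g e] by simp
    then have "n ^ 2 \<le> n ^ 4" by (intro power_increasing) auto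
    then show "(if hit n k q X p e then weight n e else 0) \<le> 2 * n ^ 4"
      using edge_id(3)[OF g e] by (simp add: weight_def)
  qed
  also have "\<dots> \<le> n ^ 2 * (2 * n ^ 4)" using graph_card[OF g] by simp
  finally show ?thesis .
qed

lemma bucket_single:
  assumes "graph n E" "bucket n k q X E p div n ^ 4 = 1"
  obtains e where "e \<in> E" "bucket n k q X E p mod n ^ 4 = Min e * n + Max e"
proof -
  define H where "H = {e \<in> E. hit n k q X p e}"
  note c = sum_hits_eq[OF assms(1), of k q X p, folded H_def]
  have "E \<noteq> {}" using assms(2) by (auto simp: bucket_def)
  note s = c(2)[OF this]
  have "card H = 1" using assms(2) unfolding c(1) mixed_radix[OF s] .
  then obtain e where e: "H = {e}" by (auto simp: card_1_singleton_iff)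
  then have "e \<in> E" by (auto simp: H_def)
  moreover have "bucket n k q X E p mod n ^ 4 = Min e * n + Max e" unfolding c(1) mixed_radix[OF s] by (simp add: e)
  ultimately show ?thesis by (rule that)
qed

lemma bucket_singleI:
  assumes "graph n E" "e \<in> E" "\<And>d. d \<in> E \<Longrightarrow> hit n k q X p d \<longleftrightarrow> d = e"
  shows "bucket n k q X E p div n ^ 4 = 1" "bucket n k q X E p mod n ^ 4 = Min e * n + Max e"
proof -
  define H where "H = {e \<in> E. hit n k q X p e}"
  note c = sum_hits_eq[OF assms(1), of k q X p, folded H_def]
  have "E \<noteq> {}" using assms(2) by auto
  note s = c(2)[OF this]
  have e: "H = {e}" using assms by (auto simp: H_def)
  show "bucket n k q X E p div n ^ 4 = 1" "bucket n k q X E p mod n ^ 4 = Min e * n + Max e"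
    unfolding c(1) mixed_radix[OF s] by (simp_all add: e)
qed

text \<open>Linearity of the sketch: a deletion subtracts exactly what the insertion added, so
  buckets depend on the current graph only.\<close>

lemma bucket_insert:
  assumes "graph n E" "e \<notin> E"
  shows "bucket n k q X (insert e E) p = bucket n k q X E p + (if hit n k q X p e then weight n e else 0)"
  using graph_finite[OF assms(1)] assms(2) by (simp add: bucket_def)

text \<open>The query tries all sequences of \<open>k\<close> buckets, read off the base \<open>N\<close> digits of a number \<open>x < N ^ k\<close>.\<close>

definition digit :: "nat \<Rightarrow> nat \<Rightarrow> nat \<Rightarrow> nat" where
  "digit N x i = x div N ^ i mod N"
text \<open>Same numbering as in the output array: edge \<open>m div 2\<close>, with its smaller
  endpoint at even and its larger one at odd \<open>m\<close>.\<close>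

definition endpt :: "(nat \<Rightarrow> nat) \<Rightarrow> nat \<Rightarrow> nat \<Rightarrow> nat \<Rightarrow> nat \<Rightarrow> nat" where
  "endpt c n N x m = (let d = c (digit N x (m div 2)) mod n ^ 4 in if even m then d div n else d mod n)"
definition found :: "(nat \<Rightarrow> nat) \<Rightarrow> nat \<Rightarrow> nat \<Rightarrow> nat \<Rightarrow> nat \<Rightarrow> bool" where
  "found c n k N x \<longleftrightarrow> (\<forall>i<k. c (digit N x i) div n ^ 4 = 1) \<and> inj_on (endpt c n N x) {..<2 * k}"

lemma digits_exist:
  assumes "\<And>i. i < k \<Longrightarrow> p i < N"
  shows "\<exists>x<N ^ k. \<forall>i<k. digit N x i = p i"
  using assms
proof (induction k)
  case (Suc k)
  then obtain x where x: "x < N ^ k" "\<And>i. i < k \<Longrightarrow> digit N x i = p i" by force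
  let ?x = "p k * N ^ k + x"
  have pk: "p k < N" using Suc.prems by simp
  have "?x < Suc (p k) * N ^ k" using x by simp
  also have "\<dots> \<le> N * N ^ k" using pk by (intro mult_le_mono1) simp
  finally have "?x < N ^ Suc k" by simp
  moreover have "digit N ?x i = p i" if "i < Suc k" for i
  proof (cases "i = k")
    case True
    have "N ^ k > 0" using pk by simp
    then have "?x div N ^ k = p k" using x(1) by simp
    then show ?thesis using True pk by (simp add: digit_def)
  next
    case False
    then have i: "i < k" using that by simp
    \<comment> \<open>The new leading digit adds a multiple of \<open>N ^ Suc i\<close>, which
      leaves digit \<open>i\<close> alone.\<close>
    have "k = i + Suc (k - Suc i)" using i by simp
    then have "N ^ k = N ^ i * (N * N ^ (k - Suc i))" by (metis power_add power_Suc)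
    then have "?x = x + N ^ i * (N * (p k * N ^ (k - Suc i)))" by (simp add: mult_ac)
    moreover have "N ^ i \<noteq> 0" using pk by simp
    ultimately have "?x div N ^ i = N * (p k * N ^ (k - Suc i)) + x div N ^ i"
      by (simp only: div_mult_self2 not_False_eq_True)
    then show ?thesis using x(2)[OF i] by (simp add: digit_def)
  qed
  ultimately show ?case by blast
qed simp

text \<open>Valid for every \<open>X\<close>: whatever the coins, a bucket that counts one edge
  yields an edge of the graph, and distinct endpoints make the edges disjoint. A wrong answer is
  therefore impossible.\<close>

lemma found_matching:
  assumes g: "graph n E" and f: "found (bucket n k q X E) n m N x"
  shows "is_k_matching E m {{endpt (bucket n k q X E) n N x (2 * i), endpt (bucket n k q X E) n N x (2 * i + 1)} | i. i < m}"
proof -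
  let ?c = "bucket n k q X E"
  let ?o = "endpt ?c n N x"
  let ?e = "\<lambda>i. {?o (2 * i), ?o (2 * i + 1)}"
  have inj: "inj_on ?o {..<2 * m}" using f by (simp add: found_def)
  have E: "?e i \<in> E" if "i < m" for i
  proof -
    have "?c (digit N x i) div n ^ 4 = 1" using f that by (simp add: found_def)
    then obtain e where e: "e \<in> E" "?c (digit N x i) mod n ^ 4 = Min e * n + Max e"
      by (rule bucket_single[OF g])
    then have "?e i = e" using edge_id[OF g e(1)] graph_edge[OF g e(1)] by (simp add: endpt_def)
    then show ?thesis using e by simp
  qed
  have disj: "disjnt (?e i) (?e j)" if "i < m" "j < m" "i \<noteq> j" for i j
  proof -
    have "?o a \<noteq> ?o b" if "a < 2 * m" "b < 2 * m" "a \<noteq> b" for a b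
      using inj_onD[OF inj] that by auto
    moreover have "2 * i \<noteq> 2 * j" "2 * i \<noteq> 2 * j + 1" "2 * i + 1 \<noteq> 2 * j" "2 * i + 1 \<noteq> 2 * j + 1"
      using that(3) by presburger+
    ultimately show ?thesis using that by (simp add: disjnt_def)
  qed
  have eq: "{?e i | i. i < m} = ?e ` {..<m}" by auto
  have "inj_on ?e {..<m}"
  proof (rule inj_onI)
    fix i j assume "i \<in> {..<m}" "j \<in> {..<m}" "?e i = ?e j"
    then show "i = j" using disj[of i j] by (auto simp: disjnt_def)
  qed
  then have "card (?e ` {..<m}) = m" by (simp add: card_image)
  moreover have "pairwise disjnt (?e ` {..<m})"
    unfolding pairwise_image using disj by (simp add: pairwise_def)
  ultimately show ?thesis unfolding eq is_k_matching_def is_matching_def using E by auto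
qed

definition pairs :: "nat set set \<Rightarrow> (nat \<times> nat) set" where
  "pairs E = (\<lambda>e. (Min e, Max e)) ` E"

text \<open>For each matching edge some bucket isolates an edge with the same labels at both ends,
  though not necessarily the same edge. Since the labels of \<open>s.S\<close> are distinct, the
  recovered edges have \<open>2 * k\<close> distinct endpoints.\<close>

lemma found_if_good:
  fixes n k l :: nat
  assumes kn: "k \<ge> 1" "2 * k \<le> n" "n \<le> 2 ^ l" and q: "q = 32 * (l + 5)"
    and g: "graph n E" and m: "is_k_matching E k M" and a: "a < q"
    and good: "sampling.good n k l (pairs E) (pairs M) (sampling.repY k l X a)"
  shows "\<exists>x<cN k q ^ k. found (bucket n k q X E) n k (cN k q) x"
proof -
  have ME: "M \<subseteq> E" "pairwise disjnt M" "finite M" "card M = k"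
    using m by (auto simp: is_k_matching_def is_matching_def)
  interpret s: sampling n k l "pairs E" "pairs M"
  proof
    show "pairs E \<subseteq> {..<n} \<times> {..<n}"
      using graph_edge(1,2)[OF g] by (auto simp: pairs_def intro: less_trans)
    show "card (pairs M) \<le> k" using ME unfolding pairs_def by (metis card_image_le)
  qed (use kn ME in \<open>auto simp: pairs_def\<close>)
  have sq: "s.q = q" using q by (simp add: s.q_def)
  have sU: "s.U = cU q" by (simp add: s.U_def cU_def q)
  have sR: "s.RR = cR k" by (simp add: s.RR_def cR_def)
  have sD: "s.D = cD k q" by (simp add: s.D_def cD_def sU sR)
  have sG: "s.G = cG q" by (simp add: s.G_def cG_def sq)
  let ?Y = "s.repY X a"
  have Y: "?Y (t, c) = X (xi k q a t c)" for t c by (simp add: s.repY_def s.ix_def xi_def sq sR)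
  have h: "s.hv ?Y v = hX k q X a v" for v by (simp add: s.hv_def hX_def Y sU sD)
  have f: "s.fv ?Y v = fX k q X a v" for v by (simp add: s.fv_def fX_def Y h s.B_def)
  have gg: "s.gv ?Y b v = gX k q X a b v" for b v by (simp add: s.gv_def gX_def Y h sG)
  have q0: "q > 0" and G0: "cG q > 0" using q by (simp_all add: cG_def)
  have k0: "k > 0" using kn by simp
  have S0: "cS k q > 0" "cQ k q > 0" using G0 k0 by (simp_all add: cS_def cQ_def)
  have gless: "gX k q X a b v < cG q" for b v using G0 by (simp add: gX_def)
  have lab: "labX k q X a b v < cS k q" for b v
  proof -
    have "labX k q X a b v < Suc (fX k q X a v) * cG q" using gless[of b v] by (simp add: labX_def)
    also have "\<dots> \<le> cS k q" unfolding cS_def using k0 by (intro mult_le_mono1) (simp add: fX_def Suc_le_eq)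
    finally show ?thesis .
  qed
  from good obtain ls where ls: "\<And>i. ls i < q"
    "inj_on (\<lambda>v. (fX k q X a v, gX k q X a (ls (fX k q X a v)) v)) s.S"
    and ls3: "\<forall>(u, v)\<in>pairs M. \<exists>t<q. \<exists>j<q. s.isolates ?Y t j (s.cls ?Y (ls (fX k q X a u)) u (ls (fX k q X a v)) v)"
    unfolding s.good_def f gg sq by blast
  \<comment> \<open>The label of a vertex under the table that \<open>ls\<close> selects for its own
    group.\<close>
  define \<Lambda> where "\<Lambda> v = (fX k q X a v, gX k q X a (ls (fX k q X a v)) v)" for v
  have "\<exists>p d. p < cN k q \<and> d \<in> E \<and> \<Lambda> (Min d) = \<Lambda> (Min e) \<and> \<Lambda> (Max d) = \<Lambda> (Max e)
      \<and> bucket n k q X E p div n ^ 4 = 1 \<and> bucket n k q X E p mod n ^ 4 = Min d * n + Max d"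
    if e: "e \<in> M" for e
  proof -
    let ?u = "Min e" and ?v = "Max e"
    let ?b = "ls (fX k q X a ?u)" and ?b' = "ls (fX k q X a ?v)"
    have "(?u, ?v) \<in> pairs M" using e by (auto simp: pairs_def)
    then obtain t j where tj: "t < q" "j < q" "s.isolates ?Y t j (s.cls ?Y ?b ?u ?b' ?v)" using ls3 by blast
    \<comment> \<open>The family whose base \<open>q\<close> digits are the wanted indices, in the
      order used by \<open>pos\<close>.\<close>
    define i where "i = (((a * q + ?b') * q + ?b) * q + t) * q + j"
    have b: "?b < q" "?b' < q" using ls(1) by auto
    have d1: "i div q = ((a * q + ?b') * q + ?b) * q + t" using tj by (simp add: i_def)
    have d2: "i div q ^ 2 = (a * q + ?b') * q + ?b"
      unfolding power2_eq_square div_mult2_eq d1 using tj by simp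
    have d3: "i div q ^ 3 = a * q + ?b'"
    proof -
      have "i div q ^ 3 = i div q ^ 2 div q" by (simp add: div_mult2_eq[symmetric] power3_eq_cube power2_eq_square)
      then show ?thesis unfolding d2 using b by simp
    qed
    have d4: "i div q ^ 4 = a"
    proof -
      have "q ^ 4 = q ^ 3 * q" by (simp add: power3_eq_cube power4_eq_xxxx)
      then have "i div q ^ 4 = i div q ^ 3 div q" by (simp add: div_mult2_eq)
      then show ?thesis unfolding d3 using b by simp
    qed
    have dig: "i mod q = j" "i div q mod q = t" "i div q ^ 2 mod q = ?b" "i div q ^ 3 mod q = ?b'"
      unfolding d1 d2 d3 using tj b by (simp_all add: i_def)
    let ?cl = "\<lambda>u v. labX k q X a ?b u * cS k q + labX k q X a ?b' v"
    have pos: "pos k q X i u v = i * cQ k q + ?cl u v" for u v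
      unfolding pos_def d4 dig ..
    have cl: "?cl u v < cQ k q" for u v
    proof -
      have "?cl u v < Suc (labX k q X a ?b u) * cS k q" using lab[of ?b' v] by simp
      also have "\<dots> \<le> cQ k q" unfolding cQ_def using lab by (intro mult_le_mono1) (simp add: Suc_le_eq)
      finally show ?thesis .
    qed
    define p where "p = pos k q X i ?u ?v"
    have pi: "p div cQ k q = i" using cl[of ?u ?v] by (simp add: p_def pos)
    have il: "i < q ^ 5"
    proof -
      have "i div q ^ 4 < q" using a d4 by simp
      then have "i < q * q ^ 4" using q0 by (simp add: div_less_iff_less_mult)
      then show ?thesis by (simp add: eval_nat_numeral)
    qed
    have "p < Suc i * cQ k q" using cl[of ?u ?v] by (simp add: p_def pos)
    also have "\<dots> \<le> cN k q" unfolding cN_def using il by (intro mult_le_mono1) simp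
    finally have pN: "p < cN k q" .
    let ?C = "s.cls ?Y ?b ?u ?b' ?v"
    \<comment> \<open>Bucket \<open>p\<close> receives exactly the sampled edges of the class, so
      isolation leaves a single edge in it.\<close>
    have hit: "hit n k q X p d \<longleftrightarrow> (Min d, Max d) \<in> ?C \<and> hash s.U (?Y (Suc t, 0)) (Min d * n + Max d) < 2 ^ j"
      if "d \<in> E" for d
    proof -
      have "pos k q X i (Min d) (Max d) = p \<longleftrightarrow> ?cl (Min d) (Max d) = ?cl ?u ?v" by (simp add: p_def pos)
      also have "\<dots> \<longleftrightarrow> labX k q X a ?b (Min d) = labX k q X a ?b ?u \<and> labX k q X a ?b' (Max d) = labX k q X a ?b' ?v"
        by (rule mixed_radix_eq) (rule lab)+
      also have "\<dots> \<longleftrightarrow> (Min d, Max d) \<in> ?C"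
      proof -
        have "(Min d, Max d) \<in> pairs E" using that by (auto simp: pairs_def)
        then show ?thesis unfolding labX_def mixed_radix_eq[OF gless gless]
          by (auto simp: s.cls_def f gg)
      qed
      finally have 1: "pos k q X i (Min d) (Max d) = p \<longleftrightarrow> (Min d, Max d) \<in> ?C" .
      have 2: "pass n k q X i (Min d) (Max d) \<longleftrightarrow> hash s.U (?Y (Suc t, 0)) (Min d * n + Max d) < 2 ^ j"
        unfolding pass_def d4 dig by (simp add: Y sU)
      show ?thesis unfolding hit_def pi 1 2 ..
    qed
    obtain z where z: "z \<in> ?C" "hash s.U (?Y (Suc t, 0)) (fst z * n + snd z) < 2 ^ j"
      "\<And>y. y \<in> ?C \<Longrightarrow> hash s.U (?Y (Suc t, 0)) (fst y * n + snd y) < 2 ^ j \<Longrightarrow> y = z"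
    proof -
      assume that: "\<And>z. z \<in> ?C \<Longrightarrow> hash s.U (?Y (Suc t, 0)) (fst z * n + snd z) < 2 ^ j \<Longrightarrow>
        (\<And>y. y \<in> ?C \<Longrightarrow> hash s.U (?Y (Suc t, 0)) (fst y * n + snd y) < 2 ^ j \<Longrightarrow> y = z) \<Longrightarrow> thesis"
      from tj(3)[unfolded s.isolates_def] show thesis by (rule ex1E) (rule that, auto)
    qed
    have "z \<in> pairs E" using z(1) by (simp add: s.cls_def)
    then obtain d where d: "d \<in> E" "z = (Min d, Max d)" by (auto simp: pairs_def)
    have "hit n k q X p d' \<longleftrightarrow> d' = d" if d': "d' \<in> E" for d'
    proof
      assume "hit n k q X p d'"
      then have "(Min d', Max d') = z" using hit[OF d'] by (intro z(3)) auto
      then show "d' = d" using d graph_edge(3)[OF g d'] graph_edge(3)[OF g d(1)] by simp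
    next
      assume "d' = d"
      then show "hit n k q X p d'" using hit[OF d(1)] z(1,2) d by simp
    qed
    note cs = bucket_singleI[OF g d(1) this]
    have "\<Lambda> (Min d) = \<Lambda> ?u" "\<Lambda> (Max d) = \<Lambda> ?v"
      using z(1) d by (auto simp: \<Lambda>_def s.cls_def f gg)
    then show ?thesis using pN d(1) cs by blast
  qed
  then have "\<forall>e\<in>M. \<exists>pd. fst pd < cN k q \<and> snd pd \<in> E \<and> \<Lambda> (Min (snd pd)) = \<Lambda> (Min e) \<and> \<Lambda> (Max (snd pd)) = \<Lambda> (Max e)
      \<and> bucket n k q X E (fst pd) div n ^ 4 = 1 \<and> bucket n k q X E (fst pd) mod n ^ 4 = Min (snd pd) * n + Max (snd pd)"
    by auto
  from bchoice[OF this] obtain pd where pd: "\<And>e. e \<in> M \<Longrightarrow> fst (pd e) < cN k q"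
    "\<And>e. e \<in> M \<Longrightarrow> snd (pd e) \<in> E" "\<And>e. e \<in> M \<Longrightarrow> \<Lambda> (Min (snd (pd e))) = \<Lambda> (Min e)"
    "\<And>e. e \<in> M \<Longrightarrow> \<Lambda> (Max (snd (pd e))) = \<Lambda> (Max e)"
    "\<And>e. e \<in> M \<Longrightarrow> bucket n k q X E (fst (pd e)) div n ^ 4 = 1"
    "\<And>e. e \<in> M \<Longrightarrow> bucket n k q X E (fst (pd e)) mod n ^ 4 = Min (snd (pd e)) * n + Max (snd (pd e))"
    by blast
  obtain en where en: "bij_betw en {..<k} M"
    using ex_bij_betw_nat_finite[OF ME(3)] ME(4) by (auto simp: atLeast0LessThan)
  have enM: "en i \<in> M" if "i < k" for i using bij_betwE[OF en] that by simp
  obtain x where x: "x < cN k q ^ k" "\<And>i. i < k \<Longrightarrow> digit (cN k q) x i = fst (pd (en i))"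
    using digits_exist[of k "\<lambda>i. fst (pd (en i))" "cN k q"] pd(1) enM by auto
  \<comment> \<open>Endpoint \<open>r\<close> of the matching in the numbering of
    \<open>endpt\<close>. Equal outputs have equal labels, hence come from equal endpoints of the
    matching, hence from equal \<open>r\<close>.\<close>
  define w where "w r = (if even r then Min (en (r div 2)) else Max (en (r div 2)))" for r
  let ?o = "endpt (bucket n k q X E) n (cN k q) x"
  have o: "\<Lambda> (?o r) = \<Lambda> (w r)" if "r < 2 * k" for r
  proof -
    have r: "r div 2 < k" using that by simp
    note e = enM[OF r]
    show ?thesis
      using pd(3)[OF e] pd(4)[OF e] pd(6)[OF e] edge_id[OF g pd(2)[OF e]] x(2)[OF r]
      by (simp add: endpt_def w_def)
  qed
  have win: "w r \<in> en (r div 2)" if "r < 2 * k" for r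
  proof -
    have "en (r div 2) \<in> E" using enM[of "r div 2"] that ME by auto
    from graph_edge(3)[OF g this] show ?thesis by (auto simp: w_def)
  qed
  have winj: "r = r'" if r: "r < 2 * k" "r' < 2 * k" "w r = w r'" for r r'
  proof -
    have i: "r div 2 < k" "r' div 2 < k" using r by auto
    have "en (r div 2) = en (r' div 2)"
    proof (rule ccontr)
      assume "en (r div 2) \<noteq> en (r' div 2)"
      then have "disjnt (en (r div 2)) (en (r' div 2))" using ME(2) enM i by (auto simp: pairwise_def)
      then show False using win[OF r(1)] win[OF r(2)] r(3) by (auto simp: disjnt_def)
    qed
    then have d: "r div 2 = r' div 2" using en i by (auto simp: bij_betw_def dest: inj_onD)
    have "en (r div 2) \<in> E" using enM[of "r div 2"] i ME by auto
    from graph_edge(1)[OF g this] have "even r = even r'" using r(3) d by (auto simp: w_def split: if_splits)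
    then show ?thesis using d by (metis dvd_div_eq_iff even_two_times_div_two odd_two_times_div_two_succ)
  qed
  have wS: "w r \<in> s.S" if "r < 2 * k" for r
  proof -
    have "en (r div 2) \<in> M" using enM[of "r div 2"] that by simp
    then have "(Min (en (r div 2)), Max (en (r div 2))) \<in> pairs M" by (auto simp: pairs_def)
    then have "Min (en (r div 2)) \<in> s.S" "Max (en (r div 2)) \<in> s.S" unfolding s.S_def by force+
    then show ?thesis by (simp add: w_def)
  qed
  have "inj_on ?o {..<2 * k}"
  proof (rule inj_onI)
    fix r r' assume r: "r \<in> {..<2 * k}" "r' \<in> {..<2 * k}" "?o r = ?o r'"
    then have "\<Lambda> (w r) = \<Lambda> (w r')" using o[of r] o[of r'] by simp
    then have "w r = w r'" using ls(2) wS[of r] wS[of r'] r(1,2) unfolding \<Lambda>_def by (auto dest: inj_onD)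
    then show "r = r'" using winj r by simp
  qed
  then have "found (bucket n k q X E) n k (cN k q) x"
    unfolding found_def using x(2) pd(5) enM by simp
  then show ?thesis using x(1) by blast
qed

section \<open>The update program\<close>

abbreviation e_add (infixl "+\<^sub>e" 65) where "a +\<^sub>e b \<equiv> Op Add a b"
abbreviation e_sub (infixl "-\<^sub>e" 65) where "a -\<^sub>e b \<equiv> Op Sub a b"
abbreviation e_mul (infixl "*\<^sub>e" 70) where "a *\<^sub>e b \<equiv> Op Mul a b"
abbreviation e_div (infixl "div\<^sub>e" 70) where "a div\<^sub>e b \<equiv> Op Div a b"
abbreviation e_mod (infixl "mod\<^sub>e" 70) where "a mod\<^sub>e b \<equiv> Op Mod a b"
abbreviation e_less (infix "<\<^sub>e" 50) where "a <\<^sub>e b \<equiv> Op Less a b"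

text \<open>Registers: 0 holds \<open>n\<close>, 1 holds \<open>k\<close>, 2 the operation, 3 and 4
  the endpoints, 5 holds \<open>q\<close>, 7 the family index. From these, \<open>eR\<close>,
  \<open>eG\<close> and so on recompute \<open>cR\<close>, \<open>cG\<close> and so on; powers of
  two are looked up in a table at cell 100.\<close>

definition eU where "eU = Ld (Nm 100 +\<^sub>e Rg 5 div\<^sub>e Nm 2)"
definition eR where "eR = Nm 256 *\<^sub>e (Rg 1 *\<^sub>e Rg 1)"
definition eD where "eD = eU div\<^sub>e eR +\<^sub>e Nm 1"
definition eG where "eG = Nm 4 *\<^sub>e (Rg 5 *\<^sub>e Rg 5)"
definition eS where "eS = Nm 8 *\<^sub>e Rg 1 *\<^sub>e eG"
definition eClasses where "eClasses = eS *\<^sub>e eS"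
definition eK where "eK = Rg 5 *\<^sub>e Rg 5 *\<^sub>e Rg 5 *\<^sub>e Rg 5 *\<^sub>e Rg 5"
definition eN where "eN = eK *\<^sub>e eClasses"
definition eNX where "eNX = Rg 5 *\<^sub>e (Rg 5 +\<^sub>e Nm 1) *\<^sub>e (eR +\<^sub>e Nm 1)"
definition eaX where "eaX = Nm 100 +\<^sub>e Rg 5"
definition eaC where "eaC = eaX +\<^sub>e eNX"
definition eaO where "eaO = eaC +\<^sub>e eN"
definition eW where "eW = Rg 0 *\<^sub>e Rg 0 *\<^sub>e Rg 0 *\<^sub>e Rg 0"
text \<open>Minimum and maximum by truncated subtraction.\<close>

definition eMin where "eMin = Rg 3 -\<^sub>e (Rg 3 -\<^sub>e Rg 4)"
definition eMax where "eMax = Rg 3 +\<^sub>e (Rg 4 -\<^sub>e Rg 3)"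
definition ea where "ea = Rg 7 div\<^sub>e (Rg 5 *\<^sub>e Rg 5 *\<^sub>e Rg 5 *\<^sub>e Rg 5)"
definition eX where "eX t c = Ld (eaX +\<^sub>e ((ea *\<^sub>e (Rg 5 +\<^sub>e Nm 1) +\<^sub>e t) *\<^sub>e (eR +\<^sub>e Nm 1) +\<^sub>e c))"
definition eHash where "eHash z x = ((z div\<^sub>e eU) *\<^sub>e x +\<^sub>e z mod\<^sub>e eU) mod\<^sub>e eU"
definition eh where "eh v = eHash (eX (Nm 0) (Nm 0)) v div\<^sub>e eD"
definition eLab where "eLab b v = eX (Nm 0) (eh v +\<^sub>e Nm 1) mod\<^sub>e (Nm 8 *\<^sub>e Rg 1) *\<^sub>e eG
  +\<^sub>e eX (b +\<^sub>e Nm 1) (eh v +\<^sub>e Nm 1) mod\<^sub>e eG"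
definition ePos where "ePos = Rg 7 *\<^sub>e eClasses +\<^sub>e (eLab (Rg 7 div\<^sub>e (Rg 5 *\<^sub>e Rg 5) mod\<^sub>e Rg 5) eMin *\<^sub>e eS
  +\<^sub>e eLab (Rg 7 div\<^sub>e (Rg 5 *\<^sub>e Rg 5 *\<^sub>e Rg 5) mod\<^sub>e Rg 5) eMax)"
definition ePass where "ePass = (eHash (eX (Rg 7 div\<^sub>e Rg 5 mod\<^sub>e Rg 5 +\<^sub>e Nm 1) (Nm 0)) (eMin *\<^sub>e Rg 0 +\<^sub>e eMax)
  <\<^sub>e Ld (Nm 100 +\<^sub>e Rg 7 mod\<^sub>e Rg 5))"
definition eAddr where "eAddr = eaC +\<^sub>e ePos"
definition eDelta where "eDelta = ePass *\<^sub>e (eW +\<^sub>e (eMin *\<^sub>e Rg 0 +\<^sub>e eMax))"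
text \<open>Free of branches: \<open>eDelta\<close> is 0 if the edge is not sampled, and the
  operation in register 2 is 1 or 0, so only one of addition and subtraction takes effect.\<close>

definition eNew where "eNew = (Ld eAddr +\<^sub>e Rg 2 *\<^sub>e eDelta) -\<^sub>e (Nm 1 -\<^sub>e Rg 2) *\<^sub>e eDelta"

definition upd_body :: com where
  "upd_body = Seq (Store eAddr eNew) (Store (Nm 7) (Rg 7 +\<^sub>e Nm 1))"
definition upd_main :: com where
  "upd_main = Seq (Store (Nm 7) (Nm 0)) (WhileE (Rg 7 <\<^sub>e eK) upd_body)"
text \<open>After initialization register 5 is 0 exactly when \<open>2 * k > n\<close>, and then
  nothing is to be maintained.\<close>

definition update :: com where
  "update = If (Cell (Dir 5)) upd_main Skip"

text \<open>A single number for all inputs, since the expressions of the program are fixed. The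
  factor 2 bounds \<open>q ^ 5 + 1\<close> by \<open>2 * q ^ 5\<close>, and 8 covers the test of
  register 5.\<close>

definition upd_cost :: nat where
  "upd_cost = scost (Nm 7) (Nm 0) + 2 * (scost eAddr eNew + scost (Nm 7) (Rg 7 +\<^sub>e Nm 1)
     + ecost (Rg 7 <\<^sub>e eK) + sz (Rg 7 <\<^sub>e eK) + 4) + 8"

lemmas basic_defs = eU_def eR_def eD_def eG_def eS_def eClasses_def eK_def eN_def eNX_def eaX_def
  eaC_def eaO_def eW_def eMin_def eMax_def ea_def

text \<open>Evaluation starts in cell 20 or 21, so a depth below 79 keeps it below cell 100.\<close>

lemma depth_basic:
  "depth eU \<le> 3" "depth eR \<le> 3" "depth eD \<le> 5" "depth eG \<le> 3" "depth eS \<le> 5" "depth eClasses \<le> 7"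
  "depth eK \<le> 2" "depth eN \<le> 9" "depth eNX \<le> 6" "depth eaX \<le> 2" "depth eaC \<le> 8" "depth eaO \<le> 10"
  "depth eW \<le> 2" "depth eMin \<le> 3" "depth eMax \<le> 3" "depth ea \<le> 3"
  by (simp_all add: basic_defs)

lemma depth_eX: "depth t \<le> d \<Longrightarrow> depth c \<le> d \<Longrightarrow> depth (eX t c) \<le> d + 9"
  using depth_basic by (auto simp: eX_def)

lemma depth_eHash: "depth z \<le> d \<Longrightarrow> depth x \<le> d \<Longrightarrow> depth (eHash z x) \<le> d + 7"
  using depth_basic by (auto simp: eHash_def)

lemma depth_eh: "depth v \<le> 9 \<Longrightarrow> depth (eh v) \<le> 17"
  using depth_eHash[of "eX (Nm 0) (Nm 0)" 9 v] depth_eX[of "Nm 0" 0 "Nm 0"] depth_basic by (auto simp: eh_def)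

lemma depth_eLab: "depth b \<le> 9 \<Longrightarrow> depth v \<le> 9 \<Longrightarrow> depth (eLab b v) \<le> 30"
  using depth_eX[of "Nm 0" 18 "eh v +\<^sub>e Nm 1"] depth_eX[of "b +\<^sub>e Nm 1" 18 "eh v +\<^sub>e Nm 1"]
    depth_eh[of v] depth_basic by (auto simp: eLab_def)

lemma depth_ePos: "depth ePos \<le> 34"
  using depth_eLab[of "Rg 7 div\<^sub>e (Rg 5 *\<^sub>e Rg 5) mod\<^sub>e Rg 5" eMin]
    depth_eLab[of "Rg 7 div\<^sub>e (Rg 5 *\<^sub>e Rg 5 *\<^sub>e Rg 5) mod\<^sub>e Rg 5" eMax] depth_basic
  by (auto simp: ePos_def)

lemma depth_ePass: "depth ePass \<le> 30"
  using depth_eHash[of "eX (Rg 7 div\<^sub>e Rg 5 mod\<^sub>e Rg 5 +\<^sub>e Nm 1) (Nm 0)" 15 "eMin *\<^sub>e Rg 0 +\<^sub>e eMax"]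
    depth_eX[of "Rg 7 div\<^sub>e Rg 5 mod\<^sub>e Rg 5 +\<^sub>e Nm 1" 3 "Nm 0"] depth_basic
  by (auto simp: ePass_def)

lemma depth_eAddr: "depth eAddr < 79" and depth_eNew: "depth eNew < 79"
  using depth_ePos depth_ePass depth_basic by (auto simp: eAddr_def eNew_def eDelta_def)

section \<open>Memory layout\<close>

definition cNX where "cNX k q = q * (q + 1) * (cR k + 1)"
definition aX where "aX q = 100 + q"
definition aC where "aC k q = aX q + cNX k q"
definition aO where "aO k q = aC k q + cN k q"
definition aE where "aE k q = aO k q + 2 * k"

text \<open>
  Cells 0 to 19 are registers, of which 5 holds \<open>q\<close>. They are followed, after the evaluation
  stack, by the powers of two, the random numbers, the sketch, and the output array.
\<close>

definition memory :: "nat \<Rightarrow> nat \<Rightarrow> mem \<Rightarrow> mem \<Rightarrow> mem \<Rightarrow> mem \<Rightarrow> mem \<Rightarrow> mem" where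
  "memory k q rg P X c out = (\<lambda>a. if a < 20 then rg a else if a < 100 then 0
     else if a < aX q then P (a - 100) else if a < aC k q then X (a - aX q)
     else if a < aO k q then c (a - aC k q) else if a < aE k q then out (a - aO k q) else 0)"

lemma area_le: "aX q \<le> aC k q" "aC k q \<le> aO k q" "aO k q \<le> aE k q" "100 \<le> aX q"
  by (simp_all add: aX_def aC_def aO_def aE_def)

lemma memory_read:
  "r < 20 \<Longrightarrow> memory k q rg P X c out r = rg r"
  "j < q \<Longrightarrow> memory k q rg P X c out (100 + j) = P j"
  "p < cNX k q \<Longrightarrow> memory k q rg P X c out (aX q + p) = X p"
  "p < cN k q \<Longrightarrow> memory k q rg P X c out (aC k q + p) = c p"
  "i < 2 * k \<Longrightarrow> memory k q rg P X c out (aO k q + i) = out i"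
  by (auto simp: memory_def aX_def aC_def aO_def aE_def)

lemma memory_write:
  "r < 20 \<Longrightarrow> (memory k q rg P X c out)(r := v) = memory k q (rg(r := v)) P X c out"
  "j < q \<Longrightarrow> (memory k q rg P X c out)(100 + j := v) = memory k q rg (P(j := v)) X c out"
  "p < cNX k q \<Longrightarrow> (memory k q rg P X c out)(aX q + p := v) = memory k q rg P (X(p := v)) c out"
  "p < cN k q \<Longrightarrow> (memory k q rg P X c out)(aC k q + p := v) = memory k q rg P X (c(p := v)) out"
  "i < 2 * k \<Longrightarrow> (memory k q rg P X c out)(aO k q + i := v) = memory k q rg P X c (out(i := v))"
  by (rule ext, auto simp: memory_def aX_def aC_def aO_def aE_def)+

lemma clean_memory: "clean 20 (memory k q rg P X c out)"
  by (auto simp: clean_def memory_def)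

lemma vbound_memory:
  assumes "V \<ge> 7" "\<And>r. rg r < 2 ^ V" "\<And>j. j < q \<Longrightarrow> P j < 2 ^ V" "\<And>p. p < cNX k q \<Longrightarrow> X p < 2 ^ V"
    "\<And>p. p < cN k q \<Longrightarrow> c p < 2 ^ V" "\<And>i. i < 2 * k \<Longrightarrow> out i < 2 ^ V"
  shows "vbound V (memory k q rg P X c out)"
  using assms by (auto simp: vbound_def memory_def aX_def aC_def aO_def aE_def)

text \<open>Registers get their own bound \<open>W\<close>, because the search keeps numbers of
  about \<open>q * k\<close> bits in them. Only 20 cells are that long; the others stay at
  \<open>V\<close> bits.\<close>

lemma mem_bits_memory:
  assumes "V \<ge> 1" "W \<ge> 1" "\<And>r. rg r < 2 ^ W" "\<And>j. j < q \<Longrightarrow> P j < 2 ^ V" "\<And>p. p < cNX k q \<Longrightarrow> X p < 2 ^ V"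
    "\<And>p. p < cN k q \<Longrightarrow> c p < 2 ^ V" "\<And>i. i < 2 * k \<Longrightarrow> out i < 2 ^ V"
  shows "mem_bits (memory k q rg P X c out) \<le> 20 * (7 + W) + aE k q * (bits (aE k q) + V)"
proof -
  let ?s = "memory k q rg P X c out"
  have "mem_bits ?s \<le> (\<Sum>a\<in>{..<20} \<union> {20..<aE k q}. bits a + bits (?s a))"
    unfolding mem_bits_def
  proof (rule sum_mono2)
    show "{a. ?s a \<noteq> 0} \<subseteq> {..<20} \<union> {20..<aE k q}"
    proof
      fix a assume "a \<in> {a. ?s a \<noteq> 0}"
      then have "a < aE k q" using area_le(1)[of q k] area_le(2,3)[of k q] area_le(4)[of q]
        by (simp add: memory_def split: if_splits)
      then show "a \<in> {..<20} \<union> {20..<aE k q}" by auto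
    qed
  qed auto
  also have "\<dots> = (\<Sum>a<20. bits a + bits (?s a)) + (\<Sum>a\<in>{20..<aE k q}. bits a + bits (?s a))"
    by (rule sum.union_disjoint) auto
  also have "(\<Sum>a<20. bits a + bits (?s a)) \<le> (\<Sum>a<(20::nat). 7 + W)"
    using assms by (intro sum_mono add_mono bits_small bits_leI) (auto simp: memory_read)
  also have "(\<Sum>a\<in>{20..<aE k q}. bits a + bits (?s a)) \<le> (\<Sum>a\<in>{20..<aE k q}. bits (aE k q) + V)"
  proof (intro sum_mono add_mono bits_mono bits_leI)
    fix a assume "a \<in> {20..<aE k q}"
    have "?s a < 2 ^ V" if "a \<ge> 20" using assms that by (auto simp: memory_def aX_def aC_def aO_def aE_def)
    then show "?s a < 2 ^ V" using \<open>a \<in> _\<close> by simp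
  qed (use assms in auto)
  also have "\<dots> \<le> aE k q * (bits (aE k q) + V)" by simp
  finally show ?thesis by simp
qed

locale layout =
  fixes n k l q :: nat and X :: "nat \<Rightarrow> nat"
  assumes k: "k \<ge> 1" and kn: "2 * k \<le> n" and nl: "n \<le> 2 ^ l" and q: "q = 32 * (l + 5)"
    and X: "\<And>p. X p < 2 ^ q"
begin

lemma q_pos: "q > 0" "q \<ge> 160" using q by auto

text \<open>Crude, but it lets the sizes of the arrays, polynomial in \<open>n\<close> and
  \<open>q\<close>, fit into \<open>q\<close> bits.\<close>

lemma q_less: "q < 2 ^ (l + 10)"
proof -
  have "l + 5 < 2 ^ (l + 5)" by (rule less_exp)
  then show ?thesis using q by (simp add: power_add)
qed

lemma q_power_less: "m > 0 \<Longrightarrow> q ^ m < 2 ^ ((l + 10) * m)"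
  using power_strict_mono[OF q_less, of m] by (simp add: power_mult)

lemma n_power_le: "n ^ m \<le> 2 ^ (l * m)"
  using power_mono[OF nl, of m] by (simp add: power_mult)

lemma k_le_n: "k \<le> n" using kn by simp

lemma exp_le_q: "m \<le> q \<Longrightarrow> a < 2 ^ m \<Longrightarrow> a < 2 ^ q" for a :: nat
  by (meson less_le_trans one_le_numeral power_increasing)

lemma n_less: "n < 2 ^ q"
proof -
  have "n \<le> 2 ^ l" by (rule nl)
  also have "\<dots> < 2 ^ q" using q by (intro power_strict_increasing) auto
  finally show ?thesis .
qed

lemma q5_less: "q ^ 5 < 2 ^ q"
  by (rule exp_le_q[OF _ q_power_less]) (use q in auto)

text \<open>Together with \<open>bucket_le\<close>: no bucket exceeds \<open>q\<close> bits.\<close>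

lemma cell_value_less: "n ^ 2 * (2 * n ^ 4) < 2 ^ q"
proof -
  have "n ^ 2 * (2 * n ^ 4) = 2 * n ^ 6" by (simp flip: power_add)
  also have "\<dots> \<le> 2 * 2 ^ (l * 6)" using n_power_le[of 6] by simp
  also have "\<dots> = 2 ^ (l * 6 + 1)" by simp
  also have "\<dots> < 2 ^ q" using q by (intro power_strict_increasing) auto
  finally show ?thesis .
qed

lemma cR_pos: "cR k > 0" using k by (simp add: cR_def)

lemma hX_less: "hX k q X a v < cR k"
proof -
  have "cU q = cU q div cR k * cR k + cU q mod cR k" by simp
  also have "\<dots> < cU q div cR k * cR k + cR k" using cR_pos by (intro add_strict_left_mono mod_less_divisor)
  finally have "cU q < cR k * cD k q" by (simp add: cD_def algebra_simps)
  moreover have "hash (cU q) z v < cU q" for z by (rule hash_less) (simp add: cU_def)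
  ultimately have "hash (cU q) (X (xi k q a 0 0)) v < cR k * cD k q" using less_trans by blast
  then show ?thesis by (simp add: hX_def less_mult_imp_div_less)
qed

lemma xi_less: "a < q \<Longrightarrow> t \<le> q \<Longrightarrow> c \<le> cR k \<Longrightarrow> xi k q a t c < cNX k q"
proof -
  assume a: "a < q" "t \<le> q" "c \<le> cR k"
  have "a * (q + 1) + t < (a + 1) * (q + 1)" using a by simp
  also have "\<dots> \<le> q * (q + 1)" using a by (intro mult_le_mono1) simp
  finally have "a * (q + 1) + t + 1 \<le> q * (q + 1)" by simp
  then have "(a * (q + 1) + t + 1) * (cR k + 1) \<le> cNX k q" unfolding cNX_def by (rule mult_le_mono1)
  then show ?thesis using a by (simp add: xi_def)
qed

lemma cG_pos: "cG q > 0" and cQ_pos: "cQ k q > 0"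
  using k q_pos by (simp_all add: cG_def cS_def cQ_def)

lemma labX_less: "labX k q X a b v < cS k q"
proof -
  have "gX k q X a b v < cG q" using cG_pos by (simp add: gX_def)
  then have "labX k q X a b v < Suc (fX k q X a v) * cG q" by (simp add: labX_def)
  also have "\<dots> \<le> cS k q" unfolding cS_def using k by (intro mult_le_mono1) (simp add: fX_def Suc_le_eq)
  finally show ?thesis .
qed

lemma pos_div: "pos k q X i u v div cQ k q = i" and pos_less: "i < q ^ 5 \<Longrightarrow> pos k q X i u v < cN k q"
proof -
  let ?a = "labX k q X (i div q ^ 4) (i div q ^ 2 mod q) u" and ?b = "labX k q X (i div q ^ 4) (i div q ^ 3 mod q) v"
  have "?a * cS k q + ?b < Suc ?a * cS k q" using labX_less by simp
  also have "\<dots> \<le> cQ k q" unfolding cQ_def using labX_less by (intro mult_le_mono1) (simp add: Suc_le_eq)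
  finally have *: "?a * cS k q + ?b < cQ k q" .
  then show "pos k q X i u v div cQ k q = i" by (simp add: pos_def)
  assume "i < q ^ 5"
  have "pos k q X i u v < Suc i * cQ k q" using * by (simp add: pos_def)
  also have "\<dots> \<le> cN k q" unfolding cN_def using \<open>i < q ^ 5\<close> by (intro mult_le_mono1) simp
  finally show "pos k q X i u v < cN k q" .
qed

text \<open>The part of the memory that updates read but never change.\<close>

definition view :: "mem \<Rightarrow> bool" where
  "view s \<longleftrightarrow> s 0 = n \<and> s 1 = k \<and> s 5 = q \<and> (\<forall>j<q. s (100 + j) = 2 ^ j) \<and> (\<forall>p<cNX k q. s (aX q + p) = X p)"

lemma view_memory: "rg 0 = n \<Longrightarrow> rg 1 = k \<Longrightarrow> rg 5 = q \<Longrightarrow> view (memory k q rg (\<lambda>j. 2 ^ j) X c out)"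
  by (simp add: view_def memory_read)

lemma ev_basic:
  assumes "s 0 = n" "s 1 = k" "s 5 = q"
  shows "valex s eR = cR k" "valex s eG = cG q" "valex s eS = cS k q" "valex s eClasses = cQ k q" "valex s eK = q ^ 5"
    "valex s eN = cN k q" "valex s eNX = cNX k q" "valex s eaX = aX q" "valex s eaC = aC k q" "valex s eaO = aO k q"
    "valex s eW = n ^ 4" "valex s eMin = min (s 3) (s 4)" "valex s eMax = max (s 3) (s 4)"
  using assms by (simp_all add: basic_defs cR_def cG_def cS_def cQ_def cN_def cNX_def aX_def aC_def aO_def
    eval_nat_numeral)

lemma readable_basic:
  assumes "s 5 = q"
  shows "readable s eU" "readable s eR" "readable s eG" "readable s eS" "readable s eClasses" "readable s eK"
    "readable s eN" "readable s eNX" "readable s eaX" "readable s eaC" "readable s eaO" "readable s eW"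
    "readable s eMin" "readable s eMax" "readable s ea" "readable s eD"
  using assms by (simp_all add: basic_defs)

context
  fixes s :: mem and i :: nat
  assumes v: "view s" and i: "s 7 = i" "i < q ^ 5"
begin

lemma s_regs: "s 0 = n" "s 1 = k" "s 5 = q" "s (Suc 0) = k" using v by (simp_all add: view_def)

lemma ev_eU: "valex s eU = cU q" "valex s eD = cD k q"
proof -
  have "q div 2 < q" using q_pos by simp
  then show "valex s eU = cU q" using v by (simp add: view_def eU_def cU_def)
  then show "valex s eD = cD k q" using ev_basic[OF s_regs(1-3)] by (simp add: eD_def cD_def)
qed

lemma ev_ea: "valex s ea = i div q ^ 4" "i div q ^ 4 < q"
proof -
  show "valex s ea = i div q ^ 4" using s_regs i by (simp add: ea_def power4_eq_xxxx)
  have "i < q * q ^ 4" using i(2) by (simp add: eval_nat_numeral)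
  then show "i div q ^ 4 < q" by (simp add: less_mult_imp_div_less)
qed

lemma ev_eX: "valex s t \<le> q \<Longrightarrow> valex s c \<le> cR k \<Longrightarrow> valex s (eX t c) = X (xi k q (i div q ^ 4) (valex s t) (valex s c))"
  using xi_less[OF ev_ea(2), of "valex s t" "valex s c"] v ev_basic[OF s_regs(1-3)] ev_ea(1) s_regs
  by (simp add: eX_def view_def xi_def)

lemma ev_eHash: "valex s (eHash z x) = hash (cU q) (valex s z) (valex s x)"
  by (simp add: eHash_def hash_def ev_eU)

lemma ev_eh: "valex s (eh x) = hX k q X (i div q ^ 4) (valex s x)"
  by (simp add: eh_def hX_def ev_eHash ev_eX ev_eU)

lemma ev_eLab: "valex s b < q \<Longrightarrow> valex s (eLab b x) = labX k q X (i div q ^ 4) (valex s b) (valex s x)"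
  using hX_less[of "i div q ^ 4" "valex s x"]
  by (simp add: eLab_def labX_def fX_def gX_def ev_eX ev_eh ev_basic[OF s_regs(1-3)] s_regs Suc_le_eq)

lemma ev_ePos: "valex s ePos = pos k q X i (min (s 3) (s 4)) (max (s 3) (s 4))"
  using q_pos by (simp add: ePos_def pos_def ev_eLab ev_basic[OF s_regs(1-3)] s_regs i(1) power2_eq_square power3_eq_cube)

lemma ev_ePass: "valex s ePass = of_bool (pass n k q X i (min (s 3) (s 4)) (max (s 3) (s 4)))"
proof -
  have "i div q mod q < q" "i mod q < q" using q_pos by simp_all
  moreover have "s (100 + j) = 2 ^ j" if "j < q" for j using v that by (simp add: view_def)
  ultimately show ?thesis
    by (simp add: ePass_def pass_def ev_eHash ev_eX ev_basic[OF s_regs(1-3)] s_regs i(1) Suc_le_eq)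
qed

lemma readable_eX: "readable s t \<Longrightarrow> readable s c \<Longrightarrow> readable s (eX t c)"
  using readable_basic[of s, OF s_regs(3)] ev_basic[OF s_regs(1-3)] by (simp add: eX_def aX_def)

lemma readable_eLab: "readable s b \<Longrightarrow> readable s x \<Longrightarrow> readable s (eLab b x)"
  using readable_basic[of s, OF s_regs(3)] by (simp add: eLab_def eh_def eHash_def readable_eX)

lemma readable_upd: "readable s eAddr" "readable s eNew"
  using readable_basic[of s, OF s_regs(3)] ev_basic[OF s_regs(1-3)]
  by (simp_all add: eNew_def eDelta_def eAddr_def ePos_def ePass_def eHash_def readable_eX readable_eLab aC_def aX_def)

end

text \<open>The sketch in the middle of an update, with the families below \<open>i\<close>
  processed. \<open>E\<close> is always the graph without \<open>e\<close>: during an insertion the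
  processed families contain \<open>e\<close>, during a deletion the unprocessed ones do, whence the
  comparison with \<open>ins\<close>.\<close>

definition sketch :: "nat set set \<Rightarrow> nat set \<Rightarrow> bool \<Rightarrow> nat \<Rightarrow> nat \<Rightarrow> nat" where
  "sketch E e ins i p = bucket n k q X E p + (if ((p div cQ k q < i) = ins) \<and> hit n k q X p e then weight n e else 0)"

text \<open>Within family \<open>i\<close> the edge can hit only the bucket \<open>p\<close>, so
  changing this one bucket processes the whole family.\<close>

lemma sketch_Suc:
  fixes i :: nat
  assumes e: "Min e = u" "Max e = v"
  defines "p \<equiv> pos k q X i u v" and "w \<equiv> (if pass n k q X i u v then weight n e else 0)"
  shows "(sketch E e ins i)(p := sketch E e ins i p + of_bool ins * w - (1 - of_bool ins) * w) = sketch E e ins (Suc i)"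
proof
  fix r
  have pd: "p div cQ k q = i" unfolding p_def by (rule pos_div)
  show "((sketch E e ins i)(p := sketch E e ins i p + of_bool ins * w - (1 - of_bool ins) * w)) r = sketch E e ins (Suc i) r"
  proof (cases "r = p")
    case True
    have "hit n k q X p e \<longleftrightarrow> pass n k q X i u v" unfolding hit_def pd e by (simp add: p_def)
    then show ?thesis unfolding True by (cases ins) (auto simp: sketch_def pd w_def)
  next
    case False
    have "\<not> hit n k q X r e" if "r div cQ k q = i" using False that unfolding hit_def e by (auto simp: p_def)
    then have "(r div cQ k q < Suc i) = (r div cQ k q < i)" if "hit n k q X r e" using that by (auto simp: less_Suc_eq)
    then show ?thesis using False by (auto simp: sketch_def)
  qed
qed

lemma sketch_less:
  assumes "graph n (insert e E)" "e \<notin> E"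
  shows "sketch E e ins i p < 2 ^ q"
proof -
  have "graph n E" using assms by (simp add: graph_def)
  then have "sketch E e ins i p \<le> bucket n k q X (insert e E) p"
    using assms(2) by (simp add: bucket_insert sketch_def)
  also have "\<dots> \<le> n ^ 2 * (2 * n ^ 4)" by (rule bucket_le[OF assms(1)])
  finally show ?thesis using cell_value_less by simp
qed

abbreviation "mem_of rg c out \<equiv> memory k q rg (\<lambda>j. 2 ^ j) X c out"

definition loop_inv where
  "loop_inv rg E e ins i s \<longleftrightarrow> s = mem_of (rg(7 := i)) (sketch E e ins i) (\<lambda>_. 0)"

text \<open>There are \<open>q ^ 5\<close> rounds, each evaluating fixed expressions over
  \<open>q\<close>-bit cells in time proportional to \<open>q\<close>.\<close>

lemma update_correct:
  assumes g: "graph n (insert e E)" and e: "e \<notin> E" "e = {u, v}" "u \<noteq> v"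
    and rg: "rg 0 = n" "rg 1 = k" "rg 5 = q" "rg 2 = of_bool ins" "rg 3 = u" "rg 4 = v" "\<And>r. rg r < 2 ^ q"
  shows "\<exists>t m. exec update (mem_of rg (bucket n k q X (if ins then E else insert e E)) (\<lambda>_. 0), \<omega>) t m
      (mem_of (rg(7 := q ^ 5)) (bucket n k q X (if ins then insert e E else E)) (\<lambda>_. 0), \<omega>) \<and> t \<le> upd_cost * q ^ 6"
proof -
  have gE: "graph n E" using g by (simp add: graph_def)
  have mm: "Min e = min u v" "Max e = max u v" using e by auto
  have out: "sketch E e ins i p = bucket n k q X E p" if "p div cQ k q \<ge> i" "ins" for i p
    using that by (simp add: sketch_def)
  have s0: "mem_of rg (bucket n k q X (if ins then E else insert e E)) (\<lambda>_. 0) = mem_of rg (sketch E e ins 0) (\<lambda>_. 0)"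
    using bucket_insert[OF gE e(1)] by (intro arg_cong[of _ _ "\<lambda>c. mem_of rg c _"] ext) (simp add: sketch_def)
  \<comment> \<open>Only buckets below \<open>cN k q\<close> are stored, and these lie in families
    below \<open>q ^ 5\<close>.\<close>
  have sK: "mem_of rg' (sketch E e ins (q ^ 5)) (\<lambda>_. 0)
      = mem_of rg' (bucket n k q X (if ins then insert e E else E)) (\<lambda>_. 0)" for rg'
  proof
    fix a
    have "sketch E e ins (q ^ 5) p = bucket n k q X (if ins then insert e E else E) p" if "p < cN k q" for p
    proof -
      have "p div cQ k q < q ^ 5" using that by (simp add: cN_def less_mult_imp_div_less)
      then show ?thesis using bucket_insert[OF gE e(1)] by (simp add: sketch_def)
    qed
    then show "mem_of rg' (sketch E e ins (q ^ 5)) (\<lambda>_. 0) a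
      = mem_of rg' (bucket n k q X (if ins then insert e E else E)) (\<lambda>_. 0) a"
      by (auto simp: memory_def aO_def)
  qed
  have vb: "vbound q (mem_of rg' (sketch E e ins i) (\<lambda>_. 0))" if "\<And>r. rg' r < 2 ^ q" for rg' i
    using that sketch_less[OF g e(1)] X q_pos by (intro vbound_memory) auto
  have inv: "clean 20 s \<and> vbound q s \<and> readable s (Rg 7 <\<^sub>e eK) \<and> (valex s (Rg 7 <\<^sub>e eK) \<noteq> 0 \<longleftrightarrow> i < q ^ 5)
      \<and> view s \<and> s 7 = i" if "loop_inv rg E e ins i s" "i \<le> q ^ 5" for i s
  proof -
    have s: "s = mem_of (rg(7 := i)) (sketch E e ins i) (\<lambda>_. 0)" using that by (simp add: loop_inv_def)
    have "i < 2 ^ q" using that(2) q5_less by simp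
    then have "vbound q s" unfolding s using rg(7) by (intro vb) auto
    moreover have v: "view s" unfolding s by (rule view_memory) (use rg in auto)
    moreover have i7: "s 7 = i" by (simp add: s memory_read)
    moreover have "s 0 = n" "s 1 = k" "s 5 = q" using v by (simp_all add: view_def)
    ultimately show ?thesis
      using clean_memory readable_basic(6)[of s] ev_basic[of s] by (simp add: s)
  qed
  have body: "\<exists>s' \<omega>' t m. exec upd_body (s, \<omega>) t m (s', \<omega>') \<and> (loop_inv rg E e ins (Suc i) s' \<and> \<omega>' = \<omega>0)
      \<and> t \<le> (scost eAddr eNew + scost (Nm 7) (Rg 7 +\<^sub>e Nm 1)) * q"
    if I: "loop_inv rg E e ins i s \<and> \<omega> = \<omega>0" and i: "i < q ^ 5" for i s \<omega> \<omega>0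
  proof -
    have s: "s = mem_of (rg(7 := i)) (sketch E e ins i) (\<lambda>_. 0)" using I by (simp add: loop_inv_def)
    note iv = inv[OF conjunct1[OF I] less_imp_le[OF i]]
    have v: "view s" and i7: "s 7 = i" using iv by auto
    have r: "s 0 = n" "s 1 = k" "s 5 = q" using v by (simp_all add: view_def)
    have r34: "s 3 = u" "s 4 = v" "s 2 = of_bool ins" using rg by (simp_all add: s memory_read)
    let ?p = "pos k q X i (min u v) (max u v)"
    have pN: "?p < cN k q" by (rule pos_less[OF i])
    let ?w = "if pass n k q X i (min u v) (max u v) then weight n e else 0"
    have ea: "valex s eAddr = aC k q + ?p"
      using ev_ePos[OF v i7 i] ev_basic[OF r] by (simp add: eAddr_def r34)
    have ed: "valex s eDelta = ?w"
      using ev_ePass[OF v i7 i] ev_basic[OF r] r by (simp add: eDelta_def r34 weight_def mm)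
    have en: "valex s eNew = sketch E e ins i ?p + of_bool ins * ?w - (1 - of_bool ins) * ?w"
    proof -
      have "s (aC k q + ?p) = sketch E e ins i ?p" unfolding s by (rule memory_read(4)[OF pN])
      then show ?thesis by (simp add: eNew_def r34(3) ea ed)
    qed
    let ?s1 = "mem_of (rg(7 := i)) (sketch E e ins (Suc i)) (\<lambda>_. 0)"
    have s1: "?s1 = s(valex s eAddr := valex s eNew)"
      unfolding en ea unfolding s memory_write(4)[OF pN] sketch_Suc[OF mm] ..
    have 1: "\<exists>t m. exec (Store eAddr eNew) (s, \<omega>) t m (?s1, \<omega>) \<and> t \<le> scost eAddr eNew * q"
      using iv by (intro Store_correct depth_eAddr depth_eNew readable_upd[OF v i7 i] s1)
        (auto simp: ea aC_def aX_def)
    have "vbound q ?s1" using q5_less i rg(7) by (intro vb) auto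
    then have 2: "\<exists>t m. exec (Store (Nm 7) (Rg 7 +\<^sub>e Nm 1)) (?s1, \<omega>) t m
        (mem_of (rg(7 := Suc i)) (sketch E e ins (Suc i)) (\<lambda>_. 0), \<omega>) \<and> t \<le> scost (Nm 7) (Rg 7 +\<^sub>e Nm 1) * q"
      by (intro Store_correct) (auto simp: clean_memory memory_read memory_write)
    have "\<exists>t m. exec upd_body (s, \<omega>) t m (mem_of (rg(7 := Suc i)) (sketch E e ins (Suc i)) (\<lambda>_. 0), \<omega>)
        \<and> t \<le> (scost eAddr eNew + scost (Nm 7) (Rg 7 +\<^sub>e Nm 1)) * q"
      unfolding upd_body_def by (rule exec_Seq[OF 1 2]) (simp add: algebra_simps)
    then show ?thesis using I unfolding loop_inv_def by blast
  qed
  let ?s0 = "mem_of (rg(7 := 0)) (sketch E e ins 0) (\<lambda>_. 0)"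
  have "\<exists>s' \<omega>' t m. exec (WhileE (Rg 7 <\<^sub>e eK) upd_body) (?s0, \<omega>) t m (s', \<omega>')
      \<and> (loop_inv rg E e ins (q ^ 5) s' \<and> \<omega>' = \<omega>)
      \<and> t \<le> (q ^ 5 + 1) * ((scost eAddr eNew + scost (Nm 7) (Rg 7 +\<^sub>e Nm 1)) * q
          + (ecost (Rg 7 <\<^sub>e eK) + sz (Rg 7 <\<^sub>e eK) + 4) * q)"
  proof (rule WhileE_time[where I = "\<lambda>i s \<omega>'. loop_inv rg E e ins i s \<and> \<omega>' = \<omega>"])
    show "depth (Rg 7 <\<^sub>e eK) < 79" using depth_basic by simp
    show "loop_inv rg E e ins 0 ?s0 \<and> \<omega> = \<omega>" by (simp add: loop_inv_def)
  qed (use inv in blast, use body in blast)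
  then have w: "\<exists>t m. exec (WhileE (Rg 7 <\<^sub>e eK) upd_body) (?s0, \<omega>) t m (mem_of (rg(7 := q ^ 5)) (sketch E e ins (q ^ 5)) (\<lambda>_. 0), \<omega>)
      \<and> t \<le> (q ^ 5 + 1) * ((scost eAddr eNew + scost (Nm 7) (Rg 7 +\<^sub>e Nm 1)) * q
          + (ecost (Rg 7 <\<^sub>e eK) + sz (Rg 7 <\<^sub>e eK) + 4) * q)"
    unfolding loop_inv_def by blast
  let ?st = "mem_of rg (sketch E e ins 0) (\<lambda>_. 0)"
  have "\<exists>t m. exec (Store (Nm 7) (Nm 0)) (?st, \<omega>) t m (?s0, \<omega>) \<and> t \<le> scost (Nm 7) (Nm 0) * q"
  proof -
    have "?s0 = ?st(valex ?st (Nm 7) := valex ?st (Nm 0))" unfolding valex.simps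
      by (rule memory_write(1)[symmetric]) simp
    then show ?thesis using vb[of rg 0] rg(7) by (intro Store_correct) (simp_all add: clean_memory)
  qed
  note m = exec_Seq[OF this w order_refl, folded upd_main_def]
  then obtain t m where t: "exec upd_main (?st, \<omega>) t m (mem_of (rg(7 := q ^ 5)) (sketch E e ins (q ^ 5)) (\<lambda>_. 0), \<omega>)"
    "t \<le> scost (Nm 7) (Nm 0) * q + (q ^ 5 + 1) * ((scost eAddr eNew + scost (Nm 7) (Rg 7 +\<^sub>e Nm 1)) * q
          + (ecost (Rg 7 <\<^sub>e eK) + sz (Rg 7 <\<^sub>e eK) + 4) * q)" by blast
  have r5: "?st 5 = q" using rg by (simp add: memory_read)
  have "exec update (?st, \<omega>) (1 + operand_cost (Cell (Dir 5)) ?st + t) m (mem_of (rg(7 := q ^ 5)) (sketch E e ins (q ^ 5)) (\<lambda>_. 0), \<omega>)"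
    unfolding update_def by (rule exec.IfTrue[OF _ t(1)]) (use r5 q_pos in simp)
  moreover have "1 + operand_cost (Cell (Dir 5)) ?st + t \<le> upd_cost * q ^ 6"
  proof -
    define a where "a = scost (Nm 7) (Nm 0)"
    define b where "b = scost eAddr eNew + scost (Nm 7) (Rg 7 +\<^sub>e Nm 1) + ecost (Rg 7 <\<^sub>e eK) + sz (Rg 7 <\<^sub>e eK) + 4"
    have "bits (?st 5) \<le> q" using vbound_bits[OF vb[of rg 0]] rg(7) by simp
    then have o: "1 + operand_cost (Cell (Dir 5)) ?st \<le> 8 + q" using bits_small[of 5] by simp
    have q1: "1 \<le> q ^ 5" "q \<ge> 1" using q_pos by simp_all
    have q6: "q ^ 6 = q ^ 5 * q" by (simp add: eval_nat_numeral)
    have "q * 1 \<le> q ^ 5 * q" using q1 by (metis mult.commute mult_le_mono2)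
    then have q': "q \<le> q ^ 6" by (simp add: q6)
    have "t \<le> a * q + (q ^ 5 + 1) * (b * q)" using t(2) unfolding a_def b_def by (simp add: algebra_simps)
    also have "(q ^ 5 + 1) * (b * q) \<le> 2 * q ^ 5 * (b * q)" using q1 by (intro mult_le_mono1) simp
    also have "\<dots> = 2 * b * q ^ 6" by (simp add: q6)
    also have "a * q \<le> a * q ^ 6" using q' by (rule mult_le_mono2)
    finally have "1 + operand_cost (Cell (Dir 5)) ?st + t \<le> 8 + q + (a * q ^ 6 + 2 * b * q ^ 6)" using o by simp
    also have "\<dots> \<le> (a + 2 * b + 8) * q ^ 6" using q' q_pos by (simp add: algebra_simps)
    also have "a + 2 * b + 8 = upd_cost" by (simp add: a_def b_def upd_cost_def)
    finally show ?thesis .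
  qed
  ultimately show ?thesis unfolding s0 sK by blast
qed

end

section \<open>The initialization program\<close>

definition fit :: "nat \<Rightarrow> nat \<Rightarrow> mem \<Rightarrow> bool" where
  "fit V M s \<longleftrightarrow> clean 20 s \<and> vbound V s \<and> mem_bits s \<le> M"

lemma fit_Store:
  assumes "fit V M s" "readable s a" "readable s e" "depth a < 79" "depth e < 79" "valex s a \<notin> {20..<100}"
    and "s' = s(valex s a := valex s e)" "scost a e \<le> \<kappa>"
  shows "runm (M + \<kappa> * V) (Store a e) (s, \<omega>) (s', \<omega>)"
proof (rule runm_Store)
  have "scost a e * V \<le> \<kappa> * V" using assms(8) by (rule mult_le_mono1)
  then show "mem_bits s + scost a e * V \<le> M + \<kappa> * V" using assms(1) by (intro add_mono) (auto simp: fit_def)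
qed (use assms in \<open>auto simp: fit_def\<close>)

lemma fit_Store_register:
  assumes "fit V M (memory k q rg P Y c out)" "readable (memory k q rg P Y c out) e" "depth e < 79" "r < 20"
    and "\<And>a. rg' a = (if a = r then valex (memory k q rg P Y c out) e else rg a)" "scost (Nm r) e \<le> \<kappa>"
  shows "runm (M + \<kappa> * V) (Store (Nm r) e) (memory k q rg P Y c out, \<omega>) (memory k q rg' P Y c out, \<omega>)"
proof (rule fit_Store[OF assms(1) _ assms(2)])
  have "rg' = rg(r := valex (memory k q rg P Y c out) e)" using assms(5) by auto
  then show "memory k q rg' P Y c out
      = (memory k q rg P Y c out)(valex (memory k q rg P Y c out) (Nm r) := valex (memory k q rg P Y c out) e)"
    using assms(4) by (simp only: valex.simps memory_write(1))
qed (use assms in auto)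

lemma fit_WhileE:
  assumes inv: "\<And>i s \<omega>. J i s \<omega> \<Longrightarrow> i \<le> m \<Longrightarrow> fit V M s \<and> readable s e \<and> (valex s e \<noteq> 0 \<longleftrightarrow> i < m)"
    and body: "\<And>i s \<omega>. J i s \<omega> \<Longrightarrow> i < m \<Longrightarrow> \<exists>s' \<omega>'. runm (M + \<kappa> * V) b (s, \<omega>) (s', \<omega>') \<and> J (Suc i) s' \<omega>'"
    and e: "depth e < 79" "ecost e + sz e + 4 \<le> \<kappa>" and J: "J 0 s \<omega>"
  shows "\<exists>s' \<omega>'. runm (M + \<kappa> * V) (WhileE e b) (s, \<omega>) (s', \<omega>') \<and> J m s' \<omega>'"
proof (rule runm_WhileE[where I = J])
  fix i s \<omega> assume *: "J i s \<omega>" "i \<le> m"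
  have "(ecost e + sz e + 4) * V \<le> \<kappa> * V" using e(2) by (rule mult_le_mono1)
  then show "clean 20 s \<and> vbound V s \<and> readable s e \<and> (valex s e \<noteq> 0 \<longleftrightarrow> i < m)
      \<and> mem_bits s + (ecost e + sz e + 4) * V \<le> M + \<kappa> * V"
    using inv[OF *] unfolding fit_def by linarith
qed (use assms in auto)

text \<open>Register 5 becomes 1 if \<open>2 * k \<le> n\<close> and 0 otherwise; in the first case
  it is later overwritten by \<open>q\<close>, which is nonzero too.\<close>

definition init_flag :: com where
  "init_flag = Store (Nm 5) (Nm 1 -\<^sub>e (Rg 0 <\<^sub>e Rg 1 +\<^sub>e Rg 1))"
text \<open>Register 6 doubles from 1 until it reaches \<open>n\<close>, while register 5 grows by
  32 from 160. After \<open>l\<close> rounds, with \<open>l\<close> least such that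
  \<open>n \<le> 2 ^ l\<close>, it holds \<open>q = 32 * (l + 5)\<close>.\<close>

definition init_grow :: com where
  "init_grow = WhileE (Rg 6 <\<^sub>e Rg 0) (Seq (Store (Nm 6) (Rg 6 +\<^sub>e Rg 6)) (Store (Nm 5) (Rg 5 +\<^sub>e Nm 32)))"
definition init_pow :: com where
  "init_pow = WhileE (Rg 7 <\<^sub>e Rg 5) (Seq (Store (Nm 100 +\<^sub>e Rg 7) (Rg 6))
     (Seq (Store (Nm 6) (Rg 6 +\<^sub>e Rg 6)) (Store (Nm 7) (Rg 7 +\<^sub>e Nm 1))))"
definition eBitAddr where "eBitAddr = eaX +\<^sub>e Rg 7 div\<^sub>e Rg 5"
definition init_rand :: com where
  "init_rand = WhileE (Rg 7 <\<^sub>e eNX *\<^sub>e Rg 5) (Seq (Flip (Dir 8))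
     (Seq (Store eBitAddr (Nm 2 *\<^sub>e Ld eBitAddr +\<^sub>e Rg 8)) (Store (Nm 7) (Rg 7 +\<^sub>e Nm 1))))"
definition init_main :: com where
  "init_main = Seq (Store (Nm 5) (Nm 160)) (Seq (Store (Nm 6) (Nm 1)) (Seq init_grow
     (Seq (Store (Nm 6) (Nm 1)) (Seq init_pow (Seq (Store (Nm 6) (Nm 0)) (Seq (Store (Nm 7) (Nm 0)) init_rand))))))"
definition init :: com where
  "init = Seq init_flag (If (Cell (Dir 5)) init_main Skip)"

text \<open>A sum over all statements and loop conditions bounds each of them, so one space
  allowance serves the whole program.\<close>

definition init_cost :: nat where
  "init_cost = scost (Nm 5) (Nm 1 -\<^sub>e (Rg 0 <\<^sub>e Rg 1 +\<^sub>e Rg 1)) + scost (Nm 6) (Rg 6 +\<^sub>e Rg 6)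
     + scost (Nm 5) (Rg 5 +\<^sub>e Nm 32) + scost (Nm 100 +\<^sub>e Rg 7) (Rg 6) + scost (Nm 7) (Rg 7 +\<^sub>e Nm 1)
     + scost eBitAddr (Nm 2 *\<^sub>e Ld eBitAddr +\<^sub>e Rg 8) + scost (Nm 5) (Nm 160) + scost (Nm 6) (Nm 1)
     + scost (Nm 7) (Nm 0) + scost (Nm 6) (Nm 0) + (ecost (Rg 6 <\<^sub>e Rg 0) + sz (Rg 6 <\<^sub>e Rg 0) + 4)
     + (ecost (Rg 7 <\<^sub>e Rg 5) + sz (Rg 7 <\<^sub>e Rg 5) + 4)
     + (ecost (Rg 7 <\<^sub>e eNX *\<^sub>e Rg 5) + sz (Rg 7 <\<^sub>e eNX *\<^sub>e Rg 5) + 4)"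

context layout
begin

text \<open>Bounds the coin counter of \<open>init_rand\<close>.\<close>

lemma cNX_less: "cNX k q * q < 2 ^ q"
proof -
  have k2: "k ^ 2 \<le> 2 ^ (l * 2)" using order_trans[OF power_mono[OF k_le_n, of 2] n_power_le[of 2]] by simp
  have "(1::nat) \<le> 2 ^ (l * 2)" by simp
  then have "256 * k ^ 2 + 1 \<le> 512 * 2 ^ (l * 2)" using k2 by linarith
  then have "cR k + 1 \<le> 2 ^ 9 * 2 ^ (l * 2)" by (simp add: cR_def)
  then have c: "cR k + 1 \<le> 2 ^ (9 + l * 2)" by (simp only: power_add)
  have "q * (q + 1) * q \<le> q * (2 * q) * q" by (intro mult_le_mono) (use q_pos in auto)
  also have "\<dots> = 2 * q ^ 3" by (simp add: power3_eq_cube)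
  also have "\<dots> < 2 * 2 ^ ((l + 10) * 3)" using q_power_less[of 3] by simp
  also have "\<dots> = 2 ^ ((l + 10) * 3 + 1)" by (subst power_add) simp
  finally have "q * (q + 1) * q < 2 ^ ((l + 10) * 3 + 1)" .
  then have "q * (q + 1) * q * (cR k + 1) < 2 ^ ((l + 10) * 3 + 1) * 2 ^ (9 + l * 2)"
    using c by (intro mult_less_le_imp_less) auto
  also have "\<dots> = 2 ^ ((l + 10) * 3 + 1 + (9 + l * 2))" by (simp only: power_add)
  also have "\<dots> \<le> 2 ^ q" using q by (intro power_increasing) auto
  finally show ?thesis by (simp add: cNX_def mult_ac)
qed

text \<open>The bound of \<open>mem_bits_memory\<close> for cells of \<open>q + 1\<close> and
  registers of \<open>W\<close> bits.\<close>

definition cap :: "nat \<Rightarrow> nat" where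
  "cap W = 20 * (7 + W) + aE k q * (bits (aE k q) + (q + 1))"

lemma fit_memory:
  assumes "q + 1 \<le> W" "\<And>r. rg r < 2 ^ W" "\<And>j. j < q \<Longrightarrow> P j < 2 ^ (q + 1)" "\<And>p. p < cNX k q \<Longrightarrow> Y p < 2 ^ (q + 1)"
    "\<And>p. p < cN k q \<Longrightarrow> c p < 2 ^ (q + 1)" "\<And>i. i < 2 * k \<Longrightarrow> out i < 2 ^ (q + 1)"
  shows "fit W (cap W) (memory k q rg P Y c out)"
proof -
  have le: "a < 2 ^ W" if "a < 2 ^ (q + 1)" for a :: nat
    using that assms(1) by (meson less_le_trans one_le_numeral power_increasing)
  have "vbound W (memory k q rg P Y c out)"
  proof (rule vbound_memory)
    show "W \<ge> 7" using assms(1) q_pos by simp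
  qed (use assms(2) in blast, (rule le, use assms in blast)+)
  moreover have "mem_bits (memory k q rg P Y c out) \<le> cap W"
    unfolding cap_def by (intro mem_bits_memory) (use assms q_pos in auto)
  ultimately show ?thesis by (simp add: fit_def clean_memory)
qed

lemma eBitAddr:
  assumes "s 0 = n" "s 1 = k" "s 5 = q"
  shows "valex s eBitAddr = aX q + s 7 div q" "readable s eBitAddr" "readable s (Ld eBitAddr)"
  using ev_basic(8)[OF assms] readable_basic(9)[of s, OF assms(3)] assms(3)
  by (simp_all add: eBitAddr_def aX_def)

abbreviation "zeros \<equiv> (\<lambda>_ :: nat. 0 :: nat)"

text \<open>The hypothesis makes \<open>l\<close> the least exponent, so that the doubling loop ends
  after exactly \<open>l\<close> rounds. The stored numbers are those of
  \<open>prob_some_rep_good\<close>.\<close>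

lemma init_correct:
  assumes l: "\<And>i. i < l \<Longrightarrow> 2 ^ i < n"
  shows "\<exists>rg. runm (cap (q + 1) + init_cost * (q + 1)) init (initial_mem n k, \<omega>)
      (memory k q rg (\<lambda>j. 2 ^ j) (numbers q (stake (cNX k q * q) \<omega>)) zeros zeros, sdrop (cNX k q * q) \<omega>)
    \<and> rg 0 = n \<and> rg 1 = k \<and> rg 5 = q \<and> (\<forall>r. rg r < 2 ^ q)"
proof -
  \<comment> \<open>One bit more than \<open>q\<close>, because building the table of powers leaves
    \<open>2 ^ q\<close> in register 6.\<close>
  let ?V = "q + 1"
  let ?B = "cap ?V + init_cost * ?V"
  define r0 :: mem where "r0 = (\<lambda>_. 0)(0 := n, 1 := k)"
  have less1: "a < 2 ^ q \<Longrightarrow> a < 2 ^ ?V" for a :: nat by simp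
  have r0: "r0 r < 2 ^ ?V" for r using n_less k_le_n by (auto simp: r0_def)
  have n5: "q < 2 ^ q" by (rule less_exp)
  have "160 < (2::nat) ^ q" by (rule le_less_trans[OF q_pos(2) n5])
  then have one: "1 < (2::nat) ^ ?V" and c160: "160 < (2::nat) ^ ?V" by simp_all
  let ?i = "\<lambda>rg. memory k q rg zeros zeros zeros zeros"
  have fit0: "fit ?V (cap ?V) (?i rg)" if "\<And>r. rg r < 2 ^ ?V" for rg
    using that by (intro fit_memory) auto
  have s0: "initial_mem n k = ?i r0" by (rule ext) (simp add: initial_mem_def memory_def r0_def)
  have 1: "runm ?B init_flag (initial_mem n k, \<omega>) (?i (r0(5 := 1)), \<omega>)"
    unfolding init_flag_def s0
    by (rule fit_Store[OF fit0[OF r0]])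
      (use kn in \<open>simp_all add: memory_write(1)[symmetric] memory_read init_cost_def, simp_all add: r0_def\<close>)
  have 2: "runm ?B (Store (Nm 5) (Nm 160)) (?i (r0(5 := 1)), \<omega>) (?i (r0(5 := 160)), \<omega>)"
    by (rule fit_Store_register[OF fit0]) (use r0 one in \<open>simp_all add: init_cost_def\<close>)
  have 3: "runm ?B (Store (Nm 6) (Nm 1)) (?i (r0(5 := 160)), \<omega>) (?i (r0(5 := 160, 6 := 1)), \<omega>)"
    by (rule fit_Store_register[OF fit0]) (use r0 c160 in \<open>simp_all add: init_cost_def\<close>)
  let ?g = "\<lambda>i. r0(5 := 160 + 32 * i, 6 := 2 ^ i)"
  have pl: "2 ^ i < (2::nat) ^ ?V" if "i \<le> q" for i using that by (intro power_strict_increasing) auto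
  have gl: "160 + 32 * i < 2 ^ ?V" if "i \<le> l" for i
    by (rule less1, rule le_less_trans[OF _ n5]) (use that q in simp)
  have g: "?g i r < 2 ^ ?V" if "i \<le> l" for i r
    using r0 that pl[of i] gl[of i] q by auto
  let ?J = "\<lambda>i s \<omega>'. \<omega>' = \<omega> \<and> s = ?i (?g i)"
  have "\<exists>s' \<omega>'. runm ?B init_grow (?i (?g 0), \<omega>) (s', \<omega>') \<and> ?J l s' \<omega>'"
    unfolding init_grow_def
  proof (rule fit_WhileE[where J = ?J])
    fix i s \<omega>' assume J: "?J i s \<omega>'" "i \<le> l"
    have "fit ?V (cap ?V) s" unfolding conjunct2[OF J(1)] by (rule fit0[OF g[OF J(2)]])
    moreover have "valex s (Rg 6 <\<^sub>e Rg 0) \<noteq> 0 \<longleftrightarrow> 2 ^ i < n" using J by (simp add: memory_read) (simp add: r0_def)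
    moreover have "2 ^ i < n \<longleftrightarrow> i < l" using l J nl by (metis antisym_conv2 leD)
    ultimately show "fit ?V (cap ?V) s \<and> readable s (Rg 6 <\<^sub>e Rg 0) \<and> (valex s (Rg 6 <\<^sub>e Rg 0) \<noteq> 0 \<longleftrightarrow> i < l)" by simp
  next
    fix i s \<omega>' assume J: "?J i s \<omega>'" "i < l"
    let ?s1 = "?i (r0(5 := 160 + 32 * i, 6 := 2 ^ Suc i))"
    have f: "fit ?V (cap ?V) s" unfolding conjunct2[OF J(1)] by (rule fit0[OF g[OF less_imp_le[OF J(2)]]])
    have g': "(r0(5 := 160 + 32 * i, 6 := 2 ^ Suc i)) r < 2 ^ ?V" for r
      using g[of "Suc i" r] gl[of i] J(2) by (auto split: if_splits)
    have "runm ?B (Store (Nm 6) (Rg 6 +\<^sub>e Rg 6)) (s, \<omega>') (?s1, \<omega>')"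
      unfolding conjunct2[OF J(1)]
      by (rule fit_Store_register[OF fit0[OF g]]) (use J(2) in \<open>simp_all add: init_cost_def memory_read\<close>)
    moreover have "runm ?B (Store (Nm 5) (Rg 5 +\<^sub>e Nm 32)) (?s1, \<omega>') (?i (?g (Suc i)), \<omega>')"
      by (rule fit_Store_register[OF fit0[OF g']]) (simp_all add: init_cost_def memory_read)
    ultimately show "\<exists>s' \<omega>''. runm ?B (Seq (Store (Nm 6) (Rg 6 +\<^sub>e Rg 6)) (Store (Nm 5) (Rg 5 +\<^sub>e Nm 32))) (s, \<omega>') (s', \<omega>'') \<and> ?J (Suc i) s' \<omega>''"
      using runm_Seq J by blast
  qed (simp_all add: init_cost_def)
  moreover have "?g 0 = r0(5 := 160, 6 := 1)" by simp
  moreover have "160 + 32 * l = q" using q by simp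
  ultimately have 4: "runm ?B init_grow (?i (r0(5 := 160, 6 := 1)), \<omega>) (?i (r0(5 := q, 6 := 2 ^ l)), \<omega>)" by simp
  let ?h = "\<lambda>i. r0(5 := q, 6 := 2 ^ i, 7 := i)"
  have h: "?h i r < 2 ^ ?V" if "i \<le> q" for i r
    using r0 that pl[of i] less1[OF n5] by auto
  have 5: "runm ?B (Store (Nm 6) (Nm 1)) (?i (r0(5 := q, 6 := 2 ^ l)), \<omega>) (?i (?h 0), \<omega>)"
  proof (rule fit_Store_register[OF fit0])
    show "(r0(5 := q, 6 := 2 ^ l)) r < 2 ^ ?V" for r using r0 pl[of l] q less1[OF n5] by auto
  qed (simp_all add: init_cost_def, simp add: r0_def)
  let ?P = "\<lambda>i j. if j < i then 2 ^ j else 0 :: nat"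
  let ?p = "\<lambda>rg i. memory k q rg (?P i) zeros zeros zeros"
  have fitp: "fit ?V (cap ?V) (?p rg i)" if "\<And>r. rg r < 2 ^ ?V" for rg i
    using that by (intro fit_memory) (auto intro: pl[simplified])
  let ?J = "\<lambda>i s \<omega>'. \<omega>' = \<omega> \<and> s = ?p (?h i) i"
  have "\<exists>s' \<omega>'. runm ?B init_pow (?p (?h 0) 0, \<omega>) (s', \<omega>') \<and> ?J q s' \<omega>'"
    unfolding init_pow_def
  proof (rule fit_WhileE[where J = ?J])
    fix i s \<omega>' assume J: "?J i s \<omega>'" "i \<le> q"
    have "fit ?V (cap ?V) s" unfolding conjunct2[OF J(1)] by (rule fitp[OF h[OF J(2)]])
    then show "fit ?V (cap ?V) s \<and> readable s (Rg 7 <\<^sub>e Rg 5) \<and> (valex s (Rg 7 <\<^sub>e Rg 5) \<noteq> 0 \<longleftrightarrow> i < q)"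
      using J by (simp add: memory_read)
  next
    fix i s \<omega>' assume J: "?J i s \<omega>'" "i < q"
    have f: "fit ?V (cap ?V) s" unfolding conjunct2[OF J(1)] by (rule fitp[OF h[OF less_imp_le[OF J(2)]]])
    let ?s1 = "?p (?h i) (Suc i)"
    let ?s2 = "?p (r0(5 := q, 6 := 2 ^ Suc i, 7 := i)) (Suc i)"
    have "runm ?B (Store (Nm 100 +\<^sub>e Rg 7) (Rg 6)) (s, \<omega>') (?s1, \<omega>')"
    proof (rule fit_Store[OF f])
      have "?P (Suc i) = (?P i)(i := 2 ^ i)" by (rule ext) auto
      then show "?s1 = s(valex s (Nm 100 +\<^sub>e Rg 7) := valex s (Rg 6))" using J
        by (simp only: valex.simps bop.simps memory_read(1)) (simp add: memory_read memory_write(2))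
    qed (simp_all add: init_cost_def)
    moreover have "runm ?B (Store (Nm 6) (Rg 6 +\<^sub>e Rg 6)) (?s1, \<omega>') (?s2, \<omega>')"
      by (rule fit_Store_register[OF fitp[OF h]]) (use J(2) in \<open>simp_all add: init_cost_def memory_read\<close>)
    moreover have "runm ?B (Store (Nm 7) (Rg 7 +\<^sub>e Nm 1)) (?s2, \<omega>') (?p (?h (Suc i)) (Suc i), \<omega>')"
    proof (rule fit_Store_register[OF fitp])
      show "(r0(5 := q, 6 := 2 ^ Suc i, 7 := i)) r < 2 ^ ?V" for r
        using h[of "Suc i" r] h[of i r] J by (auto split: if_splits)
    qed (simp_all add: init_cost_def memory_read)
    ultimately show "\<exists>s' \<omega>''. runm ?B (Seq (Store (Nm 100 +\<^sub>e Rg 7) (Rg 6))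
     (Seq (Store (Nm 6) (Rg 6 +\<^sub>e Rg 6)) (Store (Nm 7) (Rg 7 +\<^sub>e Nm 1)))) (s, \<omega>') (s', \<omega>'') \<and> ?J (Suc i) s' \<omega>''"
      using runm_Seq J by blast
  qed (simp_all add: init_cost_def)
  moreover have "?p (?h 0) 0 = ?i (?h 0)" by simp
  moreover have "?p rg q = memory k q rg (\<lambda>j. 2 ^ j) zeros zeros zeros" for rg
    by (rule ext) (auto simp: memory_def aX_def)
  ultimately have 6: "runm ?B init_pow (?i (?h 0), \<omega>) (memory k q (?h q) (\<lambda>j. 2 ^ j) zeros zeros zeros, \<omega>)" by auto
  let ?m = "\<lambda>rg i. memory k q rg (\<lambda>j. 2 ^ j) (numbers q (stake i \<omega>)) zeros zeros"
  have fitm: "fit ?V (cap ?V) (?m rg i)" if "\<And>r. rg r < 2 ^ ?V" for rg i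
    using that by (intro fit_memory) (auto intro: pl[simplified] less1[OF numbers_less, simplified])
  have n0: "numbers q (stake 0 \<omega>) = zeros" by (rule ext) (simp add: numbers_def num_Nil)
  let ?r = "r0(5 := q, 6 := 0, 7 := 0)"
  let ?r' = "r0(5 := q, 6 := 0, 7 := q)"
  have r: "?r r < 2 ^ ?V" and r': "?r' r < 2 ^ ?V" for r using r0 less1[OF n5] by auto
  have 7: "runm ?B (Store (Nm 6) (Nm 0)) (memory k q (?h q) (\<lambda>j. 2 ^ j) zeros zeros zeros, \<omega>) (?m ?r' 0, \<omega>)"
    unfolding n0
    by (rule fit_Store_register[OF fitm[of "?h q" 0, unfolded n0]]) (use h[of q] in \<open>simp_all add: init_cost_def\<close>)
  have 8: "runm ?B (Store (Nm 7) (Nm 0)) (?m ?r' 0, \<omega>) (?m ?r 0, \<omega>)"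
    by (rule fit_Store_register[OF fitm[OF r']]) (simp_all add: init_cost_def)
  let ?T = "cNX k q * q"
  \<comment> \<open>After \<open>i\<close> tosses exactly \<open>i\<close> bits of the tape are
    consumed and stored; register 8 holds some bit whose value no longer matters.\<close>
  let ?J = "\<lambda>i s \<omega>'. \<omega>' = sdrop i \<omega> \<and> (\<exists>b<2. s = ?m (?r(7 := i, 8 := b)) i)"
  have rb: "(?r(7 := i, 8 := b)) r < 2 ^ ?V" if "i \<le> ?T" "b < 2" for i b r
  proof -
    have "i < 2 ^ ?V" "b < 2 ^ ?V" using that cNX_less one by auto
    then show ?thesis using r[of r] by auto
  qed
  have "\<exists>s' \<omega>'. runm ?B init_rand (?m ?r 0, \<omega>) (s', \<omega>') \<and> ?J ?T s' \<omega>'"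
    unfolding init_rand_def
  proof (rule fit_WhileE[where J = ?J])
    fix i s \<omega>' assume J: "?J i s \<omega>'" "i \<le> ?T"
    then obtain b where b: "b < 2" "s = ?m (?r(7 := i, 8 := b)) i" by blast
    have "fit ?V (cap ?V) s" unfolding b(2) by (rule fitm) (use rb J(2) b in blast)
    moreover have s: "s 0 = n" "s 1 = k" "s 5 = q" "s 7 = i" by (simp_all add: b memory_read, simp_all add: r0_def)
    ultimately show "fit ?V (cap ?V) s \<and> readable s (Rg 7 <\<^sub>e eNX *\<^sub>e Rg 5) \<and> (valex s (Rg 7 <\<^sub>e eNX *\<^sub>e Rg 5) \<noteq> 0 \<longleftrightarrow> i < ?T)"
      using ev_basic[OF s(1-3)] readable_basic[of s, OF s(3)] by simp
  next
    fix i s \<omega>' assume J: "?J i s \<omega>'" "i < ?T"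
    then obtain b where b: "b < 2" "s = ?m (?r(7 := i, 8 := b)) i" by blast
    let ?b = "of_bool (shd \<omega>') :: nat"
    let ?s1 = "?m (?r(7 := i, 8 := ?b)) i"
    have f: "fit ?V (cap ?V) s" unfolding b(2) by (rule fitm) (use rb J(2) b in \<open>blast intro: less_imp_le\<close>)
    have f1: "fit ?V (cap ?V) ?s1" by (rule fitm) (use rb[of i ?b] J(2) in simp)
    have a: "runm ?B (Flip (Dir 8)) (s, \<omega>') (?s1, stl \<omega>')"
    proof (rule runm_Flip)
      have "(?r(7 := i, 8 := b))(8 := ?b) = ?r(7 := i, 8 := ?b)" by (rule ext) simp
      then show "?s1 = s(8 := ?b)" by (simp only: b(2)) (simp add: memory_write(1))
    qed (use f f1 in \<open>simp_all add: fit_def\<close>)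
    have s: "?s1 0 = n" "?s1 1 = k" "?s1 5 = q" "?s1 7 = i" "?s1 8 = ?b"
      by (simp_all add: memory_read, simp_all add: r0_def)
    have p: "i div q < cNX k q" using J(2) by (simp add: less_mult_imp_div_less)
    have ad: "valex ?s1 eBitAddr = aX q + i div q" using eBitAddr(1)[OF s(1-3)] unfolding s(4) .
    note rd = eBitAddr(2,3)[OF s(1-3)]
    let ?s2 = "?m (?r(7 := i, 8 := ?b)) (Suc i)"
    have c: "runm ?B (Store eBitAddr (Nm 2 *\<^sub>e Ld eBitAddr +\<^sub>e Rg 8)) (?s1, stl \<omega>') (?s2, stl \<omega>')"
    proof (rule fit_Store[OF f1 rd(1)])
      have "shd \<omega>' = \<omega> !! i" using J by simp
      then have "numbers q (stake (Suc i) \<omega>) = (numbers q (stake i \<omega>))(i div q := 2 * numbers q (stake i \<omega>) (i div q) + ?b)"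
        using numbers_snoc[OF q_pos(1), of "stake i \<omega>" "shd \<omega>'"] by (simp only: stake_Suc length_stake)
      moreover have "valex ?s1 (Nm 2 *\<^sub>e Ld eBitAddr +\<^sub>e Rg 8) = 2 * numbers q (stake i \<omega>) (i div q) + ?b"
        by (simp only: valex.simps bop.simps ad s(5) memory_read(3)[OF p])
      ultimately show "?s2 = ?s1(valex ?s1 eBitAddr := valex ?s1 (Nm 2 *\<^sub>e Ld eBitAddr +\<^sub>e Rg 8))"
        unfolding ad by (simp only: memory_write(3)[OF p])
      show "readable ?s1 (Nm 2 *\<^sub>e Ld eBitAddr +\<^sub>e Rg 8)" using rd(2) by (simp only: readable.simps) simp
      show "valex ?s1 eBitAddr \<notin> {20..<100}" unfolding ad by (simp add: aX_def)
    qed (use depth_basic in \<open>simp_all add: init_cost_def eBitAddr_def\<close>)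
    have d: "runm ?B (Store (Nm 7) (Rg 7 +\<^sub>e Nm 1)) (?s2, stl \<omega>') (?m (?r(7 := Suc i, 8 := ?b)) (Suc i), stl \<omega>')"
    proof (rule fit_Store_register[OF fitm])
      show "(?r(7 := i, 8 := ?b)) r < 2 ^ ?V" for r using rb[of i ?b] J(2) by simp
    qed (simp_all add: init_cost_def memory_read)
    show "\<exists>s' \<omega>''. runm ?B (Seq (Flip (Dir 8)) (Seq (Store eBitAddr (Nm 2 *\<^sub>e Ld eBitAddr +\<^sub>e Rg 8))
        (Store (Nm 7) (Rg 7 +\<^sub>e Nm 1)))) (s, \<omega>') (s', \<omega>'') \<and> ?J (Suc i) s' \<omega>''"
    proof (intro exI conjI)
      show "runm ?B (Seq (Flip (Dir 8)) (Seq (Store eBitAddr (Nm 2 *\<^sub>e Ld eBitAddr +\<^sub>e Rg 8))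
        (Store (Nm 7) (Rg 7 +\<^sub>e Nm 1)))) (s, \<omega>') (?m (?r(7 := Suc i, 8 := ?b)) (Suc i), stl \<omega>')"
        by (rule runm_Seq[OF a runm_Seq[OF c d]])
      show "stl \<omega>' = sdrop (Suc i) \<omega>" unfolding conjunct1[OF J(1)] sdrop.simps sdrop_stl ..
      show "?b < 2" by simp
    qed simp
  next
    have "?r(7 := 0, 8 := 0) = ?r" by (rule ext) (simp add: r0_def)
    then have "?m ?r 0 = ?m (?r(7 := 0, 8 := 0)) 0" by simp
    then show "\<omega> = sdrop 0 \<omega> \<and> (\<exists>b<2. ?m ?r 0 = ?m (?r(7 := 0, 8 := b)) 0)" by (intro conjI exI[of _ 0]) auto
  qed (use depth_basic in \<open>auto simp: init_cost_def\<close>)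
  then obtain s' \<omega>' b where "runm ?B init_rand (?m ?r 0, \<omega>) (s', \<omega>')" "\<omega>' = sdrop ?T \<omega>" "b < 2"
    "s' = ?m (?r(7 := ?T, 8 := b)) ?T" by blast
  then have b: "b < 2" "runm ?B init_rand (?m ?r 0, \<omega>) (?m (?r(7 := ?T, 8 := b)) ?T, sdrop ?T \<omega>)" by simp_all
  let ?rg = "?r(7 := ?T, 8 := b)"
  have main: "runm ?B init_main (?i (r0(5 := 1)), \<omega>) (?m ?rg ?T, sdrop ?T \<omega>)"
    unfolding init_main_def
    by (rule runm_Seq[OF 2 runm_Seq[OF 3 runm_Seq[OF 4 runm_Seq[OF 5 runm_Seq[OF 6 runm_Seq[OF 7 runm_Seq[OF 8 b(2)]]]]]]])
  have "runm ?B (If (Cell (Dir 5)) init_main Skip) (?i (r0(5 := 1)), \<omega>) (?m ?rg ?T, sdrop ?T \<omega>)"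
    using main exec.IfTrue[of "Cell (Dir 5)" "?i (r0(5 := 1))"] unfolding runm_def
    by (simp add: memory_read) blast
  then have "runm ?B init (initial_mem n k, \<omega>) (?m ?rg ?T, sdrop ?T \<omega>)"
    unfolding init_def by (rule runm_Seq[OF 1])
  moreover have "?rg r < 2 ^ q" for r
  proof -
    have "1 < (2::nat) ^ q" using q_pos by (intro one_less_power) auto
    then have "b < 2 ^ q" using b(1) by simp
    then show ?thesis using cNX_less n_less k_le_n n5 by (auto simp: r0_def)
  qed
  ultimately show ?thesis by (intro exI[of _ ?rg]) (auto simp: r0_def)
qed

end

section \<open>The query program\<close>

text \<open>Both truncated differences vanish exactly if the values agree; otherwise one of them
  cancels the 1.\<close>

definition eEq where "eEq a b = Nm 1 -\<^sub>e (a -\<^sub>e b) -\<^sub>e (b -\<^sub>e a)"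
text \<open>Registers of the search: 7 holds the candidate, 8 a loop counter, 9 the digits not yet
  decoded, 10 a flag, 11 the number of candidates. Conjunction is multiplication of flags.\<close>

definition eCell where "eCell = Ld (eaC +\<^sub>e Rg 9 mod\<^sub>e eN)"
definition eOk1 where "eOk1 = Rg 10 *\<^sub>e eEq (eCell div\<^sub>e eW) (Nm 1)"
definition eOut where "eOut = eaO +\<^sub>e (Rg 8 +\<^sub>e Rg 8)"
definition eFst where "eFst = eCell mod\<^sub>e eW div\<^sub>e Rg 0"
definition eSnd where "eSnd = eCell mod\<^sub>e eW mod\<^sub>e Rg 0"
text \<open>The counter in register 8 is read as a pair of positions in base \<open>2 * k\<close>,
  so that one loop compares all pairs of endpoints.\<close>

definition eA where "eA = Rg 8 div\<^sub>e (Rg 1 +\<^sub>e Rg 1)"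
definition eB where "eB = Rg 8 mod\<^sub>e (Rg 1 +\<^sub>e Rg 1)"
definition eOk2 where "eOk2 = Rg 10 *\<^sub>e (Nm 1 -\<^sub>e (eA <\<^sub>e eB) *\<^sub>e eEq (Ld (eaO +\<^sub>e eA)) (Ld (eaO +\<^sub>e eB)))"
definition eEnd where "eEnd = (Rg 1 +\<^sub>e Rg 1) *\<^sub>e (Rg 1 +\<^sub>e Rg 1)"
definition eGo where "eGo = (Rg 7 <\<^sub>e Rg 11) *\<^sub>e (Nm 1 -\<^sub>e Rg 10)"

definition q_dec :: com where
  "q_dec = WhileE (Rg 8 <\<^sub>e Rg 1) (Seq (Store (Nm 10) eOk1) (Seq (Store eOut eFst)
     (Seq (Store (eOut +\<^sub>e Nm 1) eSnd) (Seq (Store (Nm 9) (Rg 9 div\<^sub>e eN)) (Store (Nm 8) (Rg 8 +\<^sub>e Nm 1))))))"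
definition q_chk :: com where
  "q_chk = WhileE (Rg 8 <\<^sub>e eEnd) (Seq (Store (Nm 10) eOk2) (Store (Nm 8) (Rg 8 +\<^sub>e Nm 1)))"
definition q_try :: com where
  "q_try = Seq (Store (Nm 10) (Nm 1)) (Seq (Store (Nm 9) (Rg 7)) (Seq (Store (Nm 8) (Nm 0))
     (Seq q_dec (Seq (Store (Nm 8) (Nm 0)) (Seq q_chk (Store (Nm 7) (Rg 7 +\<^sub>e Nm 1)))))))"
definition q_pow :: com where
  "q_pow = WhileE (Rg 8 <\<^sub>e Rg 1) (Seq (Store (Nm 11) (Rg 11 *\<^sub>e eN)) (Store (Nm 8) (Rg 8 +\<^sub>e Nm 1)))"
text \<open>The output length is the flag times \<open>k\<close>, hence 0 after an unsuccessful
  search.\<close>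

definition q_main :: com where
  "q_main = Seq (Store (Nm 11) (Nm 1)) (Seq (Store (Nm 8) (Nm 0)) (Seq q_pow (Seq (Store (Nm 7) (Nm 0))
     (Seq (Store (Nm 10) (Nm 0)) (Seq (WhileE eGo q_try) (Seq (Store (Nm 2) (Rg 10 *\<^sub>e Rg 1)) (Store (Nm 3) eaO)))))))"
definition query :: com where
  "query = If (Cell (Dir 5)) q_main (Store (Nm 2) (Nm 0))"

definition query_cost :: nat where
  "query_cost = scost (Nm 10) eOk1 + scost eOut eFst + scost (eOut +\<^sub>e Nm 1) eSnd + scost (Nm 9) (Rg 9 div\<^sub>e eN)
     + scost (Nm 8) (Rg 8 +\<^sub>e Nm 1) + scost (Nm 10) eOk2 + scost (Nm 10) (Nm 1) + scost (Nm 9) (Rg 7)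
     + scost (Nm 8) (Nm 0) + scost (Nm 7) (Rg 7 +\<^sub>e Nm 1) + scost (Nm 11) (Rg 11 *\<^sub>e eN) + scost (Nm 11) (Nm 1)
     + scost (Nm 7) (Nm 0) + scost (Nm 10) (Nm 0) + scost (Nm 2) (Rg 10 *\<^sub>e Rg 1) + scost (Nm 3) eaO
     + (ecost (Rg 8 <\<^sub>e Rg 1) + sz (Rg 8 <\<^sub>e Rg 1) + 4) + (ecost (Rg 8 <\<^sub>e eEnd) + sz (Rg 8 <\<^sub>e eEnd) + 4)
     + (ecost eGo + sz eGo + 4) + scost (Nm 2) (Nm 0)"

lemma ev_eEq: "valex s (eEq a b) = of_bool (valex s a = valex s b)"
  by (auto simp: eEq_def)

lemma setcompr_less_cong:
  fixes r :: nat
  assumes "\<And>i. i < r \<Longrightarrow> F i = H i"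
  shows "{F i | i. i < r} = {H i | i. i < r}"
  by (intro Collect_cong ex_cong1) (use assms in auto)

text \<open>Justifies the single loop of \<open>q_chk\<close>.\<close>

lemma inj_on_lessThan_square:
  fixes m :: nat
  shows "inj_on f {..<m} \<longleftrightarrow> (\<forall>z<m * m. \<not> (z div m < z mod m \<and> f (z div m) = f (z mod m)))" (is "_ \<longleftrightarrow> ?R")
proof
  assume f: "inj_on f {..<m}"
  show ?R
  proof (intro allI impI notI)
    fix z assume "z < m * m" "z div m < z mod m \<and> f (z div m) = f (z mod m)"
    moreover have "z div m < m" using \<open>z < m * m\<close> using less_mult_imp_div_less by blast
    moreover have "z mod m < m" using \<open>z < m * m\<close> by (cases m) auto
    ultimately show False using inj_onD[OF f, of "z div m" "z mod m"] by auto
  qed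
next
  assume R: ?R
  have "f a \<noteq> f b" if "a < b" "b < m" for a b
  proof -
    have "a * m + b < m * m" using mult_le_mono1[of "Suc a" m m] that by simp
    then show ?thesis using R[rule_format, of "a * m + b"] mixed_radix[OF that(2), of a] that(1) by simp
  qed
  then show "inj_on f {..<m}" unfolding inj_on_def by (metis lessThan_iff nat_neq_iff)
qed

context layout
begin

text \<open>Enough for the candidates, which number \<open>cN k q ^ k \<le> 2 ^ (q * k)\<close>, and
  for the address of the output array, which is below \<open>2 ^ (q + 2)\<close>.\<close>

definition W where "W = q * k + 2"

lemma q_le_W: "q + 2 \<le> W" "q + 1 \<le> W" proof -
  have "q \<le> q * k" using mult_le_mono2[OF k, of q] unfolding mult_1_right .
  then show "q + 2 \<le> W" "q + 1 \<le> W" unfolding W_def by linarith+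
qed

lemma less_W: "a < 2 ^ (q + 1) \<Longrightarrow> a < 2 ^ W" for a :: nat
  using q_le_W(2) by (meson less_le_trans one_le_numeral power_increasing)

lemma cN_pos: "cN k q > 0" using cQ_pos q_pos by (simp add: cN_def)

lemma cN_less: "cN k q < 2 ^ q"
proof -
  have k2: "k ^ 2 \<le> 2 ^ (l * 2)" using order_trans[OF power_mono[OF k_le_n, of 2] n_power_le[of 2]] by simp
  have "q ^ 9 = q ^ 5 * (q ^ 2 * q ^ 2)" by (simp only: power_add[symmetric]) simp
  then have "cN k q = 2 ^ 10 * k ^ 2 * q ^ 9"
    by (simp add: cN_def cQ_def cS_def cG_def power2_eq_square mult_ac)
  also have "\<dots> \<le> 2 ^ 10 * 2 ^ (l * 2) * q ^ 9" using k2 by simp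
  also have "\<dots> < 2 ^ 10 * 2 ^ (l * 2) * 2 ^ ((l + 10) * 9)" using q_power_less[of 9] by simp
  also have "\<dots> = 2 ^ (10 + l * 2 + (l + 10) * 9)" by (simp only: power_add)
  also have "\<dots> \<le> 2 ^ q" using q by (intro power_increasing) auto
  finally show ?thesis .
qed

lemma cN_power_less: "cN k q ^ i < 2 ^ W" if "i \<le> k"
proof -
  have "cN k q ^ i \<le> (2 ^ q) ^ i" using cN_less by (intro power_mono) auto
  also have "\<dots> = 2 ^ (q * i)" by (simp add: power_mult)
  also have "\<dots> < 2 ^ W" using that unfolding W_def by (intro power_strict_increasing) (auto simp: less_Suc_eq_le le_SucI)
  finally show ?thesis .
qed

lemma square_less: "2 * k * (2 * k) < 2 ^ W"
proof -
  have "2 * k * (2 * k) \<le> n * n" using kn by (intro mult_le_mono)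
  also have "\<dots> = n ^ 2" by (simp add: power2_eq_square)
  also have "\<dots> \<le> 2 ^ (l * 2)" by (rule n_power_le)
  also have "\<dots> < 2 ^ (q + 1)" using q by (intro power_strict_increasing) auto
  finally show ?thesis by (rule less_W)
qed

lemma aO_less: "aO k q < 2 ^ W"
proof -
  have "100 + q \<le> 2 * q" using q_pos by simp
  also have "\<dots> \<le> 2 * 2 ^ (l + 10)" using q_less by simp
  also have "\<dots> = 2 ^ (l + 10 + 1)" by (subst power_add[of _ _ 1]) simp
  also have "\<dots> \<le> 2 ^ q" using q by (intro power_increasing) auto
  finally have 1: "100 + q \<le> 2 ^ q" .
  have "1 \<le> q" using q_pos by simp
  from mult_le_mono2[OF this, of "cNX k q"] have "cNX k q \<le> cNX k q * q" unfolding mult_1_right .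
  then have 2: "cNX k q < 2 ^ q" using cNX_less by (rule le_less_trans)
  have "aO k q < 4 * 2 ^ q" using 1 2 cN_less by (simp add: aO_def aC_def aX_def)
  also have "\<dots> = 2 ^ (q + 2)" by (simp add: power_add)
  also have "\<dots> \<le> 2 ^ W" using q_le_W by (intro power_increasing) auto
  finally show ?thesis .
qed

definition okr where "okr rg \<longleftrightarrow> rg 0 = n \<and> rg 1 = k \<and> rg 5 = q \<and> (\<forall>r. rg r < 2 ^ W)"
definition oko :: "mem \<Rightarrow> bool" where "oko out \<longleftrightarrow> (\<forall>m<2 * k. out m < 2 ^ (q + 1))"
definition qB where "qB = cap W + query_cost * W"

context
  fixes c :: mem
  assumes c: "\<And>p. c p < 2 ^ q"
begin


lemma fit_st: "okr rg \<Longrightarrow> oko out \<Longrightarrow> fit W (cap W) (mem_of rg c out)"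
proof (rule fit_memory[OF q_le_W(2)])
  have *: "a < 2 ^ (q + 1)" if "a < 2 ^ q" for a :: nat using that by simp
  show "2 ^ j < (2::nat) ^ (q + 1)" if "j < q" for j using that by (intro power_strict_increasing) auto
  show "X p < 2 ^ (q + 1)" "c p < 2 ^ (q + 1)" for p by (rule *[OF X], rule *[OF c])
qed (auto simp: okr_def oko_def)

lemma st_regs:
  assumes "okr rg"
  shows "mem_of rg c out 0 = n" "mem_of rg c out 1 = k" "mem_of rg c out 5 = q"
  using assms by (simp_all add: okr_def memory_read)

lemma ev_st:
  assumes "okr rg"
  shows "valex (mem_of rg c out) eN = cN k q" "valex (mem_of rg c out) eaC = aC k q" "valex (mem_of rg c out) eaO = aO k q"
    "valex (mem_of rg c out) eW = n ^ 4" "valex (mem_of rg c out) eEnd = 2 * k * (2 * k)"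
    "valex (mem_of rg c out) eOut = aO k q + 2 * rg 8"
    "valex (mem_of rg c out) eCell = c (rg 9 mod cN k q)"
    "valex (mem_of rg c out) eA = rg 8 div (2 * k)" "valex (mem_of rg c out) eB = rg 8 mod (2 * k)"
proof -
  note r = st_regs[OF assms, of out]
  note b = ev_basic[OF r]
  have r8: "mem_of rg c out 8 = rg 8" "mem_of rg c out 9 = rg 9" by (simp_all add: memory_read)
  show "valex (mem_of rg c out) eN = cN k q" "valex (mem_of rg c out) eaC = aC k q" "valex (mem_of rg c out) eaO = aO k q"
    "valex (mem_of rg c out) eW = n ^ 4" by (rule b)+
  show "valex (mem_of rg c out) eEnd = 2 * k * (2 * k)"
    unfolding eEnd_def valex.simps bop.simps r by (simp add: mult_2)
  show "valex (mem_of rg c out) eOut = aO k q + 2 * rg 8"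
    unfolding eOut_def valex.simps bop.simps b r8 by simp
  show "valex (mem_of rg c out) eCell = c (rg 9 mod cN k q)"
    unfolding eCell_def valex.simps bop.simps b r8 by (rule memory_read(4)) (simp add: cN_pos)
  show "valex (mem_of rg c out) eA = rg 8 div (2 * k)" "valex (mem_of rg c out) eB = rg 8 mod (2 * k)"
    unfolding eA_def eB_def valex.simps bop.simps r r8 by (simp_all add: mult_2)
qed

lemma readable_st:
  assumes "okr rg"
  shows "readable (mem_of rg c out) eN" "readable (mem_of rg c out) eaO" "readable (mem_of rg c out) eOut"
    "readable (mem_of rg c out) eOk1" "readable (mem_of rg c out) eFst" "readable (mem_of rg c out) eSnd"
    "readable (mem_of rg c out) eOk2" "readable (mem_of rg c out) eEnd" "readable (mem_of rg c out) eGo"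
proof -
  note r = readable_basic[of "mem_of rg c out", OF st_regs(3)[OF assms]]
  note e = ev_st[OF assms, of out]
  have cell: "readable (mem_of rg c out) eCell"
    unfolding eCell_def readable.simps valex.simps bop.simps e using r by (simp add: aC_def aX_def)
  have ab: "readable (mem_of rg c out) eA" "readable (mem_of rg c out) eB" by (simp_all add: eA_def eB_def)
  have l: "readable (mem_of rg c out) (Ld (eaO +\<^sub>e eA))" "readable (mem_of rg c out) (Ld (eaO +\<^sub>e eB))"
    unfolding readable.simps valex.simps bop.simps e using r ab by (simp_all add: aO_def aC_def aX_def)
  show "readable (mem_of rg c out) eN" "readable (mem_of rg c out) eaO" "readable (mem_of rg c out) eOut"
    "readable (mem_of rg c out) eOk1" "readable (mem_of rg c out) eFst" "readable (mem_of rg c out) eSnd"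
    "readable (mem_of rg c out) eEnd" "readable (mem_of rg c out) eGo"
    using r cell by (simp_all add: eOut_def eOk1_def eFst_def eSnd_def eEnd_def eGo_def eEq_def)
  show "readable (mem_of rg c out) eOk2"
    using r l ab unfolding eOk2_def eEq_def readable.simps(2,4) readable.simps(1) by simp
qed

lemma depth_query:
  "depth eN < 79" "depth eaO < 79" "depth eOut < 70" "depth eOk1 < 79" "depth eFst < 79" "depth eSnd < 79"
  "depth eOk2 < 79" "depth eEnd < 78" "depth eGo < 79" "depth eN < 78"
  using depth_basic by (simp_all add: eOut_def eOk1_def eFst_def eSnd_def eOk2_def eEnd_def eGo_def eEq_def eCell_def eA_def eB_def)

lemma set_reg:
  assumes "okr rg" "oko out" "readable (mem_of rg c out) e" "depth e < 79" "r < 20" "r \<notin> {0, 1, 5}"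
    and "valex (mem_of rg c out) e = v" "v < 2 ^ W" "scost (Nm r) e \<le> query_cost"
  shows "runm qB (Store (Nm r) e) (mem_of rg c out, \<omega>) (mem_of (rg(r := v)) c out, \<omega>)" "okr (rg(r := v))"
proof -
  show "runm qB (Store (Nm r) e) (mem_of rg c out, \<omega>) (mem_of (rg(r := v)) c out, \<omega>)"
    unfolding qB_def
    by (rule fit_Store_register[OF fit_st[OF assms(1,2)] assms(3,4,5) _ assms(9)]) (simp add: assms(7))
  show "okr (rg(r := v))" using assms(1,6,8) by (auto simp: okr_def)
qed

lemma okr_upd: "okr rg \<Longrightarrow> r \<notin> {0, 1, 5} \<Longrightarrow> v < 2 ^ W \<Longrightarrow> okr (rg(r := v))"
  by (auto simp: okr_def)

lemma set_out:
  assumes "okr rg" "oko out" "readable (mem_of rg c out) a" "readable (mem_of rg c out) e" "depth a < 79" "depth e < 79"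
    and "valex (mem_of rg c out) a = aO k q + i" "i < 2 * k"
    and "valex (mem_of rg c out) e = v" "v < 2 ^ (q + 1)" "scost a e \<le> query_cost"
  shows "runm qB (Store a e) (mem_of rg c out, \<omega>) (mem_of rg c (out(i := v)), \<omega>)" "oko (out(i := v))"
proof -
  show "runm qB (Store a e) (mem_of rg c out, \<omega>) (mem_of rg c (out(i := v)), \<omega>)"
    unfolding qB_def
  proof (rule fit_Store[OF fit_st[OF assms(1,2)] assms(3,4,5,6) _ _ assms(11)])
    show "valex (mem_of rg c out) a \<notin> {20..<100}" unfolding assms(7) by (simp add: aO_def aC_def aX_def)
    show "mem_of rg c (out(i := v)) = (mem_of rg c out)(valex (mem_of rg c out) a := valex (mem_of rg c out) e)"
      unfolding assms(7,9) by (rule memory_write(5)[symmetric, OF assms(8)])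
  qed
  show "oko (out(i := v))" using assms(2,10) by (auto simp: oko_def)
qed

lemma query_loop:
  assumes "\<And>i s \<omega>'. J i s \<omega>' \<Longrightarrow> i \<le> m \<Longrightarrow> \<exists>rg out. s = mem_of rg c out \<and> okr rg \<and> oko out
      \<and> readable s e \<and> (valex s e \<noteq> 0 \<longleftrightarrow> i < m)"
    and "\<And>i s \<omega>'. J i s \<omega>' \<Longrightarrow> i < m \<Longrightarrow> \<exists>s' \<omega>''. runm qB b (s, \<omega>') (s', \<omega>'') \<and> J (Suc i) s' \<omega>''"
    and "depth e < 79" "ecost e + sz e + 4 \<le> query_cost" and J: "J 0 s \<omega>"
  shows "\<exists>s' \<omega>'. runm qB (WhileE e b) (s, \<omega>) (s', \<omega>') \<and> J m s' \<omega>'"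
  unfolding qB_def
proof (rule fit_WhileE[where J = J])
  fix i s \<omega>' assume "J i s \<omega>'" "i \<le> m"
  from assms(1)[OF this] show "fit W (cap W) s \<and> readable s e \<and> (valex s e \<noteq> 0 \<longleftrightarrow> i < m)"
    using fit_st by blast
qed (use assms in \<open>auto simp: qB_def\<close>)

text \<open>All \<open>k\<close> digits are decoded even after a failure, since the flag only
  accumulates a conjunction. After \<open>i\<close> rounds register 9 has lost \<open>i\<close>
  digits.\<close>

lemma decode_correct:
  fixes x :: nat
  assumes r0: "okr rg0" "oko out0" "rg0 8 = 0" "rg0 9 = x" "rg0 10 = 1"
  shows "\<exists>rg out. runm qB q_dec (mem_of rg0 c out0, \<omega>) (mem_of rg c out, \<omega>) \<and> okr rg \<and> oko out
    \<and> (\<forall>r. r \<notin> {8, 9, 10} \<longrightarrow> rg r = rg0 r)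
    \<and> rg 10 = of_bool (\<forall>i<k. c (digit (cN k q) x i) div n ^ 4 = 1)
    \<and> (\<forall>m<2 * k. out m = endpt c n (cN k q) x m)"
proof -
  let ?N = "cN k q"
  let ?J = "\<lambda>i s \<omega>'. \<omega>' = \<omega> \<and> (\<exists>rg out. s = mem_of rg c out \<and> okr rg \<and> oko out
    \<and> (\<forall>r. r \<notin> {8, 9, 10} \<longrightarrow> rg r = rg0 r) \<and> rg 8 = i \<and> rg 9 = x div ?N ^ i
    \<and> rg 10 = of_bool (\<forall>i'<i. c (digit ?N x i') div n ^ 4 = 1) \<and> (\<forall>m<2 * i. out m = endpt c n ?N x m))"
  have "\<exists>s' \<omega>'. runm qB q_dec (mem_of rg0 c out0, \<omega>) (s', \<omega>') \<and> ?J k s' \<omega>'"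
    unfolding q_dec_def
  proof (rule query_loop[where J = ?J])
    fix i s \<omega>' assume J: "?J i s \<omega>'" "i \<le> k"
    then obtain rg out where s: "s = mem_of rg c out" "okr rg" "oko out" "rg 8 = i" by blast
    have "readable s (Rg 8 <\<^sub>e Rg 1)" by simp
    moreover have "valex s (Rg 8 <\<^sub>e Rg 1) \<noteq> 0 \<longleftrightarrow> i < k"
      unfolding valex.simps bop.simps s(1) st_regs[OF s(2)] by (simp add: memory_read s(4))
    ultimately show "\<exists>rg out. s = mem_of rg c out \<and> okr rg \<and> oko out
      \<and> readable s (Rg 8 <\<^sub>e Rg 1) \<and> (valex s (Rg 8 <\<^sub>e Rg 1) \<noteq> 0 \<longleftrightarrow> i < k)" using s by blast
  next
    fix i s \<omega>' assume J: "?J i s \<omega>'" "i < k"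
    then obtain rg out where s: "s = mem_of rg c out" "okr rg" "oko out" "\<forall>r. r \<notin> {8, 9, 10} \<longrightarrow> rg r = rg0 r"
      "rg 8 = i" "rg 9 = x div ?N ^ i" "rg 10 = of_bool (\<forall>i'<i. c (digit ?N x i') div n ^ 4 = 1)"
      "\<forall>m<2 * i. out m = endpt c n ?N x m" by blast
    let ?d = "c (digit ?N x i)"
    have dig: "rg 9 mod ?N = digit ?N x i" by (simp add: s(6) digit_def)
    let ?v1 = "of_bool (\<forall>i'<Suc i. c (digit ?N x i') div n ^ 4 = 1) :: nat"
    let ?rg1 = "rg(10 := ?v1)"
    have e1: "valex (mem_of rg c out) eOk1 = ?v1"
    proof -
      have "valex (mem_of rg c out) eOk1 = rg 10 * of_bool (?d div n ^ 4 = 1)"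
        unfolding eOk1_def valex.simps(4) bop.simps ev_eEq ev_st[OF s(2)] dig by (simp add: memory_read)
      then show ?thesis by (auto simp: s(7) less_Suc_eq)
    qed
    have "1 < (2::nat) ^ W" using q_le_W by (intro one_less_power) auto
    then have v1: "?v1 < 2 ^ W" by simp
    note a1 = set_reg[OF s(2,3) readable_st(4)[OF s(2)] depth_query(4) _ _ e1 v1, of 10]
    have a1: "runm qB (Store (Nm 10) eOk1) (mem_of rg c out, \<omega>) (mem_of ?rg1 c out, \<omega>)" "okr ?rg1"
      by (rule a1; simp add: query_cost_def)+
    have d: "?d mod n ^ 4 div n < 2 ^ (q + 1)" "?d mod n ^ 4 mod n < 2 ^ (q + 1)"
    proof -
      have "?d mod n ^ 4 \<le> ?d" by simp
      moreover have "?d < 2 ^ (q + 1)" using c[of "digit ?N x i"] by simp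
      ultimately have "?d mod n ^ 4 < 2 ^ (q + 1)" by linarith
      then show "?d mod n ^ 4 div n < 2 ^ (q + 1)" "?d mod n ^ 4 mod n < 2 ^ (q + 1)"
        by (meson div_le_dividend mod_less_eq_dividend le_less_trans)+
    qed
    have dig1: "?rg1 9 mod ?N = digit ?N x i" using dig by simp
    let ?out1 = "out(2 * i := ?d mod n ^ 4 div n)"
    have e2: "valex (mem_of ?rg1 c out) eFst = ?d mod n ^ 4 div n"
      unfolding eFst_def valex.simps(2,4) bop.simps ev_st[OF a1(2)] dig1 st_regs[OF a1(2)] ..
    have o2: "valex (mem_of ?rg1 c out) eOut = aO k q + 2 * i" unfolding ev_st[OF a1(2)] by (simp add: s(5))
    have a2: "runm qB (Store eOut eFst) (mem_of ?rg1 c out, \<omega>) (mem_of ?rg1 c ?out1, \<omega>)" "oko ?out1"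
      by (rule set_out[OF a1(2) s(3) readable_st(3)[OF a1(2)] readable_st(5)[OF a1(2)] _ depth_query(5) o2 _ e2 d(1)];
        use J(2) depth_query(3) in \<open>simp add: query_cost_def\<close>)+
    let ?out2 = "?out1(2 * i + 1 := ?d mod n ^ 4 mod n)"
    have e3: "valex (mem_of ?rg1 c ?out1) eSnd = ?d mod n ^ 4 mod n"
      unfolding eSnd_def valex.simps(2,4) bop.simps ev_st[OF a1(2)] dig1 st_regs[OF a1(2)] ..
    have o3: "valex (mem_of ?rg1 c ?out1) (eOut +\<^sub>e Nm 1) = aO k q + (2 * i + 1)"
      unfolding valex.simps(1,4) bop.simps ev_st[OF a1(2)] by (simp add: s(5))
    have r3: "readable (mem_of ?rg1 c ?out1) (eOut +\<^sub>e Nm 1)" using readable_st(3)[OF a1(2)] by simp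
    have a3: "runm qB (Store (eOut +\<^sub>e Nm 1) eSnd) (mem_of ?rg1 c ?out1, \<omega>) (mem_of ?rg1 c ?out2, \<omega>)" "oko ?out2"
      by (rule set_out[OF a1(2) a2(2) r3 readable_st(6)[OF a1(2)] _ depth_query(6) o3 _ e3 d(2)];
        use J(2) depth_query(3) in \<open>simp add: query_cost_def\<close>)+
    let ?rg2 = "?rg1(9 := x div ?N ^ Suc i)"
    have e4: "valex (mem_of ?rg1 c ?out2) (Rg 9 div\<^sub>e eN) = x div ?N ^ Suc i"
      unfolding valex.simps(2,4) bop.simps ev_st[OF a1(2)] by (simp add: memory_read s(6) div_mult2_eq[symmetric] mult.commute)
    have v4: "x div ?N ^ Suc i < 2 ^ W"
    proof -
      have "x < 2 ^ W" using r0(1,4) unfolding okr_def by metis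
      then show ?thesis by (meson div_le_dividend le_less_trans)
    qed
    have r4: "readable (mem_of ?rg1 c ?out2) (Rg 9 div\<^sub>e eN)" using readable_st(1)[OF a1(2)] by simp
    have a4: "runm qB (Store (Nm 9) (Rg 9 div\<^sub>e eN)) (mem_of ?rg1 c ?out2, \<omega>) (mem_of ?rg2 c ?out2, \<omega>)" "okr ?rg2"
      by (rule set_reg[OF a1(2) a3(2) r4 _ _ _ e4 v4]; use depth_query(10) in \<open>simp add: query_cost_def\<close>)+
    let ?rg3 = "?rg2(8 := Suc i)"
    have e5: "valex (mem_of ?rg2 c ?out2) (Rg 8 +\<^sub>e Nm 1) = Suc i" by (simp add: memory_read s(5))
    have "i < 2 ^ q" using J(2) k_le_n n_less by simp
    then have "Suc i < 2 ^ (q + 1)" by simp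
    then have v5: "Suc i < 2 ^ W" by (rule less_W)
    have a5: "runm qB (Store (Nm 8) (Rg 8 +\<^sub>e Nm 1)) (mem_of ?rg2 c ?out2, \<omega>) (mem_of ?rg3 c ?out2, \<omega>)" "okr ?rg3"
      by (rule set_reg[OF a4(2) a3(2) _ _ _ _ e5 v5]; simp add: query_cost_def)+
    have out: "\<forall>m<2 * Suc i. ?out2 m = endpt c n ?N x m"
    proof (intro allI impI)
      fix m assume "m < 2 * Suc i"
      then have "m < 2 * i \<or> m = 2 * i \<or> m = 2 * i + 1" by presburger
      then consider "m < 2 * i" | "m = 2 * i" | "m = 2 * i + 1" by blast
      then show "?out2 m = endpt c n ?N x m" by cases (use s(8) in \<open>auto simp: endpt_def\<close>)
    qed
    show "\<exists>s' \<omega>''. runm qB (Seq (Store (Nm 10) eOk1) (Seq (Store eOut eFst)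
     (Seq (Store (eOut +\<^sub>e Nm 1) eSnd) (Seq (Store (Nm 9) (Rg 9 div\<^sub>e eN)) (Store (Nm 8) (Rg 8 +\<^sub>e Nm 1)))))) (s, \<omega>') (s', \<omega>'')
      \<and> ?J (Suc i) s' \<omega>''"
    proof (intro exI conjI)
      show "runm qB (Seq (Store (Nm 10) eOk1) (Seq (Store eOut eFst)
     (Seq (Store (eOut +\<^sub>e Nm 1) eSnd) (Seq (Store (Nm 9) (Rg 9 div\<^sub>e eN)) (Store (Nm 8) (Rg 8 +\<^sub>e Nm 1)))))) (s, \<omega>') (mem_of ?rg3 c ?out2, \<omega>)"
        unfolding conjunct1[OF J(1)] s(1)
        by (rule runm_Seq[OF a1(1) runm_Seq[OF a2(1) runm_Seq[OF a3(1) runm_Seq[OF a4(1) a5(1)]]]])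
      show "okr ?rg3" by (rule a5(2))
      show "oko ?out2" by (rule a3(2))
      show "\<forall>m<2 * Suc i. ?out2 m = endpt c n ?N x m" by (rule out)
    qed (use s(4) in auto)
  next
    show "?J 0 (mem_of rg0 c out0) \<omega>"
      using r0 by (intro conjI refl exI[of _ rg0] exI[of _ out0]) auto
  qed (simp_all add: query_cost_def)
  then obtain s' \<omega>' where j: "runm qB q_dec (mem_of rg0 c out0, \<omega>) (s', \<omega>')" "?J k s' \<omega>'" by blast
  from j(2) obtain rg out where s: "s' = mem_of rg c out" "okr rg" "oko out" "\<forall>r. r \<notin> {8, 9, 10} \<longrightarrow> rg r = rg0 r"
      "rg 10 = of_bool (\<forall>i'<k. c (digit ?N x i') div n ^ 4 = 1)"
      "\<forall>m<2 * k. out m = endpt c n ?N x m" by blast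
  show ?thesis using j(1) s conjunct1[OF j(2)] by blast
qed

lemma check_correct:
  assumes r0: "okr rg0" "oko out" "rg0 8 = 0" "rg0 10 = of_bool P"
  shows "\<exists>rg. runm qB q_chk (mem_of rg0 c out, \<omega>) (mem_of rg c out, \<omega>) \<and> okr rg
    \<and> (\<forall>r. r \<notin> {8, 10} \<longrightarrow> rg r = rg0 r) \<and> rg 10 = of_bool (P \<and> inj_on out {..<2 * k})"
proof -
  let ?m = "2 * k"
  let ?bad = "\<lambda>z. z div ?m < z mod ?m \<and> out (z div ?m) = out (z mod ?m)"
  let ?J = "\<lambda>i s \<omega>'. \<omega>' = \<omega> \<and> (\<exists>rg. s = mem_of rg c out \<and> okr rg
    \<and> (\<forall>r. r \<notin> {8, 10} \<longrightarrow> rg r = rg0 r) \<and> rg 8 = i \<and> rg 10 = of_bool (P \<and> (\<forall>z<i. \<not> ?bad z)))"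
  have "\<exists>s' \<omega>'. runm qB q_chk (mem_of rg0 c out, \<omega>) (s', \<omega>') \<and> ?J (?m * ?m) s' \<omega>'"
    unfolding q_chk_def
  proof (rule query_loop[where J = ?J])
    fix i s \<omega>' assume J: "?J i s \<omega>'" "i \<le> ?m * ?m"
    then obtain rg where s: "s = mem_of rg c out" "okr rg" "rg 8 = i" by blast
    have "readable s (Rg 8 <\<^sub>e eEnd)" using readable_st(8)[OF s(2)] s(1) by simp
    moreover have "valex s (Rg 8 <\<^sub>e eEnd) \<noteq> 0 \<longleftrightarrow> i < ?m * ?m"
      unfolding valex.simps(2,4) bop.simps s(1) ev_st[OF s(2)] by (simp add: memory_read s(3))
    ultimately show "\<exists>rg out. s = mem_of rg c out \<and> okr rg \<and> oko out
      \<and> readable s (Rg 8 <\<^sub>e eEnd) \<and> (valex s (Rg 8 <\<^sub>e eEnd) \<noteq> 0 \<longleftrightarrow> i < ?m * ?m)" using s r0(2) by blast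
  next
    fix i s \<omega>' assume J: "?J i s \<omega>'" "i < ?m * ?m"
    then obtain rg where s: "s = mem_of rg c out" "okr rg" "\<forall>r. r \<notin> {8, 10} \<longrightarrow> rg r = rg0 r" "rg 8 = i"
      "rg 10 = of_bool (P \<and> (\<forall>z<i. \<not> ?bad z))" by blast
    let ?v = "of_bool (P \<and> (\<forall>z<Suc i. \<not> ?bad z)) :: nat"
    have "?m > 0" using k by simp
    then have ab: "i div ?m < ?m" "i mod ?m < ?m" using J(2) by (auto simp: less_mult_imp_div_less)
    have e1: "valex (mem_of rg c out) eOk2 = ?v"
    proof -
      have "valex (mem_of rg c out) eOk2 = rg 10 * (1 - of_bool (?bad i))"
        unfolding eOk2_def valex.simps bop.simps ev_eEq ev_st[OF s(2)] s(4) memory_read(5)[OF ab(1)] memory_read(5)[OF ab(2)]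
        by (simp add: memory_read)
      then show ?thesis by (auto simp: s(5) less_Suc_eq)
    qed
    have "1 < (2::nat) ^ W" using q_le_W by (intro one_less_power) auto
    then have v1: "?v < 2 ^ W" by simp
    let ?rg1 = "rg(10 := ?v)"
    have a1: "runm qB (Store (Nm 10) eOk2) (mem_of rg c out, \<omega>) (mem_of ?rg1 c out, \<omega>)" "okr ?rg1"
      by (rule set_reg[OF s(2) r0(2) readable_st(7)[OF s(2)] depth_query(7) _ _ e1 v1]; simp add: query_cost_def)+
    let ?rg2 = "?rg1(8 := Suc i)"
    have e2: "valex (mem_of ?rg1 c out) (Rg 8 +\<^sub>e Nm 1) = Suc i" by (simp add: memory_read s(4))
    have v2: "Suc i < 2 ^ W" using J(2) square_less by simp
    have a2: "runm qB (Store (Nm 8) (Rg 8 +\<^sub>e Nm 1)) (mem_of ?rg1 c out, \<omega>) (mem_of ?rg2 c out, \<omega>)" "okr ?rg2"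
      by (rule set_reg[OF a1(2) r0(2) _ _ _ _ e2 v2]; simp add: query_cost_def)+
    show "\<exists>s' \<omega>''. runm qB (Seq (Store (Nm 10) eOk2) (Store (Nm 8) (Rg 8 +\<^sub>e Nm 1))) (s, \<omega>') (s', \<omega>'') \<and> ?J (Suc i) s' \<omega>''"
    proof (intro exI conjI)
      show "runm qB (Seq (Store (Nm 10) eOk2) (Store (Nm 8) (Rg 8 +\<^sub>e Nm 1))) (s, \<omega>') (mem_of ?rg2 c out, \<omega>)"
        unfolding conjunct1[OF J(1)] s(1) by (rule runm_Seq[OF a1(1) a2(1)])
      show "okr ?rg2" by (rule a2(2))
    qed (use s(3) in auto)
  next
    show "?J 0 (mem_of rg0 c out) \<omega>" using r0 by (intro conjI refl exI[of _ rg0]) auto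
    show "depth (Rg 8 <\<^sub>e eEnd) < 79" using depth_query(8) by simp
  qed (simp_all add: query_cost_def)
  then obtain s' \<omega>' where j: "runm qB q_chk (mem_of rg0 c out, \<omega>) (s', \<omega>')" "?J (?m * ?m) s' \<omega>'" by blast
  from j(2) obtain rg where s: "s' = mem_of rg c out" "okr rg" "\<forall>r. r \<notin> {8, 10} \<longrightarrow> rg r = rg0 r"
      "rg 10 = of_bool (P \<and> (\<forall>z<?m * ?m. \<not> ?bad z))" by blast
  show ?thesis using j(1) s conjunct1[OF j(2)] unfolding inj_on_lessThan_square by blast
qed

lemma try_correct:
  assumes r0: "okr rg0" "oko out0" and x: "rg0 7 = x" "x < cN k q ^ k"
  shows "\<exists>rg out. runm qB q_try (mem_of rg0 c out0, \<omega>) (mem_of rg c out, \<omega>) \<and> okr rg \<and> oko out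
    \<and> (\<forall>r. r \<notin> {7, 8, 9, 10} \<longrightarrow> rg r = rg0 r) \<and> rg 7 = Suc x
    \<and> rg 10 = of_bool (found c n k (cN k q) x) \<and> (\<forall>m<2 * k. out m = endpt c n (cN k q) x m)"
proof -
  let ?N = "cN k q"
  have one: "1 < (2::nat) ^ W" using q_le_W by (intro one_less_power) auto
  have x': "x < 2 ^ W" using x(2) cN_power_less[of k] by simp
  have a1: "runm qB (Store (Nm 10) (Nm 1)) (mem_of rg0 c out0, \<omega>) (mem_of (rg0(10 := 1)) c out0, \<omega>)" "okr (rg0(10 := 1))"
    by (rule set_reg(1)[OF r0 _ _ _ _ _ one], simp_all add: query_cost_def del: One_nat_def) (rule okr_upd[OF r0(1) _ one], simp_all)
  have a2: "runm qB (Store (Nm 9) (Rg 7)) (mem_of (rg0(10 := 1)) c out0, \<omega>) (mem_of (rg0(10 := 1, 9 := x)) c out0, \<omega>)"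
    "okr (rg0(10 := 1, 9 := x))"
    by (rule set_reg(1)[OF a1(2) r0(2) _ _ _ _ _ x'], simp_all add: query_cost_def memory_read x(1) del: One_nat_def) (rule okr_upd[OF a1(2) _ x'], simp_all)
  have a3: "runm qB (Store (Nm 8) (Nm 0)) (mem_of (rg0(10 := 1, 9 := x)) c out0, \<omega>) (mem_of (rg0(10 := 1, 9 := x, 8 := 0)) c out0, \<omega>)"
    "okr (rg0(10 := 1, 9 := x, 8 := 0))"
    by (rule set_reg(1)[OF a2(2) r0(2)], simp_all add: query_cost_def del: One_nat_def) (rule okr_upd[OF a2(2)], simp_all)
  obtain rg1 out where d: "runm qB q_dec (mem_of (rg0(10 := 1, 9 := x, 8 := 0)) c out0, \<omega>) (mem_of rg1 c out, \<omega>)"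
    "okr rg1" "oko out" "\<forall>r. r \<notin> {8, 9, 10} \<longrightarrow> rg1 r = (rg0(10 := 1, 9 := x, 8 := 0)) r"
    "rg1 10 = of_bool (\<forall>i<k. c (digit ?N x i) div n ^ 4 = 1)" "\<forall>m<2 * k. out m = endpt c n ?N x m"
    using decode_correct[OF a3(2) r0(2), of x \<omega>] by auto
  let ?P = "\<forall>i<k. c (digit ?N x i) div n ^ 4 = 1"
  have a4: "runm qB (Store (Nm 8) (Nm 0)) (mem_of rg1 c out, \<omega>) (mem_of (rg1(8 := 0)) c out, \<omega>)" "okr (rg1(8 := 0))"
    by (rule set_reg(1)[OF d(2,3)], simp_all add: query_cost_def del: One_nat_def) (rule okr_upd[OF d(2)], simp_all)
  obtain rg2 where e: "runm qB q_chk (mem_of (rg1(8 := 0)) c out, \<omega>) (mem_of rg2 c out, \<omega>)" "okr rg2"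
    "\<forall>r. r \<notin> {8, 10} \<longrightarrow> rg2 r = (rg1(8 := 0)) r" "rg2 10 = of_bool (?P \<and> inj_on out {..<2 * k})"
    using check_correct[OF a4(2) d(3), of ?P \<omega>] d(5) by auto
  have inj: "inj_on out {..<2 * k} \<longleftrightarrow> inj_on (endpt c n ?N x) {..<2 * k}"
    using d(6) by (intro inj_on_cong) auto
  have r7: "rg2 7 = x" using e(3) d(4) x(1) by simp
  have sx: "Suc x < 2 ^ W"
  proof -
    have "?N ^ k \<le> (2 ^ q) ^ k" using cN_less by (intro power_mono) auto
    also have "\<dots> = 2 ^ (q * k)" by (simp add: power_mult)
    also have "\<dots> < 2 ^ W" unfolding W_def by (intro power_strict_increasing) auto
    finally show ?thesis using x(2) by simp
  qed
  have a5: "runm qB (Store (Nm 7) (Rg 7 +\<^sub>e Nm 1)) (mem_of rg2 c out, \<omega>) (mem_of (rg2(7 := Suc x)) c out, \<omega>)"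
    "okr (rg2(7 := Suc x))"
    by (rule set_reg(1)[OF e(2) d(3) _ _ _ _ _ sx], simp_all add: query_cost_def memory_read r7 del: One_nat_def) (rule okr_upd[OF e(2) _ sx], simp_all)
  show ?thesis
  proof (intro exI conjI)
    show "runm qB q_try (mem_of rg0 c out0, \<omega>) (mem_of (rg2(7 := Suc x)) c out, \<omega>)"
      unfolding q_try_def
      by (rule runm_Seq[OF a1(1) runm_Seq[OF a2(1) runm_Seq[OF a3(1) runm_Seq[OF d(1) runm_Seq[OF a4(1) runm_Seq[OF e(1) a5(1)]]]]]])
    show "okr (rg2(7 := Suc x))" by (rule a5(2))
    show "oko out" by (rule d(3))
    show "\<forall>r. r \<notin> {7, 8, 9, 10} \<longrightarrow> (rg2(7 := Suc x)) r = rg0 r" using e(3) d(4) by simp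
    show "(rg2(7 := Suc x)) 10 = of_bool (found c n k ?N x)" using e(4) inj by (simp add: found_def)
  qed (use d(6) in auto)
qed

lemma query_correct:
  assumes r0: "okr rg0" "oko out0"
  shows "\<exists>s'. runm qB query (mem_of rg0 c out0, \<omega>) (s', \<omega>)
    \<and> (if \<exists>x<cN k q ^ k. found c n k (cN k q) x
       then \<exists>x. found c n k (cN k q) x \<and> output_edges s'
         = {{endpt c n (cN k q) x (2 * i), endpt c n (cN k q) x (2 * i + 1)} | i. i < k}
       else output_edges s' = {})"
proof -
  let ?N = "cN k q"
  let ?F = "found c n k ?N"
  have one: "1 < (2::nat) ^ W" using q_le_W by (intro one_less_power) auto
  have a1: "runm qB (Store (Nm 11) (Nm 1)) (mem_of rg0 c out0, \<omega>) (mem_of (rg0(11 := 1)) c out0, \<omega>)" "okr (rg0(11 := 1))"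
    by (rule set_reg(1)[OF r0 _ _ _ _ _ one], simp_all add: query_cost_def del: One_nat_def) (rule okr_upd[OF r0(1) _ one], simp_all)
  have a2: "runm qB (Store (Nm 8) (Nm 0)) (mem_of (rg0(11 := 1)) c out0, \<omega>) (mem_of (rg0(11 := 1, 8 := 0)) c out0, \<omega>)"
    "okr (rg0(11 := 1, 8 := 0))"
    by (rule set_reg(1)[OF a1(2) r0(2)], simp_all add: query_cost_def del: One_nat_def) (rule okr_upd[OF a1(2)], simp_all)
  let ?J = "\<lambda>i s \<omega>'. \<omega>' = \<omega> \<and> (\<exists>rg. s = mem_of rg c out0 \<and> okr rg \<and> rg 8 = i \<and> rg 11 = ?N ^ i)"
  have "\<exists>s' \<omega>'. runm qB q_pow (mem_of (rg0(11 := 1, 8 := 0)) c out0, \<omega>) (s', \<omega>') \<and> ?J k s' \<omega>'"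
    unfolding q_pow_def
  proof (rule query_loop[where J = ?J])
    fix i s \<omega>' assume J: "?J i s \<omega>'" "i \<le> k"
    then obtain rg where s: "s = mem_of rg c out0" "okr rg" "rg 8 = i" by blast
    have "readable s (Rg 8 <\<^sub>e Rg 1)" by simp
    moreover have "valex s (Rg 8 <\<^sub>e Rg 1) \<noteq> 0 \<longleftrightarrow> i < k"
      unfolding valex.simps bop.simps s(1) st_regs[OF s(2)] by (simp add: memory_read s(3))
    ultimately show "\<exists>rg out. s = mem_of rg c out \<and> okr rg \<and> oko out
      \<and> readable s (Rg 8 <\<^sub>e Rg 1) \<and> (valex s (Rg 8 <\<^sub>e Rg 1) \<noteq> 0 \<longleftrightarrow> i < k)" using s r0(2) by blast
  next
    fix i s \<omega>' assume J: "?J i s \<omega>'" "i < k"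
    then obtain rg where s: "s = mem_of rg c out0" "okr rg" "rg 8 = i" "rg 11 = ?N ^ i" by blast
    have e1: "valex (mem_of rg c out0) (Rg 11 *\<^sub>e eN) = ?N ^ Suc i"
      unfolding valex.simps(2,4) bop.simps ev_st[OF s(2)] by (simp add: memory_read s(4))
    have v1: "?N ^ Suc i < 2 ^ W" using J(2) by (intro cN_power_less) simp
    have rd: "readable (mem_of rg c out0) (Rg 11 *\<^sub>e eN)" using readable_st(1)[OF s(2)] by simp
    have b1: "runm qB (Store (Nm 11) (Rg 11 *\<^sub>e eN)) (mem_of rg c out0, \<omega>) (mem_of (rg(11 := ?N ^ Suc i)) c out0, \<omega>)"
      "okr (rg(11 := ?N ^ Suc i))"
      by (rule set_reg[OF s(2) r0(2) rd _ _ _ e1 v1]; use depth_query(10) in \<open>simp add: query_cost_def\<close>)+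
    have "i < 2 ^ q" using J(2) k_le_n n_less by simp
    then have "Suc i < 2 ^ (q + 1)" by simp
    then have v2: "Suc i < 2 ^ W" by (rule less_W)
    have b2: "runm qB (Store (Nm 8) (Rg 8 +\<^sub>e Nm 1)) (mem_of (rg(11 := ?N ^ Suc i)) c out0, \<omega>) (mem_of (rg(11 := ?N ^ Suc i, 8 := Suc i)) c out0, \<omega>)"
      "okr (rg(11 := ?N ^ Suc i, 8 := Suc i))"
      by (rule set_reg(1)[OF b1(2) r0(2) _ _ _ _ _ v2], simp_all add: query_cost_def memory_read s(3) del: One_nat_def power_Suc) (rule okr_upd[OF b1(2) _ v2], simp_all)
    show "\<exists>s' \<omega>''. runm qB (Seq (Store (Nm 11) (Rg 11 *\<^sub>e eN)) (Store (Nm 8) (Rg 8 +\<^sub>e Nm 1))) (s, \<omega>') (s', \<omega>'') \<and> ?J (Suc i) s' \<omega>''"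
    proof (intro exI conjI)
      show "runm qB (Seq (Store (Nm 11) (Rg 11 *\<^sub>e eN)) (Store (Nm 8) (Rg 8 +\<^sub>e Nm 1))) (s, \<omega>') (mem_of (rg(11 := ?N ^ Suc i, 8 := Suc i)) c out0, \<omega>)"
        unfolding conjunct1[OF J(1)] s(1) by (rule runm_Seq[OF b1(1) b2(1)])
      show "okr (rg(11 := ?N ^ Suc i, 8 := Suc i))" by (rule b2(2))
    qed auto
  next
    show "?J 0 (mem_of (rg0(11 := 1, 8 := 0)) c out0) \<omega>" using a2(2) by (intro conjI refl exI[of _ "rg0(11 := 1, 8 := 0)"]) auto
  qed (simp_all add: query_cost_def)
  then obtain s1 \<omega>1 where j: "runm qB q_pow (mem_of (rg0(11 := 1, 8 := 0)) c out0, \<omega>) (s1, \<omega>1)" "?J k s1 \<omega>1" by blast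
  then obtain rg1 where s1: "s1 = mem_of rg1 c out0" "okr rg1" "rg1 11 = ?N ^ k" by blast
  have a3: "runm qB q_pow (mem_of (rg0(11 := 1, 8 := 0)) c out0, \<omega>) (mem_of rg1 c out0, \<omega>)"
    using j(1) unfolding s1(1) conjunct1[OF j(2)] .
  have a4: "runm qB (Store (Nm 7) (Nm 0)) (mem_of rg1 c out0, \<omega>) (mem_of (rg1(7 := 0)) c out0, \<omega>)" "okr (rg1(7 := 0))"
    by (rule set_reg(1)[OF s1(2) r0(2)], simp_all add: query_cost_def del: One_nat_def) (rule okr_upd[OF s1(2)], simp_all)
  let ?r = "rg1(7 := 0, 10 := 0)"
  have a5: "runm qB (Store (Nm 10) (Nm 0)) (mem_of (rg1(7 := 0)) c out0, \<omega>) (mem_of ?r c out0, \<omega>)" "okr ?r"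
    by (rule set_reg(1)[OF a4(2) r0(2)], simp_all add: query_cost_def del: One_nat_def) (rule okr_upd[OF a4(2)], simp_all)
  \<comment> \<open>The number of rounds: the loop stops right after the least successful candidate,
    or after all of them.\<close>
  define m where "m = (if \<exists>x<?N ^ k. ?F x then Suc (LEAST x. ?F x) else ?N ^ k)"
  have m: "i < ?N ^ k \<and> \<not> (i > 0 \<and> ?F (i - 1)) \<longleftrightarrow> i < m" if "i \<le> m" for i
  proof (cases "\<exists>x<?N ^ k. ?F x")
    case True
    then obtain x where x: "x < ?N ^ k" "?F x" by blast
    let ?x = "LEAST x. ?F x"
    have F: "?F ?x" "?x \<le> x" using x by (auto intro: LeastI Least_le)
    have m: "m = Suc ?x" using True by (simp add: m_def)
    show ?thesis
    proof (cases "i = m")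
      case True
      then show ?thesis using F m by simp
    next
      case False
      then have "i \<le> ?x" using that m by simp
      moreover have "\<not> (i > 0 \<and> ?F (i - 1))" using \<open>i \<le> ?x\<close> not_less_Least[of "i - 1" ?F] by linarith
      ultimately show ?thesis using F x m by auto
    qed
  next
    case False
    then have m: "m = ?N ^ k" by (auto simp: m_def)
    show ?thesis using False that unfolding m by auto
  qed
  \<comment> \<open>After \<open>i\<close> rounds the flag and the output array belong to candidate
    \<open>i - 1\<close>; the guard \<open>i > 0\<close> excludes the start, where none has been
    tried.\<close>
  let ?J = "\<lambda>i s \<omega>'. \<omega>' = \<omega> \<and> (\<exists>rg out. s = mem_of rg c out \<and> okr rg \<and> oko out \<and> rg 7 = i \<and> rg 11 = ?N ^ k
     \<and> rg 10 = of_bool (i > 0 \<and> ?F (i - 1)) \<and> (i > 0 \<longrightarrow> (\<forall>m<2 * k. out m = endpt c n ?N (i - 1) m)))"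
  have "\<exists>s' \<omega>'. runm qB (WhileE eGo q_try) (mem_of ?r c out0, \<omega>) (s', \<omega>') \<and> ?J m s' \<omega>'"
  proof (rule query_loop[where J = ?J])
    fix i s \<omega>' assume J: "?J i s \<omega>'" "i \<le> m"
    then obtain rg out where s: "s = mem_of rg c out" "okr rg" "oko out" "rg 7 = i" "rg 11 = ?N ^ k"
      "rg 10 = of_bool (i > 0 \<and> ?F (i - 1))" by blast
    have "valex s eGo \<noteq> 0 \<longleftrightarrow> i < ?N ^ k \<and> \<not> (i > 0 \<and> ?F (i - 1))"
      unfolding eGo_def s(1) by (simp add: memory_read s(4,5,6))
    then show "\<exists>rg out. s = mem_of rg c out \<and> okr rg \<and> oko out
      \<and> readable s eGo \<and> (valex s eGo \<noteq> 0 \<longleftrightarrow> i < m)" using s(1,2,3) m[OF J(2)] readable_st(9)[OF s(2)] by blast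
  next
    fix i s \<omega>' assume J: "?J i s \<omega>'" "i < m"
    then obtain rg out where s: "s = mem_of rg c out" "okr rg" "oko out" "rg 7 = i" "rg 11 = ?N ^ k" by blast
    have "i < ?N ^ k" using m[of i] J(2) by simp
    from try_correct[OF s(2,3,4) this, of \<omega>] obtain rg' out' where t:
      "runm qB q_try (mem_of rg c out, \<omega>) (mem_of rg' c out', \<omega>)" "okr rg'" "oko out'"
      "\<forall>r. r \<notin> {7, 8, 9, 10} \<longrightarrow> rg' r = rg r" "rg' 7 = Suc i" "rg' 10 = of_bool (?F i)"
      "\<forall>m<2 * k. out' m = endpt c n ?N i m" by blast
    have "?J (Suc i) (mem_of rg' c out') \<omega>"
      using t s(5) by (intro conjI refl exI[of _ rg'] exI[of _ out']) auto
    moreover have "runm qB q_try (s, \<omega>') (mem_of rg' c out', \<omega>)" unfolding s(1) conjunct1[OF J(1)] by (rule t(1))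
    ultimately show "\<exists>s' \<omega>''. runm qB q_try (s, \<omega>') (s', \<omega>'') \<and> ?J (Suc i) s' \<omega>''" by blast
  next
    show "?J 0 (mem_of ?r c out0) \<omega>" using a5(2) r0(2) s1(3) by (intro conjI refl exI[of _ ?r] exI[of _ out0]) auto
  qed (use depth_query in \<open>simp_all add: query_cost_def\<close>)
  then obtain s2 \<omega>2 where "runm qB (WhileE eGo q_try) (mem_of ?r c out0, \<omega>) (s2, \<omega>2) \<and> ?J m s2 \<omega>2"
    by (elim exE) (rule that)
  note j2 = conjunct1[OF this] conjunct1[OF conjunct2[OF this]] conjunct2[OF conjunct2[OF this]]
  from j2(3) obtain rg2 out where "s2 = mem_of rg2 c out \<and> okr rg2 \<and> oko out \<and> rg2 7 = m \<and> rg2 11 = ?N ^ k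
     \<and> rg2 10 = of_bool (m > 0 \<and> ?F (m - 1)) \<and> (m > 0 \<longrightarrow> (\<forall>r<2 * k. out r = endpt c n ?N (m - 1) r))"
    by (elim exE) (rule that)
  then have s2: "s2 = mem_of rg2 c out" "okr rg2" "oko out"
     "rg2 10 = of_bool (m > 0 \<and> ?F (m - 1))" "m > 0 \<longrightarrow> (\<forall>r<2 * k. out r = endpt c n ?N (m - 1) r)"
    by - (elim conjE, assumption)+
  have a6: "runm qB (WhileE eGo q_try) (mem_of ?r c out0, \<omega>) (mem_of rg2 c out, \<omega>)"
    using j2(1) unfolding s2(1) j2(2) .
  have kW: "k < 2 ^ W" using k_le_n n_less by (intro less_W) simp
  then have v: "rg2 10 * k < 2 ^ W" by (simp add: s2(4))
  have e7: "valex (mem_of rg2 c out) (Rg 10 *\<^sub>e Rg 1) = rg2 10 * k"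
    using s2(2) by (simp add: memory_read okr_def)
  have a7: "runm qB (Store (Nm 2) (Rg 10 *\<^sub>e Rg 1)) (mem_of rg2 c out, \<omega>) (mem_of (rg2(2 := rg2 10 * k)) c out, \<omega>)"
    "okr (rg2(2 := rg2 10 * k))"
    by (rule set_reg[OF s2(2,3) _ _ _ _ e7 v]; simp add: query_cost_def)+
  let ?R = "rg2(2 := rg2 10 * k, 3 := aO k q)"
  have a8: "runm qB (Store (Nm 3) eaO) (mem_of (rg2(2 := rg2 10 * k)) c out, \<omega>) (mem_of ?R c out, \<omega>)"
    by (rule set_reg(1)[OF a7(2) s2(3) readable_st(2)[OF a7(2)] depth_query(2) _ _ ev_st(3)[OF a7(2)] aO_less])
      (simp_all add: query_cost_def)
  have main: "runm qB q_main (mem_of rg0 c out0, \<omega>) (mem_of ?R c out, \<omega>)"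
    unfolding q_main_def
    by (rule runm_Seq[OF a1(1) runm_Seq[OF a2(1) runm_Seq[OF a3 runm_Seq[OF a4(1) runm_Seq[OF a5(1) runm_Seq[OF a6 runm_Seq[OF a7(1) a8]]]]]]])
  have r5: "val (Cell (Dir 5)) (mem_of rg0 c out0) \<noteq> 0" using r0(1) q_pos by (simp add: memory_read okr_def)
  from main obtain t M where "exec q_main (mem_of rg0 c out0, \<omega>) t M (mem_of ?R c out, \<omega>)" "M \<le> qB"
    unfolding runm_def by blast
  then have "runm qB query (mem_of rg0 c out0, \<omega>) (mem_of ?R c out, \<omega>)"
    unfolding runm_def query_def using exec.IfTrue[OF r5] by blast
  moreover have out: "output_edges (mem_of ?R c out) = {{out (2 * i), out (2 * i + 1)} | i. i < rg2 10 * k}"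
  proof -
    have r: "mem_of ?R c out 2 = rg2 10 * k" "mem_of ?R c out 3 = aO k q" by (simp_all add: memory_read)
    have i: "mem_of ?R c out (aO k q + 2 * i) = out (2 * i)" "mem_of ?R c out (aO k q + 2 * i + 1) = out (2 * i + 1)"
      if "i < rg2 10 * k" for i
    proof -
      have "i < k" using that unfolding s2(4) by (cases "m > 0 \<and> ?F (m - 1)") auto
      then show "mem_of ?R c out (aO k q + 2 * i) = out (2 * i)" by (intro memory_read(5)) simp
      show "mem_of ?R c out (aO k q + 2 * i + 1) = out (2 * i + 1)"
        using memory_read(5)[of "2 * i + 1" k q ?R "\<lambda>j. 2 ^ j" X c out] \<open>i < k\<close> by (simp add: add.assoc)
    qed
    show ?thesis unfolding output_edges_def r by (rule setcompr_less_cong) (simp only: i)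
  qed
  moreover have "if \<exists>x<?N ^ k. ?F x then \<exists>x. ?F x \<and> {{out (2 * i), out (2 * i + 1)} | i. i < rg2 10 * k}
         = {{endpt c n ?N x (2 * i), endpt c n ?N x (2 * i + 1)} | i. i < k}
       else {{out (2 * i), out (2 * i + 1)} | i. i < rg2 10 * k} = {}"
  proof (cases "\<exists>x<?N ^ k. ?F x")
    case True
    then have "?F (LEAST x. ?F x)" "m = Suc (LEAST x. ?F x)" by (auto intro: LeastI simp: m_def)
    then have F: "?F (m - 1)" "m > 0" by simp_all
    then have "rg2 10 = 1" by (simp add: s2(4))
    moreover have "out (2 * i) = endpt c n ?N (m - 1) (2 * i)" "out (2 * i + 1) = endpt c n ?N (m - 1) (2 * i + 1)"
      if "i < k" for i using s2(5) F(2) that by auto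
    ultimately have "{{out (2 * i), out (2 * i + 1)} | i. i < rg2 10 * k}
        = {{endpt c n ?N (m - 1) (2 * i), endpt c n ?N (m - 1) (2 * i + 1)} | i. i < k}"
      unfolding \<open>rg2 10 = 1\<close> mult_1 by (intro setcompr_less_cong) simp
    then show ?thesis using True F(1) by auto
  next
    case False
    then have "m = ?N ^ k" by (auto simp: m_def)
    moreover have "?N ^ k > 0" using cN_pos by simp
    ultimately have "\<not> ?F (m - 1)" using False by (metis diff_less zero_less_one)
    then have "rg2 10 = 0" by (simp add: s2(4))
    then show ?thesis using False by auto
  qed
  ultimately show ?thesis by (intro exI[of _ "mem_of ?R c out"]) (simp only: out simp_thms)
qed

end
end

section \<open>Complete runs\<close>

definition matching_alg :: stream_alg where
  "matching_alg = \<lparr>init_prog = init, update_prog = update, query_prog = query\<rparr>"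

lemma legal_updates_graph:
  assumes "graph n E" "legal_update n E x"
  shows "graph n (apply_update E x)"
proof (cases x)
  case (Ins u v)
  have "\<exists>a b. a < b \<and> b < n \<and> {u, v} = {a, b}"
    using assms(2) Ins by (intro exI[of _ "min u v"] exI[of _ "max u v"]) auto
  then show ?thesis using assms Ins by (auto simp: graph_def)
qed (use assms in \<open>auto simp: graph_def\<close>)

lemma legal_update_vertices:
  assumes "graph n E" "legal_update n E x"
  shows "case x of Ins u v \<Rightarrow> u < n \<and> v < n \<and> u \<noteq> v | Del u v \<Rightarrow> u < n \<and> v < n \<and> u \<noteq> v"
proof (cases x)
  case (Del u v)
  then have "{u, v} \<in> E" using assms by simp
  then obtain a b where "a < b" "b < n" "{u, v} = {a, b}" using assms(1) by (auto simp: graph_def)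
  then have "u < n \<and> v < n \<and> u \<noteq> v" by (auto simp: doubleton_eq_iff)
  then show ?thesis using Del by simp
qed (use assms in auto)

lemma graph_stream: "legal_updates n E \<sigma> \<Longrightarrow> graph n E \<Longrightarrow> graph n (foldl apply_update E \<sigma>)"
  by (induction \<sigma> arbitrary: E) (auto intro: legal_updates_graph)

text \<open>Justifies staying idle: \<open>k\<close> disjoint edges cover \<open>2 * k\<close>
  vertices.\<close>

lemma k_matching_size:
  assumes "graph n E" "is_k_matching E k M"
  shows "2 * k \<le> n"
proof -
  have M: "M \<subseteq> E" "pairwise disjnt M" "finite M" "card M = k"
    using assms(2) by (auto simp: is_k_matching_def is_matching_def)
  have e: "card e = 2" "finite e" "e \<subseteq> {..<n}" if "e \<in> M" for e
  proof -
    note m = graph_edge[OF assms(1), of e]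
    have "e \<in> E" using M that by auto
    then show "card e = 2" "finite e" "e \<subseteq> {..<n}"
      using m by (metis card_2_iff less_irrefl, metis finite.emptyI finite.insertI,
        metis insert_subset empty_subsetI lessThan_iff less_trans)
  qed
  have "card (\<Union>M) = (\<Sum>e\<in>M. card e)" using e M by (intro card_Union_disjoint) auto
  also have "\<dots> = 2 * k" using e M by simp
  finally show ?thesis using e card_mono[of "{..<n}" "\<Union>M"] by auto
qed

context layout
begin

definition ok where "ok rg \<longleftrightarrow> rg 0 = n \<and> rg 1 = k \<and> rg 5 = q \<and> (\<forall>r. rg r < 2 ^ q)"

lemma bucket_less: "graph n E \<Longrightarrow> bucket n k q X E p < 2 ^ q"
  using bucket_le cell_value_less le_less_trans by blast

lemma double_less: "a < 2 ^ q \<Longrightarrow> a < 2 ^ (q + 1)" for a :: nat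
  by simp

lemma mem_bits_sketch:
  assumes "ok rg" "graph n E"
  shows "mem_bits (mem_of rg (bucket n k q X E) zeros) \<le> cap (q + 1)"
proof -
  note * = double_less
  have rg: "rg r < 2 ^ q" for r using assms(1) by (simp add: ok_def)
  have "fit (q + 1) (cap (q + 1)) (mem_of rg (bucket n k q X E) zeros)"
  proof (rule fit_memory)
    show "(2::nat) ^ j < 2 ^ (q + 1)" if "j < q" for j using that by (intro power_strict_increasing) auto
  qed (rule order_refl, rule *[OF rg], rule *[OF X], rule *[OF bucket_less[OF assms(2)]], simp)
  then show ?thesis by (simp add: fit_def)
qed

text \<open>All coins are read during initialization, so the tape does not change here. The bounds
  are maxima over the updates and hence independent of the length of the stream.\<close>

lemma process_live:
  assumes "legal_updates n E \<sigma>" "graph n E" "ok rg"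
  shows "\<exists>T m rg'. process update \<sigma> (mem_of rg (bucket n k q X E) zeros, \<omega>) T m
      (mem_of rg' (bucket n k q X (foldl apply_update E \<sigma>)) zeros, \<omega>)
    \<and> T \<le> upd_cost * q ^ 6 \<and> m \<le> cap (q + 1) + upd_cost * q ^ 6 \<and> ok rg'"
  using assms
proof (induction \<sigma> arbitrary: E rg)
  case Nil
  then show ?case by (auto intro!: exI process.Nil)
next
  case (Cons x \<sigma>)
  let ?c = "\<lambda>E. bucket n k q X E"
  have lx: "legal_update n E x" "legal_updates n (apply_update E x) \<sigma>" using Cons.prems(1) by auto
  note g' = legal_updates_graph[OF Cons.prems(2) lx(1)]
  note vs = legal_update_vertices[OF Cons.prems(2) lx(1)]
  have "\<exists>t m rg1 s1. feed x (mem_of rg (?c E) zeros, \<omega>) = (s1, \<omega>) \<and> mem_bits s1 \<le> cap (q + 1)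
    \<and> exec update (s1, \<omega>) t m (mem_of rg1 (?c (apply_update E x)) zeros, \<omega>) \<and> t \<le> upd_cost * q ^ 6 \<and> ok rg1"
  proof -
    define ins where "ins = (case x of Ins _ _ \<Rightarrow> True | Del _ _ \<Rightarrow> False)"
    define u where "u = (case x of Ins u v \<Rightarrow> u | Del u v \<Rightarrow> u)"
    define v where "v = (case x of Ins u v \<Rightarrow> v | Del u v \<Rightarrow> v)"
    \<comment> \<open>The graph without the updated edge, which is the form that
      \<open>update_correct\<close> takes for both operations.\<close>
    define E0 where "E0 = (if ins then E else E - {{u, v}})"
    have uv: "u < n" "v < n" "u \<noteq> v" using vs by (auto simp: u_def v_def split: edge_update.splits)
    have E: "E = (if ins then E0 else insert {u, v} E0)" "apply_update E x = (if ins then insert {u, v} E0 else E0)"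
      "{u, v} \<notin> E0"
      using lx(1) by (auto simp: ins_def u_def v_def E0_def split: edge_update.splits)
    have g: "graph n (insert {u, v} E0)" using Cons.prems(2) g' E by (cases ins) auto
    let ?rg = "rg(2 := of_bool ins, 3 := u, 4 := v)"
    have one: "1 < (2::nat) ^ q" using q_pos by (intro one_less_power) auto
    have okr: "ok ?rg" using Cons.prems(3) uv n_less one by (auto simp: ok_def)
    let ?s1 = "mem_of ?rg (?c E) zeros"
    have f: "feed x (mem_of rg (?c E) zeros, \<omega>) = (?s1, \<omega>)"
      by (cases x) (simp_all add: memory_write(1) ins_def u_def v_def)
    have "\<exists>t m. exec update (mem_of ?rg (?c (if ins then E0 else insert {u, v} E0)) zeros, \<omega>) t m
      (mem_of (?rg(7 := q ^ 5)) (?c (if ins then insert {u, v} E0 else E0)) zeros, \<omega>) \<and> t \<le> upd_cost * q ^ 6"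
      by (rule update_correct[OF g E(3) refl uv(3)]) (use okr in \<open>auto simp: ok_def\<close>)
    then obtain t m where "exec update (?s1, \<omega>) t m (mem_of (?rg(7 := q ^ 5)) (?c (apply_update E x)) zeros, \<omega>)"
      "t \<le> upd_cost * q ^ 6" unfolding E(1)[symmetric] E(2)[symmetric] by blast
    moreover have "ok (?rg(7 := q ^ 5))" using okr q5_less by (auto simp: ok_def)
    ultimately show ?thesis using f mem_bits_sketch[OF okr Cons.prems(2)] by blast
  qed
  then obtain t m rg1 s1 where s1: "feed x (mem_of rg (?c E) zeros, \<omega>) = (s1, \<omega>)" "mem_bits s1 \<le> cap (q + 1)"
    "exec update (s1, \<omega>) t m (mem_of rg1 (?c (apply_update E x)) zeros, \<omega>)" "t \<le> upd_cost * q ^ 6" "ok rg1" by blast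
  have m: "m \<le> cap (q + 1) + upd_cost * q ^ 6" using exec_mem[OF s1(3)] s1(2,4) by simp
  obtain T m' rg' where p: "process update \<sigma> (mem_of rg1 (?c (apply_update E x)) zeros, \<omega>) T m'
      (mem_of rg' (?c (foldl apply_update (apply_update E x) \<sigma>)) zeros, \<omega>)"
    "T \<le> upd_cost * q ^ 6" "m' \<le> cap (q + 1) + upd_cost * q ^ 6" "ok rg'"
    using Cons.IH[OF lx(2) g' s1(5)] by blast
  have "process update (x # \<sigma>) (mem_of rg (?c E) zeros, \<omega>) (max t T) (max m m')
      (mem_of rg' (?c (foldl apply_update E (x # \<sigma>))) zeros, \<omega>)"
    using process.Cons[of update x "(mem_of rg (?c E) zeros, \<omega>)"] s1(1,3) p(1) by simp
  then show ?case using p s1(4) m by (metis max.bounded_iff)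
qed

definition space_bound where
  "space_bound = max (cap (q + 1) + init_cost * (q + 1)) (max (cap (q + 1) + upd_cost * q ^ 6) qB)"

end

text \<open>Which of the two outcomes occurs depends on the tape only through \<open>X\<close>, that
  is, through a finite prefix.\<close>

lemma run_live:
  fixes \<omega> :: "bool stream"
  assumes k: "k \<ge> 1" "2 * k \<le> n" and l: "n \<le> 2 ^ l" "\<And>i. i < l \<Longrightarrow> 2 ^ i < n" and q: "q = 32 * (l + 5)"
    and \<sigma>: "dynamic_stream n \<sigma>"
  defines "X \<equiv> numbers q (stake (cNX k q * q) \<omega>)" and "E \<equiv> stream_graph \<sigma>"
  shows "\<exists>M T S. run matching_alg n k \<sigma> \<omega> M T S \<and> T \<le> upd_cost * q ^ 6 \<and> S \<le> layout.space_bound k q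
    \<and> (if \<exists>x<cN k q ^ k. found (bucket n k q X E) n k (cN k q) x then is_k_matching E k M else M = {})"
proof -
  interpret layout n k l q X
    by unfold_locales (use k l(1) q in \<open>auto simp: X_def numbers_less\<close>)
  have g: "graph n E" unfolding E_def stream_graph_def using \<sigma>
    by (intro graph_stream) (auto simp: dynamic_stream_def graph_def)
  obtain rg where rg: "runm (cap (q + 1) + init_cost * (q + 1)) init (initial_mem n k, \<omega>)
      (mem_of rg zeros zeros, sdrop (cNX k q * q) \<omega>)" "ok rg"
    using init_correct[OF l(2), of \<omega>] unfolding ok_def X_def by blast
  let ?\<omega> = "sdrop (cNX k q * q) \<omega>"
  have c0: "bucket n k q X {} = zeros" by (rule ext) (simp add: bucket_def)
  obtain T m1 rg1 where p: "process update \<sigma> (mem_of rg zeros zeros, ?\<omega>) T m1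
      (mem_of rg1 (bucket n k q X E) zeros, ?\<omega>)"
    "T \<le> upd_cost * q ^ 6" "m1 \<le> cap (q + 1) + upd_cost * q ^ 6" "ok rg1"
    using process_live[of "{}" \<sigma> rg ?\<omega>] \<sigma> rg(2) unfolding dynamic_stream_def E_def stream_graph_def c0
    by (auto simp: graph_def)
  have okr: "okr rg1"
    using p(4) less_W[OF double_less] unfolding ok_def okr_def by blast
  have oko: "oko zeros" by (simp add: oko_def)
  obtain s where s: "runm qB query (mem_of rg1 (bucket n k q X E) zeros, ?\<omega>) (s, ?\<omega>)"
    "if \<exists>x<cN k q ^ k. found (bucket n k q X E) n k (cN k q) x
       then \<exists>x. found (bucket n k q X E) n k (cN k q) x \<and> output_edges s
         = {{endpt (bucket n k q X E) n (cN k q) x (2 * i), endpt (bucket n k q X E) n (cN k q) x (2 * i + 1)} | i. i < k}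
       else output_edges s = {}"
    using query_correct[where c = "bucket n k q X E" and \<omega> = ?\<omega>, OF bucket_less[OF g] okr oko] by blast
  obtain t0 m0 where e0: "exec init (initial_mem n k, \<omega>) t0 m0 (mem_of rg zeros zeros, ?\<omega>)"
    "m0 \<le> cap (q + 1) + init_cost * (q + 1)" using rg(1) unfolding runm_def by blast
  obtain t2 m2 where e2: "exec query (mem_of rg1 (bucket n k q X E) zeros, ?\<omega>) t2 m2 (s, ?\<omega>)" "m2 \<le> qB"
    using s(1) unfolding runm_def by blast
  have "run matching_alg n k \<sigma> \<omega> (output_edges s) T (max m0 (max m1 m2))"
    by (rule run.intros) (use e0(1) p(1) e2(1) in \<open>auto simp: matching_alg_def\<close>)
  moreover have "max m0 (max m1 m2) \<le> space_bound"
    using e0(2) p(3) e2(2) by (auto simp: space_bound_def max_def)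
  moreover have "if \<exists>x<cN k q ^ k. found (bucket n k q X E) n k (cN k q) x
      then is_k_matching E k (output_edges s) else output_edges s = {}"
    using s(2) found_matching[OF g] by (auto split: if_splits)
  ultimately show ?thesis using p(2) by blast
qed

section \<open>Runs with \<open>2 * k > n\<close>\<close>

lemma bits_le_self: "x \<ge> 1 \<Longrightarrow> bits x \<le> x"
  by (rule bits_leI) simp_all

definition idle_mem :: "nat \<Rightarrow> nat \<Rightarrow> nat \<Rightarrow> nat \<Rightarrow> nat \<Rightarrow> mem" where
  "idle_mem n k b u v = (\<lambda>_. 0)(0 := n, 1 := k, 2 := b, 3 := u, 4 := v)"

lemma mem_bits_idle:
  assumes "b \<le> 1" "u \<le> n" "v \<le> n"
  shows "mem_bits (idle_mem n k b u v) \<le> 10 * (bits n + bits k + 7)"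
proof -
  let ?s0 = "(\<lambda>_. 0) :: mem"
  have "mem_bits ?s0 = 0" by (simp add: mem_bits_def)
  then have "mem_bits (idle_mem n k b u v) \<le> 0 + bits 0 + bits n + bits 1 + bits k + bits 2 + bits b + bits 3 + bits u + bits 4 + bits v"
    unfolding idle_mem_def
    using mem_bits_upd[of ?s0 0 n] mem_bits_upd[of "?s0(0 := n)" 1 k] mem_bits_upd[of "?s0(0 := n, 1 := k)" 2 b]
      mem_bits_upd[of "?s0(0 := n, 1 := k, 2 := b)" 3 u] mem_bits_upd[of "?s0(0 := n, 1 := k, 2 := b, 3 := u)" 4 v]
    by linarith
  moreover have "bits u \<le> bits n" "bits v \<le> bits n" "bits b \<le> 1"
    using assms by (auto intro: bits_mono bits_leI)
  moreover have "bits 0 \<le> 7" "bits 1 \<le> 7" "bits 2 \<le> 7" "bits 3 \<le> 7" "bits 4 \<le> 7" by (auto intro: bits_small)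
  ultimately show ?thesis by simp
qed

lemma vbound_idle:
  assumes "b \<le> 1" "u \<le> n" "v \<le> n"
  shows "vbound (bits n + bits k + 7) (idle_mem n k b u v)"
proof -
  let ?V = "bits n + bits k + 7"
  have le: "x < 2 ^ ?V" if "x < 2 ^ bits y" "bits y \<le> ?V" for x y :: nat
    using that by (meson less_le_trans one_le_numeral power_increasing)
  have "n < 2 ^ ?V" "k < 2 ^ ?V" by (rule le[OF less_two_power_bits]; simp)+
  moreover have "1 < (2 :: nat) ^ ?V" by (intro one_less_power) auto
  ultimately show ?thesis using assms by (auto simp: vbound_def idle_mem_def)
qed

lemma process_idle:
  assumes "legal_updates n E \<sigma>" "graph n E" "b \<le> 1" "u \<le> n" "v \<le> n"
  shows "\<exists>T m b' u' v'. process update \<sigma> (idle_mem n k b u v, \<omega>) T m (idle_mem n k b' u' v', \<omega>)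
    \<and> T \<le> 10 \<and> m \<le> 10 * (bits n + bits k + 7) \<and> b' \<le> 1 \<and> u' \<le> n \<and> v' \<le> n"
  using assms
proof (induction \<sigma> arbitrary: E b u v)
  case Nil
  then have "process update [] (idle_mem n k b u v, \<omega>) 0 0 (idle_mem n k b u v, \<omega>)" by (intro process.Nil)
  then show ?case using Nil by (metis le0)
next
  case (Cons x \<sigma>)
  have lx: "legal_update n E x" "legal_updates n (apply_update E x) \<sigma>" using Cons.prems(1) by auto
  note g' = legal_updates_graph[OF Cons.prems(2) lx(1)]
  note vs = legal_update_vertices[OF Cons.prems(2) lx(1)]
  obtain b1 u1 v1 where f: "feed x (idle_mem n k b u v, \<omega>) = (idle_mem n k b1 u1 v1, \<omega>)" "b1 \<le> 1" "u1 \<le> n" "v1 \<le> n"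
  proof (cases x)
    case (Ins u1 v1)
    show ?thesis by (rule that[of 1 u1 v1]) (use Ins vs in \<open>auto simp: idle_mem_def fun_upd_def fun_eq_iff\<close>)
  next
    case (Del u1 v1)
    show ?thesis by (rule that[of 0 u1 v1]) (use Del vs in \<open>auto simp: idle_mem_def fun_upd_def fun_eq_iff\<close>)
  qed
  let ?s = "idle_mem n k b1 u1 v1"
  have s5: "?s 5 = 0" by (simp add: idle_mem_def)
  have e: "exec update (?s, \<omega>) (1 + operand_cost (Cell (Dir 5)) ?s + 1) (mem_bits ?s) (?s, \<omega>)"
    unfolding update_def by (rule exec.IfFalse[OF _ exec.Skip]) (simp add: s5)
  have t: "1 + operand_cost (Cell (Dir 5)) ?s + 1 \<le> 10" using bits_small[of 5] by (simp add: s5 bits_0)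
  obtain T m b' u' v' where p: "process update \<sigma> (?s, \<omega>) T m (idle_mem n k b' u' v', \<omega>)"
    "T \<le> 10" "m \<le> 10 * (bits n + bits k + 7)" "b' \<le> 1" "u' \<le> n" "v' \<le> n"
    using Cons.IH[OF lx(2) g' f(2-4)] by blast
  have "process update (x # \<sigma>) (idle_mem n k b u v, \<omega>) (max (1 + operand_cost (Cell (Dir 5)) ?s + 1) T)
      (max (mem_bits ?s) m) (idle_mem n k b' u' v', \<omega>)"
    by (rule process.Cons[OF _ p(1)]) (use e f(1) in simp)
  moreover have "max (1 + operand_cost (Cell (Dir 5)) ?s + 1) T \<le> 10" using t p(2) by simp
  moreover have "max (mem_bits ?s) m \<le> 10 * (bits n + bits k + 7)" using mem_bits_idle[OF f(2-4)] p(3) by simp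
  ultimately show ?case using p(4-6) by blast
qed

text \<open>Here \<open>k\<close> may be far larger than \<open>n\<close>, so its bit length is kept
  as a separate term.\<close>

lemma run_idle:
  assumes nk: "n < 2 * k" and \<sigma>: "dynamic_stream n \<sigma>"
  shows "\<exists>T S. run matching_alg n k \<sigma> \<omega> {} T S \<and> T \<le> 10
    \<and> S \<le> (10 + init_cost + query_cost) * (bits n + bits k + 7)"
proof -
  let ?V = "bits n + bits k + 7"
  let ?s0 = "idle_mem n k 0 0 0"
  have s0: "initial_mem n k = ?s0" by (rule ext) (simp add: initial_mem_def idle_mem_def)
  have fit: "fit ?V (10 * ?V) (idle_mem n k b u v)" if "b \<le> 1" "u \<le> n" "v \<le> n" for b u v
    using vbound_idle[OF that] mem_bits_idle[OF that] by (auto simp: fit_def clean_def idle_mem_def)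
  have "runm (10 * ?V + init_cost * ?V) init_flag (?s0, \<omega>) (?s0, \<omega>)"
    unfolding init_flag_def
    by (rule fit_Store[OF fit]) (use nk in \<open>auto simp: init_cost_def idle_mem_def fun_eq_iff\<close>)
  moreover have "exec (If (Cell (Dir 5)) init_main Skip) (?s0, \<omega>) (1 + operand_cost (Cell (Dir 5)) ?s0 + 1) (mem_bits ?s0) (?s0, \<omega>)"
    by (rule exec.IfFalse[OF _ exec.Skip]) (simp add: idle_mem_def)
  then have "runm (10 * ?V + init_cost * ?V) (If (Cell (Dir 5)) init_main Skip) (?s0, \<omega>) (?s0, \<omega>)"
    unfolding runm_def using mem_bits_idle[of 0 0 n 0 k] trans_le_add1 by blast
  ultimately have "runm (10 * ?V + init_cost * ?V) init (?s0, \<omega>) (?s0, \<omega>)" unfolding init_def by (rule runm_Seq)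
  then obtain t0 m0 where 0: "exec init (?s0, \<omega>) t0 m0 (?s0, \<omega>)" "m0 \<le> 10 * ?V + init_cost * ?V"
    unfolding runm_def by blast
  obtain T m1 b u v where 1: "process update \<sigma> (?s0, \<omega>) T m1 (idle_mem n k b u v, \<omega>)"
    "T \<le> 10" "m1 \<le> 10 * ?V" "b \<le> 1" "u \<le> n" "v \<le> n"
    using process_idle[of n "{}" \<sigma> 0 0 0 k \<omega>] \<sigma> by (auto simp: dynamic_stream_def graph_def)
  let ?s = "idle_mem n k b u v"
  have "runm (10 * ?V + query_cost * ?V) (Store (Nm 2) (Nm 0)) (?s, \<omega>) (?s(2 := 0), \<omega>)"
    by (rule fit_Store[OF fit[OF 1(4-6)]]) (auto simp: query_cost_def)
  then obtain t2 m2 where 2: "exec (Store (Nm 2) (Nm 0)) (?s, \<omega>) t2 m2 (?s(2 := 0), \<omega>)" "m2 \<le> 10 * ?V + query_cost * ?V"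
    unfolding runm_def by blast
  have 3: "exec query (?s, \<omega>) (1 + operand_cost (Cell (Dir 5)) ?s + t2) m2 (?s(2 := 0), \<omega>)"
    unfolding query_def by (rule exec.IfFalse[OF _ 2(1)]) (simp add: idle_mem_def)
  have "run matching_alg n k \<sigma> \<omega> (output_edges (?s(2 := 0))) T (max m0 (max m1 m2))"
    by (rule run.intros) (use 0(1) 1(1) 3 s0 in \<open>auto simp: matching_alg_def\<close>)
  moreover have "output_edges (?s(2 := 0)) = {}" by (simp add: output_edges_def)
  moreover have "max m0 (max m1 m2) \<le> (10 + init_cost + query_cost) * ?V"
    using 0(2) 1(3) 2(2) by (simp add: add_mult_distrib)
  ultimately show ?thesis using 1(2) by metis
qed

section \<open>Space and failure probability in closed form\<close>

context layout
begin

text \<open>The buckets dominate: \<open>cN k q\<close> is \<open>1024 * (k ^ 2 * q ^ 9)\<close>,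
  with five factors \<open>q\<close> from the families and four from the two label ranges.\<close>

lemma aE_le: "aE k q \<le> 1641 * (k ^ 2 * q ^ 9)" and bits_aE_le: "bits (aE k q) \<le> q + 3"
proof -
  have q9: "q ^ 9 = q ^ 5 * (q ^ 2 * q ^ 2)" by (simp only: power_add[symmetric]) simp
  have k1: "1 \<le> k ^ 2" "k \<le> k ^ 2" using k by (simp_all add: power2_eq_square)
  have qp: "q \<le> q ^ 9" "q ^ 2 \<le> q ^ 9" using q_pos by (auto intro: power_increasing simp: self_le_power)
  have "100 + q \<le> 2 * q" using q_pos by simp
  also have "\<dots> \<le> 2 * (k ^ 2 * q ^ 9)" using mult_le_mono[OF k1(1) qp(1)] by simp
  finally have 1: "100 + q \<le> 2 * (k ^ 2 * q ^ 9)" .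
  have "cNX k q \<le> q * (2 * q) * (257 * k ^ 2)"
    unfolding cNX_def cR_def using k1 q_pos by (intro mult_le_mono) auto
  also have "\<dots> = 514 * (k ^ 2 * q ^ 2)" by (simp add: power2_eq_square)
  also have "\<dots> \<le> 514 * (k ^ 2 * q ^ 9)" using qp(2) by simp
  finally have 2: "cNX k q \<le> 514 * (k ^ 2 * q ^ 9)" .
  have 3: "cN k q = 1024 * (k ^ 2 * q ^ 9)"
    unfolding q9 by (simp add: cN_def cQ_def cS_def cG_def power2_eq_square mult_ac)
  have "1 \<le> q ^ 9" using q_pos by simp
  then have "k \<le> k ^ 2 * q ^ 9" using mult_le_mono[OF k1(2), of 1 "q ^ 9"] by simp
  then show "aE k q \<le> 1641 * (k ^ 2 * q ^ 9)"
    using 1 2 3 unfolding aE_def aO_def aC_def aX_def by linarith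
next
  have "2 * k < 2 ^ q" using kn n_less by simp
  moreover have "cN k q < 2 ^ q" by (rule cN_less)
  moreover have "cNX k q < 2 ^ q"
  proof (rule le_less_trans[OF _ cNX_less])
    have "1 \<le> q" using q_pos by simp
    from mult_le_mono2[OF this, of "cNX k q"] show "cNX k q \<le> cNX k q * q" unfolding mult_1_right .
  qed
  moreover have "100 + q < 2 * 2 ^ q"
  proof -
    have "100 + q \<le> 2 * q" using q_pos by simp
    also have "\<dots> < 2 * 2 ^ q" using less_exp[of q] by simp
    finally show ?thesis .
  qed
  ultimately have "aE k q < 8 * 2 ^ q" unfolding aE_def aO_def aC_def aX_def by linarith
  also have "\<dots> = 2 ^ (q + 3)" by (simp add: power_add)
  finally show "bits (aE k q) \<le> q + 3" by (rule bits_leI) simp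
qed

text \<open>At most \<open>q + 3\<close> bits of address and \<open>q + 1\<close> bits of contents
  make at most \<open>3 * q\<close> per cell, whence \<open>3 * 1641 = 4923\<close>; adding 140 for
  the registers gives 5063.\<close>

lemma cap_le: "cap V \<le> 20 * V + 5063 * (k ^ 2 * q ^ 10)"
proof -
  have "aE k q * (bits (aE k q) + (q + 1)) \<le> 1641 * (k ^ 2 * q ^ 9) * (3 * q)"
    using bits_aE_le q_pos by (intro mult_le_mono aE_le) auto
  also have "\<dots> = 4923 * (k ^ 2 * q ^ 10)" using power_add[of q 9 1] by simp
  finally have "cap V \<le> 20 * V + 140 + 4923 * (k ^ 2 * q ^ 10)" by (simp add: cap_def)
  moreover have "1 \<le> k ^ 2 * q ^ 10" using k q_pos by simp
  ultimately show ?thesis by linarith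
qed

text \<open>The long registers do no harm: there are only 20 of them, and \<open>q * k\<close> is at
  most \<open>k ^ 2 * q ^ 10\<close>.\<close>

lemma space_bound_le:
  "space_bound \<le> (5123 + 2 * init_cost + upd_cost + 3 * query_cost) * (k ^ 2 * q ^ 10)"
proof -
  define Z where "Z = k ^ 2 * q ^ 10"
  have k1: "1 \<le> k ^ 2" "k \<le> k ^ 2" using k by (simp_all add: power2_eq_square)
  have qp: "q \<le> q ^ 10" "q ^ 6 \<le> q ^ 10" "1 \<le> q ^ 10" using q_pos by (auto intro: power_increasing simp: self_le_power)
  have q': "q \<le> Z" and 6: "q ^ 6 \<le> Z" and one: "1 \<le> Z" and qk: "q * k \<le> Z"
    using mult_le_mono[OF k1(1) qp(1)] mult_le_mono[OF k1(1) qp(2)] mult_le_mono[OF k1(1) qp(3)] mult_le_mono[OF k1(2) qp(1)]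
    by (simp_all add: Z_def mult.commute)
  have W: "W \<le> 3 * Z" using qk one unfolding W_def by linarith
  have q1: "q + 1 \<le> 2 * Z" using q' one by linarith
  have cap: "cap V \<le> 20 * V + 5063 * Z" for V unfolding Z_def by (rule cap_le)
  \<comment> \<open>5123 is \<open>20 * 3 + 5063\<close>, from \<open>cap_le\<close> with
    \<open>V\<close> at most \<open>3 * Z\<close>.\<close>
  have c1: "cap V \<le> 5123 * Z" if "V \<le> 3 * Z" for V
  proof -
    have "cap V \<le> 20 * V + 5063 * Z" by (rule cap)
    also have "\<dots> \<le> 20 * (3 * Z) + 5063 * Z" by (intro add_mono mult_le_mono2 that order_refl)
    finally show ?thesis by simp
  qed
  have q1': "q + 1 \<le> 3 * Z" by (rule order_trans[OF q1]) simp
  have 1: "cap (q + 1) + init_cost * (q + 1) \<le> 5123 * Z + init_cost * (2 * Z)"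
    by (intro add_mono mult_le_mono2 c1 q1 q1')
  have 2: "cap (q + 1) + upd_cost * q ^ 6 \<le> 5123 * Z + upd_cost * Z"
    by (intro add_mono mult_le_mono2 c1 q1' 6)
  have 3: "qB \<le> 5123 * Z + query_cost * (3 * Z)"
    unfolding qB_def by (intro add_mono mult_le_mono2 c1 W)
  have e: "(5123 + 2 * init_cost + upd_cost + 3 * query_cost) * Z
      = 5123 * Z + (init_cost * (2 * Z) + (upd_cost * Z + query_cost * (3 * Z)))"
    by (simp add: algebra_simps)
  have "x \<le> z + (i + (u + w))" if "x \<le> z + i \<or> x \<le> z + u \<or> x \<le> z + w" for x z i u w :: nat
    using that by auto
  then show ?thesis unfolding space_bound_def Z_def[symmetric] e using 1 2 3 by (simp only: max.bounded_iff) blast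
qed

end

lemma prob_success:
  fixes n k l q :: nat and \<sigma> :: "edge_update list"
  assumes k: "k \<ge> 1" "2 * k \<le> n" and l: "n \<le> 2 ^ l" and q: "q = 32 * (l + 5)"
    and g: "graph n E" and M: "is_k_matching E k M"
  shows "measure coin_tape {\<omega> \<in> space coin_tape.
      \<exists>x<cN k q ^ k. found (bucket n k q (numbers q (stake (cNX k q * q) \<omega>)) E) n k (cN k q) x} \<ge> 1 - (1 / 2) ^ q"
proof -
  have ME: "M \<subseteq> E" "finite M" "card M = k" using M by (auto simp: is_k_matching_def is_matching_def)
  interpret s: sampling n k l "pairs E" "pairs M"
  proof
    show "pairs E \<subseteq> {..<n} \<times> {..<n}"
      using graph_edge(1,2)[OF g] by (auto simp: pairs_def intro: less_trans)
    show "card (pairs M) \<le> k" using ME unfolding pairs_def by (metis card_image_le)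
  qed (use k l ME in \<open>auto simp: pairs_def\<close>)
  have sq: "s.q = q" by (simp add: s.q_def q)
  have sN: "s.NX = cNX k q" by (simp add: s.NX_def cNX_def sq s.RR_def cR_def)
  interpret prob_space coin_tape by (rule prob_space_coin_tape)
  have "1 - (1 / 2) ^ q \<le> measure coin_tape {\<omega> \<in> space coin_tape. \<exists>a<q. s.good (s.repY (numbers q (stake (cNX k q * q) \<omega>)) a)}"
    using s.prob_some_rep_good unfolding sq sN .
  also have "\<dots> \<le> measure coin_tape {\<omega> \<in> space coin_tape.
      \<exists>x<cN k q ^ k. found (bucket n k q (numbers q (stake (cNX k q * q) \<omega>)) E) n k (cN k q) x}"
  proof (rule finite_measure_mono)
    show "{\<omega> \<in> space coin_tape. \<exists>a<q. s.good (s.repY (numbers q (stake (cNX k q * q) \<omega>)) a)}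
      \<subseteq> {\<omega> \<in> space coin_tape. \<exists>x<cN k q ^ k. found (bucket n k q (numbers q (stake (cNX k q * q) \<omega>)) E) n k (cN k q) x}"
      using found_if_good[OF k l q g M] by blast
    show "{\<omega> \<in> space coin_tape. \<exists>x<cN k q ^ k. found (bucket n k q (numbers q (stake (cNX k q * q) \<omega>)) E) n k (cN k q) x}
      \<in> sets coin_tape"
      by (rule sets_coin_tape[of "\<lambda>bs. \<exists>x<cN k q ^ k. found (bucket n k q (numbers q bs) E) n k (cN k q) x"])
  qed
  finally show ?thesis .
qed

text \<open>\<open>ln x \<le> x\<close> bounds the denominator by \<open>40 * k ^ 4\<close>, and
  \<open>k \<le> 2 ^ l\<close> makes this at most \<open>2 ^ (6 + l * 4)\<close>, below
  \<open>2 ^ q\<close>.\<close>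

lemma failure_bound:
  fixes n k l q :: nat
  assumes k: "k \<ge> 1" "2 * k \<le> n" and l: "n \<le> 2 ^ l" and q: "q = 32 * (l + 5)"
  shows "(1 / 2) ^ q \<le> 11 / (20 * real k ^ 3 * ln (2 * real k))"
proof -
  have kr: "real k \<ge> 1" using k by simp
  have ln0: "ln (2 * real k) > 0" using kr by simp
  have "20 * real k ^ 3 * ln (2 * real k) \<le> 20 * real k ^ 3 * (2 * real k)"
    using kr ln_le_minus_one[of "2 * real k"] by (intro mult_left_mono) auto
  also have "\<dots> = 40 * real k ^ 4" by (simp add: power3_eq_cube power4_eq_xxxx)
  also have "\<dots> \<le> 40 * (2 ^ l) ^ 4"
  proof -
    have "k \<le> 2 ^ l" using k l by simp
    then have "real k \<le> 2 ^ l" by (metis of_nat_le_iff of_nat_numeral of_nat_power)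
    then show ?thesis by (intro mult_left_mono power_mono) auto
  qed
  also have "\<dots> \<le> 2 ^ 6 * (2 ^ l) ^ 4" by simp
  also have "\<dots> = 2 ^ (6 + l * 4)" by (simp only: power_add power_mult)
  also have "\<dots> \<le> 2 ^ q" using q by (intro power_increasing) auto
  also have "(2::real) ^ q \<le> 11 * 2 ^ q" by simp
  finally have "20 * real k ^ 3 * ln (2 * real k) \<le> 11 * 2 ^ q" .
  moreover have "20 * real k ^ 3 * ln (2 * real k) > 0" using kr ln0 by simp
  ultimately show ?thesis by (simp add: power_divide field_simps)
qed

theorem theorem11:
  shows "\<exists>A :: stream_alg. \<forall>b :: nat. \<exists>(C :: real) (c :: nat). \<forall>(n :: nat) (k :: nat) (\<sigma> :: edge_update list).
    k \<ge> 1 \<longrightarrow> dynamic_stream n \<sigma> \<longrightarrow> length \<sigma> \<le> b * n ^ b \<longrightarrow>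
      (\<forall>\<omega>. \<exists>M T S. run A n k \<sigma> \<omega> M T S
         \<and> is_matching (stream_graph \<sigma>) M
         \<and> ((\<nexists>M'. is_k_matching (stream_graph \<sigma>) k M') \<longrightarrow> M = {})
         \<and> real S \<le> C * real k ^ 2 * log 2 (real n + 2) ^ c
         \<and> real T \<le> C * log 2 (real n + 2) ^ c)
    \<and> ((\<exists>M'. is_k_matching (stream_graph \<sigma>) k M') \<longrightarrow>
         {\<omega> \<in> space coin_tape. \<exists>M T S. run A n k \<sigma> \<omega> M T S \<and> is_k_matching (stream_graph \<sigma>) k M}
           \<in> sets coin_tape
       \<and> measure coin_tape
           {\<omega> \<in> space coin_tape. \<exists>M T S. run A n k \<sigma> \<omega> M T S \<and> is_k_matching (stream_graph \<sigma>) k M}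
           \<ge> 1 - 11 / (20 * real k ^ 3 * ln (2 * real k)))"
proof -
  \<comment> \<open>The coefficients of \<open>space_bound_le\<close> and \<open>run_idle\<close>
    are added so that one constant serves both cases; \<open>224 ^ 10\<close> comes from
    \<open>q \<le> 224 * Lg\<close>.\<close>
  define K where "K = 5123 + 2 * init_cost + upd_cost + 3 * query_cost + 10 * (10 + init_cost + query_cost)"
  define C where "C = real K * 224 ^ 10"
  have main: "(\<forall>\<omega>. \<exists>M T S. run matching_alg n k \<sigma> \<omega> M T S
         \<and> is_matching (stream_graph \<sigma>) M
         \<and> ((\<nexists>M'. is_k_matching (stream_graph \<sigma>) k M') \<longrightarrow> M = {})
         \<and> real S \<le> C * real k ^ 2 * log 2 (real n + 2) ^ 10
         \<and> real T \<le> C * log 2 (real n + 2) ^ 10)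
    \<and> ((\<exists>M'. is_k_matching (stream_graph \<sigma>) k M') \<longrightarrow>
         {\<omega> \<in> space coin_tape. \<exists>M T S. run matching_alg n k \<sigma> \<omega> M T S \<and> is_k_matching (stream_graph \<sigma>) k M}
           \<in> sets coin_tape
       \<and> measure coin_tape
           {\<omega> \<in> space coin_tape. \<exists>M T S. run matching_alg n k \<sigma> \<omega> M T S \<and> is_k_matching (stream_graph \<sigma>) k M}
           \<ge> 1 - 11 / (20 * real k ^ 3 * ln (2 * real k)))"
    if k: "k \<ge> 1" and \<sigma>: "dynamic_stream n \<sigma>" for n k \<sigma>
  proof -
    let ?E = "stream_graph \<sigma>"
    define Lg where "Lg = log 2 (real n + 2)"
    have Lg: "Lg \<ge> 1" unfolding Lg_def by (simp add: le_log_iff)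
    have g: "graph n ?E" unfolding stream_graph_def using \<sigma>
      by (intro graph_stream) (auto simp: dynamic_stream_def graph_def)
    have empty: "is_matching ?E {}" by (simp add: is_matching_def)
    have k2: "1 \<le> real k ^ 2" using k by simp
    have Lp: "1 \<le> Lg ^ m" for m using Lg by simp
    show ?thesis
    proof (cases "2 * k \<le> n")
      case False
      then have nM: "\<nexists>M'. is_k_matching ?E k M'" using k_matching_size[OF g] by blast
      have "\<exists>M T S. run matching_alg n k \<sigma> \<omega> M T S \<and> is_matching ?E M
         \<and> ((\<nexists>M'. is_k_matching ?E k M') \<longrightarrow> M = {})
         \<and> real S \<le> C * real k ^ 2 * Lg ^ 10 \<and> real T \<le> C * Lg ^ 10" for \<omega>
      proof -
        obtain T S where r: "run matching_alg n k \<sigma> \<omega> {} T S" "T \<le> 10"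
          "S \<le> (10 + init_cost + query_cost) * (bits n + bits k + 7)"
          using run_idle[OF _ \<sigma>] False by (meson not_le)
        have "real (bits n) \<le> Lg + 1"
        proof -
          let ?m = "nat \<lceil>Lg\<rceil>"
          have "real n < 2 powr Lg" unfolding Lg_def by simp
          also have "\<dots> \<le> 2 powr real ?m" by (intro powr_mono) linarith+
          also have "\<dots> = real (2 ^ ?m)" by (simp add: powr_realpow)
          finally have "n < 2 ^ ?m" by (simp only: of_nat_less_iff)
          moreover have "?m \<ge> 1" using Lg by linarith
          ultimately have "bits n \<le> ?m" by (rule bits_leI)
          then show ?thesis using Lg by linarith
        qed
        \<comment> \<open>Nothing bounds \<open>k\<close> in terms of \<open>n\<close> here, but its
          bit length is at most \<open>k \<le> k ^ 2\<close>.\<close>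
        moreover have "real (bits k) \<le> real k" using bits_le_self[OF k] by simp
        moreover have "real k \<le> real k ^ 2" using k by (simp add: power2_eq_square)
        moreover have "real k ^ 2 \<le> real k ^ 2 * Lg ^ 10" "Lg \<le> real k ^ 2 * Lg ^ 10"
        proof -
          show "real k ^ 2 \<le> real k ^ 2 * Lg ^ 10" using Lp[of 10] by (intro mult_le_cancel_left1[THEN iffD2]) auto
          have "1 * Lg ^ 1 \<le> real k ^ 2 * Lg ^ 10" using k2 Lg by (intro mult_mono power_increasing) auto
          then show "Lg \<le> real k ^ 2 * Lg ^ 10" by simp
        qed
        ultimately have "real (bits n) + real (bits k) + 7 \<le> 10 * (real k ^ 2 * Lg ^ 10)" using k2 by linarith
        then have b: "real (bits n + bits k + 7) \<le> 10 * (real k ^ 2 * Lg ^ 10)" by simp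
        have "real S \<le> real ((10 + init_cost + query_cost) * (bits n + bits k + 7))" using r(3) by (simp only: of_nat_le_iff)
        also have "\<dots> = real (10 + init_cost + query_cost) * real (bits n + bits k + 7)" by (rule of_nat_mult)
        also have "\<dots> \<le> real (10 + init_cost + query_cost) * (10 * (real k ^ 2 * Lg ^ 10))"
          using b by (rule mult_left_mono) simp
        also have "\<dots> = (real (10 * (10 + init_cost + query_cost))) * (real k ^ 2 * Lg ^ 10)" by simp
        also have "\<dots> \<le> C * (real k ^ 2 * Lg ^ 10)" using Lg by (intro mult_right_mono) (simp_all add: C_def K_def)
        finally have S: "real S \<le> C * real k ^ 2 * Lg ^ 10" by (simp add: mult.assoc)
        have "real T \<le> 10" using r(2) by simp
        also have "10 \<le> C" by (simp add: C_def K_def)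
        also have "C * 1 \<le> C * Lg ^ 10" using Lp[of 10] by (intro mult_left_mono) (simp_all add: C_def)
        finally have "real T \<le> C * Lg ^ 10" by simp
        then show ?thesis using r(1) empty S by blast
      qed
      then show ?thesis using nM unfolding Lg_def by blast
    next
      case True
      define l where "l = (LEAST l. n \<le> 2 ^ l)"
      have l: "n \<le> 2 ^ l" unfolding l_def by (rule LeastI[of _ n]) (rule less_imp_le[OF less_exp])
      have l': "2 ^ i < n" if "i < l" for i using not_less_Least[of i "\<lambda>l. n \<le> 2 ^ l"] that by (simp add: l_def)
      define q where "q = 32 * (l + 5)"
      have lL: "real l \<le> Lg + 1"
      proof (cases l)
        case (Suc j)
        then have "2 ^ j < n" using l' by simp
        then have "real (2 ^ j) < real n" by (simp only: of_nat_less_iff)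
        moreover have "2 powr real j = real (2 ^ j)" by (simp add: powr_realpow)
        ultimately have "2 powr real j \<le> real n + 2" by linarith
        then have "real j \<le> Lg" unfolding Lg_def by (simp add: le_log_iff)
        then show ?thesis using Suc by simp
      qed (use Lg in simp)
      \<comment> \<open>\<open>32 * (l + 5)\<close> is at most \<open>32 * (Lg + 6)\<close>, and
        \<open>Lg \<ge> 1\<close>.\<close>
      then have qL: "real q \<le> 224 * Lg" using Lg by (simp add: q_def)
      let ?X = "\<lambda>\<omega>. numbers q (stake (cNX k q * q) \<omega>)"
      let ?F = "\<lambda>\<omega>. \<exists>x<cN k q ^ k. found (bucket n k q (?X \<omega>) ?E) n k (cN k q) x"
      note live = run_live[OF k True l l' q_def \<sigma>]
      have sb: "layout.space_bound k q \<le> K * (k ^ 2 * q ^ 10)"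
      proof -
        interpret layout n k l q "\<lambda>_. 0" by unfold_locales (use k True l q_def in auto)
        have "space_bound \<le> (5123 + 2 * init_cost + upd_cost + 3 * query_cost) * (k ^ 2 * q ^ 10)"
          by (rule space_bound_le)
        also have "\<dots> \<le> K * (k ^ 2 * q ^ 10)" by (intro mult_le_mono1) (simp add: K_def)
        finally show ?thesis .
      qed
      have q10: "real q ^ 10 \<le> 224 ^ 10 * Lg ^ 10"
        using power_mono[OF qL, of 10] by (simp add: power_mult_distrib)
      have result: "\<exists>M T S. run matching_alg n k \<sigma> \<omega> M T S \<and> is_matching ?E M
         \<and> ((\<nexists>M'. is_k_matching ?E k M') \<longrightarrow> M = {})
         \<and> real S \<le> C * real k ^ 2 * Lg ^ 10 \<and> real T \<le> C * Lg ^ 10" for \<omega>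
      proof -
        obtain M T S where r: "run matching_alg n k \<sigma> \<omega> M T S" "T \<le> upd_cost * q ^ 6" "S \<le> layout.space_bound k q"
          "if ?F \<omega> then is_k_matching ?E k M else M = {}" using live[of \<omega>] by blast
        have "is_matching ?E M" "(\<nexists>M'. is_k_matching ?E k M') \<longrightarrow> M = {}"
          using r(4) empty by (auto simp: is_k_matching_def split: if_splits)
        moreover have "real S \<le> C * real k ^ 2 * Lg ^ 10"
        proof -
          have "real S \<le> real (K * (k ^ 2 * q ^ 10))" using order_trans[OF r(3) sb] by (simp only: of_nat_le_iff)
          also have "\<dots> = real K * (real k ^ 2 * real q ^ 10)" by simp
          also have "\<dots> \<le> real K * (real k ^ 2 * (224 ^ 10 * Lg ^ 10))" using q10 by (intro mult_left_mono) auto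
          finally show ?thesis by (simp add: C_def mult_ac)
        qed
        moreover have "real T \<le> C * Lg ^ 10"
        proof -
          have "q ^ 6 \<le> q ^ 10" by (intro power_increasing) (auto simp: q_def)
          then have "T \<le> K * q ^ 10" using order_trans[OF r(2) mult_le_mono[of upd_cost K]] by (simp add: K_def)
          then have "real T \<le> real (K * q ^ 10)" by (simp only: of_nat_le_iff)
          also have "\<dots> = real K * real q ^ 10" by simp
          also have "\<dots> \<le> real K * (224 ^ 10 * Lg ^ 10)" using q10 by (intro mult_left_mono) auto
          finally show ?thesis by (simp add: C_def)
        qed
        ultimately show ?thesis using r(1) by blast
      qed
      \<comment> \<open>Runs are deterministic, so success is equivalent to \<open>?F\<close>, an
        event about a finite prefix; this gives both measurability and probability.\<close>
      have event: "{\<omega> \<in> space coin_tape. \<exists>M T S. run matching_alg n k \<sigma> \<omega> M T S \<and> is_k_matching ?E k M}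
          = {\<omega> \<in> space coin_tape. ?F \<omega>}"
      proof (intro Collect_cong conj_cong refl)
        fix \<omega>
        obtain M T S where r: "run matching_alg n k \<sigma> \<omega> M T S" "if ?F \<omega> then is_k_matching ?E k M else M = {}"
          using live[of \<omega>] by blast
        \<comment> \<open>As \<open>k \<ge> 1\<close>, the empty output is no
          \<open>k\<close>-matching, so success forces \<open>?F\<close>.\<close>
        have ne: "\<not> is_k_matching ?E k {}" using k by (simp add: is_k_matching_def)
        show "(\<exists>M T S. run matching_alg n k \<sigma> \<omega> M T S \<and> is_k_matching ?E k M) = ?F \<omega>"
        proof
          assume "\<exists>M T S. run matching_alg n k \<sigma> \<omega> M T S \<and> is_k_matching ?E k M"
          then have "is_k_matching ?E k M" using run_deterministic[OF r(1)] by blast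
          then show "?F \<omega>" using r(2) ne by (auto split: if_splits)
        qed (use r in auto)
      qed
      have measurable: "{\<omega> \<in> space coin_tape. ?F \<omega>} \<in> sets coin_tape"
        by (rule sets_coin_tape[of "\<lambda>bs. \<exists>x<cN k q ^ k. found (bucket n k q (numbers q bs) ?E) n k (cN k q) x"])
      have prob: "measure coin_tape {\<omega> \<in> space coin_tape. ?F \<omega>} \<ge> 1 - 11 / (20 * real k ^ 3 * ln (2 * real k))"
        if "is_k_matching ?E k M'" for M'
        using prob_success[OF k True l q_def g that] failure_bound[OF k True l q_def] by linarith
      show ?thesis
      proof (intro conjI allI impI, goal_cases)
        case (1 \<omega>)
        show ?case unfolding Lg_def[symmetric] by (rule result)
      next
        case 2
        show ?case unfolding event by (rule measurable)
      next
        case 3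
        then show ?case unfolding event by (elim exE) (rule prob)
      qed
    qed
  qed
  show ?thesis
    by (rule exI[of _ matching_alg], rule allI, rule exI[of _ C], rule exI[of _ 10], intro allI impI, rule main)
qed

end
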